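(* Let $n\ge d\ge 2$ be integers and let $\boldsymbol{\mu}=(\mu_1,\dots,\mu_d)$ be a $d$-part partition satisfying $d\le|\boldsymbol{\mu}|\le n$. Then $\mathcal{P}_{n,d}^{\boldsymbol{\mu}}$ is a Zariski open subset of a subvariety of $R_n^{d+1}$. Furthermore, $\mathcal{P}_{n,d}^{\boldsymbol{\mu}}$ is irreducible of dimension $$\dim(\mathcal{P}_{n,d}^{\boldsymbol{\mu}})=d|\boldsymbol{\mu}|+d+n+1-\sum_{i>j}\max(0,\mu_i-\mu_j-1).$$
   Context: $\mathsf{k}$ is an arbitrary infinite field, $R=\mathsf{k}[s,t]$ with the standard grading, and $R_n$ is the space of homogeneous polynomials of degree $n$. A $d$-part partition is a tuple of integers $\boldsymbol{\mu}=(\mu_1,\dots,\mu_d)$ with $1\le\mu_1\le\cdots\le\mu_d$; put $|\boldsymbol{\mu}|=\mu_1+\cdots+\mu_d$. For linearly independent $a_0,\dots,a_d\in R_n$ with $I=\langle a_0,\dots,a_d\rangle\subseteq R$, there is a graded exact sequence $0\to\bigoplus_{i=1}^d R(-n-\mu_i)\to R(-n)^{d+1}\xrightarrow{(a_0,\dots,a_d)} I\to 0$ with uniquely determined integers $1\le\mu_1\le\cdots\le\mu_d$; the tuple $\boldsymbol{\mu}=(\mu_1,\dots,\mu_d)$ is called the $\boldsymbol{\mu}$-type (or type) of $(a_0,\dots,a_d)$. One has $|\boldsymbol{\mu}|=n-\deg\gcd(a_0,\dots,a_d)$. $\mathcal{CP}_{n,d}\subseteq R_n^{d+1}$ is the set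 of all linearly independent $(a_0,\dots,a_d)$ (a common factor is allowed), and for a $d$-part partition $\boldsymbol{\mu}$ with $|\boldsymbol{\mu}|\le n$, $\mathcal{P}_{n,d}^{\boldsymbol{\mu}}\subseteq\mathcal{CP}_{n,d}$ is the subset of those of type $\boldsymbol{\mu}$. "Subvariety" means Zariski closed subset. Sums over $i>j$ range over $1\le j<i\le d$. *)

theory Defs
  imports
    "HOL-Analysis.Abstract_Topology"
    "HOL-Library.Extended_Real"
    "HOL-Computational_Algebra.Polynomial"
begin

section \<open>Zariski topology\<close>

text \<open>
  A space of points \<open>S\<close> is given together with a set \<open>C\<close> of coordinate functions on it.
  The polynomial functions are the \<open>k\<close>-valued functions that are polynomial expressions in the
  coordinates, and closed sets are the common zero loci in \<open>S\<close> of sets of polynomial functions.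
\<close>

inductive_set polynomial_functions :: "('a \<Rightarrow> 'k::comm_ring_1) set \<Rightarrow> ('a \<Rightarrow> 'k) set"
  for C :: "('a \<Rightarrow> 'k) set" where
  coordinate: "f \<in> C \<Longrightarrow> f \<in> polynomial_functions C"
| const: "(\<lambda>_. c) \<in> polynomial_functions C"
| add: "f \<in> polynomial_functions C \<Longrightarrow> g \<in> polynomial_functions C \<Longrightarrow>
    (\<lambda>x. f x + g x) \<in> polynomial_functions C"
| mult: "f \<in> polynomial_functions C \<Longrightarrow> g \<in> polynomial_functions C \<Longrightarrow>
    (\<lambda>x. f x * g x) \<in> polynomial_functions C"

definition zero_locus :: "'a set \<Rightarrow> ('a \<Rightarrow> 'k::comm_ring_1) set \<Rightarrow> 'a set" where
  "zero_locus S F = {x \<in> S. \<forall>f\<in>F. f x = 0}"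

definition zariski_topology :: "'a set \<Rightarrow> ('a \<Rightarrow> 'k::idom) set \<Rightarrow> 'a topology" where
  "zariski_topology S C =
     topology (\<lambda>U. \<exists>F \<subseteq> polynomial_functions C. U = S - zero_locus S F)"

lemma istopology_zariski:
  fixes C :: "('a \<Rightarrow> 'k::idom) set"
  shows "istopology (\<lambda>U. \<exists>F \<subseteq> polynomial_functions C. U = S - zero_locus S F)"
  unfolding istopology_def
proof (intro conjI allI impI)
  fix U V
  assume "\<exists>F \<subseteq> polynomial_functions C. U = S - zero_locus S F"
    and "\<exists>F \<subseteq> polynomial_functions C. V = S - zero_locus S F"
  then obtain F G where
    F: "F \<subseteq> polynomial_functions C" "U = S - zero_locus S F" and
    G: "G \<subseteq> polynomial_functions C" "V = S - zero_locus S G"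
    by blast
  let ?H = "{(\<lambda>x. f x * g x) | f g. f \<in> F \<and> g \<in> G}"
  have "?H \<subseteq> polynomial_functions C"
    using F(1) G(1) by (auto intro!: polynomial_functions.mult)
  moreover have "U \<inter> V = S - zero_locus S ?H"
  proof (intro equalityI subsetI)
    fix x assume "x \<in> U \<inter> V"
    then obtain f g where "x \<in> S" "f \<in> F" "g \<in> G" "f x \<noteq> 0" "g x \<noteq> 0"
      by (auto simp: F(2) G(2) zero_locus_def)
    then have "(\<lambda>x. f x * g x) \<in> ?H" "f x * g x \<noteq> 0"
      by auto
    then have "x \<notin> zero_locus S ?H"
      unfolding zero_locus_def by (metis (mono_tags, lifting) mem_Collect_eq)
    then show "x \<in> S - zero_locus S ?H"
      using \<open>x \<in> S\<close> by blast
  next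
    fix x assume "x \<in> S - zero_locus S ?H"
    then obtain f g where "x \<in> S" "f \<in> F" "g \<in> G" "f x * g x \<noteq> 0"
      unfolding zero_locus_def by blast
    then show "x \<in> U \<inter> V"
      unfolding F(2) G(2) zero_locus_def by auto
  qed
  ultimately show "\<exists>F \<subseteq> polynomial_functions C. U \<inter> V = S - zero_locus S F"
    by blast
next
  fix K
  assume "\<forall>U\<in>K. \<exists>F \<subseteq> polynomial_functions C. U = S - zero_locus S F"
  then obtain F where F: "\<And>U. U \<in> K \<Longrightarrow> F U \<subseteq> polynomial_functions C"
      "\<And>U. U \<in> K \<Longrightarrow> U = S - zero_locus S (F U)"
    by metis
  have "(\<lambda>U. S - zero_locus S (F U)) ` K = id ` K"
    by (intro image_cong refl) (simp only: id_apply F(2)[symmetric])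
  then have "\<Union>K = \<Union>((\<lambda>U. S - zero_locus S (F U)) ` K)"
    by (simp only: image_id id_apply)
  also have "\<dots> = S - zero_locus S (\<Union>(F ` K))"
    unfolding zero_locus_def by blast
  finally have *: "\<Union>K = S - zero_locus S (\<Union>(F ` K))" .
  have "\<Union>(F ` K) \<subseteq> polynomial_functions C"
    by (rule UN_least) (rule F(1))
  with * show "\<exists>F \<subseteq> polynomial_functions C. \<Union>K = S - zero_locus S F"
    by (intro exI[of _ "\<Union>(F ` K)"] conjI)
qed

lemma openin_zariski:
  "openin (zariski_topology S C) U \<longleftrightarrow>
     (\<exists>F \<subseteq> polynomial_functions C. U = S - zero_locus S F)"
  unfolding zariski_topology_def by (simp add: topology_inverse'[OF istopology_zariski])

lemma topspace_zariski [simp]: "topspace (zariski_topology S C) = S"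
proof (rule equalityI)
  show "topspace (zariski_topology S C) \<subseteq> S"
    using openin_zariski[of S C "topspace (zariski_topology S C)"] by auto
  have "openin (zariski_topology S C) S"
    unfolding openin_zariski
    by (rule exI[of _ "{\<lambda>_. 1}"]) (auto simp: zero_locus_def intro: polynomial_functions.const)
  then show "S \<subseteq> topspace (zariski_topology S C)"
    by (rule openin_subset)
qed

lemma closedin_zariski:
  "closedin (zariski_topology S C) V \<longleftrightarrow> (\<exists>F \<subseteq> polynomial_functions C. V = zero_locus S F)"
proof -
  have "V \<subseteq> S \<and> S - V = S - zero_locus S F \<longleftrightarrow> V = zero_locus S F" for F
    unfolding zero_locus_def by blast
  then show ?thesis
    unfolding closedin_def openin_zariski topspace_zariski by blast
qed

definition irreducible_space :: "'a topology \<Rightarrow> bool" where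
  "irreducible_space X \<longleftrightarrow> topspace X \<noteq> {} \<and>
     (\<forall>A B. closedin X A \<and> closedin X B \<and> A \<union> B = topspace X \<longrightarrow>
        A = topspace X \<or> B = topspace X)"

text \<open>
  Dimension of a topological space: the supremum of the lengths \<open>m\<close> of strictly increasing chains
  \<open>Z 0 \<subset> \<dots> \<subset> Z m\<close> of irreducible closed subsets (\<open>-\<infinity>\<close> for the empty space).
\<close>

definition krull_dim :: "'a topology \<Rightarrow> ereal" where
  "krull_dim X = Sup {ereal (real m) | m. \<exists>Z :: nat \<Rightarrow> 'a set.
     (\<forall>i\<le>m. closedin X (Z i) \<and> irreducible_space (subtopology X (Z i))) \<and>
     (\<forall>i<m. Z i \<subset> Z (Suc i))}"


section \<open>Graded free modules over \<open>k[s,t]\<close>\<close>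

text \<open>
  \<open>R = k[s,t]\<close> is the type \<open>'k poly poly\<close>: the inner variable is \<open>s\<close>, the outer one is \<open>t\<close>, so
  that \<open>coeff (coeff p j) i\<close> is the coefficient of \<open>s\<^sup>i t\<^sup>j\<close>.  Degrees are integers, so
  \<open>homog e = {0}\<close> for \<open>e < 0\<close>.
\<close>

definition homog :: "int \<Rightarrow> 'k::comm_ring_1 poly poly set" where
  "homog e = {p. \<forall>i j. coeff (coeff p j) i \<noteq> 0 \<longrightarrow> int i + int j = e}"

text \<open>Elements of the free module with basis indexed by \<open>I\<close> are families extended by \<open>0\<close>.\<close>

definition free_module :: "nat set \<Rightarrow> (nat \<Rightarrow> 'k::comm_ring_1 poly poly) set" where
  "free_module I = {x. \<forall>i. i \<notin> I \<longrightarrow> x i = 0}"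

text \<open>
  The degree \<open>e\<close> piece of \<open>\<Oplus>\<^sub>i R(-m\<^sub>i)\<close> with \<open>i\<close> ranging over \<open>I\<close>, where \<open>R(-m)\<^sub>e = R\<^bsub>e-m\<^esub>\<close>.
\<close>

definition graded_piece ::
    "nat set \<Rightarrow> (nat \<Rightarrow> int) \<Rightarrow> int \<Rightarrow> (nat \<Rightarrow> 'k::comm_ring_1 poly poly) set" where
  "graded_piece I m e = {x \<in> free_module I. \<forall>i\<in>I. x i \<in> homog (e - m i)}"

text \<open>Degree-preserving \<open>R\<close>-linear maps \<open>\<Oplus>\<^sub>i R(-m\<^sub>i) \<rightarrow> \<Oplus>\<^sub>j R(-m'\<^sub>j)\<close>.\<close>

definition graded_hom ::
    "nat set \<Rightarrow> (nat \<Rightarrow> int) \<Rightarrow> nat set \<Rightarrow> (nat \<Rightarrow> int) \<Rightarrow>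
     ((nat \<Rightarrow> 'k::comm_ring_1 poly poly) \<Rightarrow> (nat \<Rightarrow> 'k poly poly)) \<Rightarrow> bool" where
  "graded_hom I m J m' \<phi> \<longleftrightarrow>
     \<phi> ` free_module I \<subseteq> free_module J \<and>
     (\<forall>x\<in>free_module I. \<forall>y\<in>free_module I. \<phi> (\<lambda>i. x i + y i) = (\<lambda>j. \<phi> x j + \<phi> y j)) \<and>
     (\<forall>c. \<forall>x\<in>free_module I. \<phi> (\<lambda>i. c * x i) = (\<lambda>j. c * \<phi> x j)) \<and>
     (\<forall>e. \<phi> ` graded_piece I m e \<subseteq> graded_piece J m' e)"


section \<open>Parametrizations and their \<open>\<mu>\<close>-type\<close>

definition partition_parts :: "nat \<Rightarrow> (nat \<Rightarrow> nat) \<Rightarrow> bool" where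
  "partition_parts d \<mu> \<longleftrightarrow> (\<forall>i\<in>{1..d}. 1 \<le> \<mu> i) \<and> mono_on {1..d} \<mu>"

definition partition_size :: "nat \<Rightarrow> (nat \<Rightarrow> nat) \<Rightarrow> nat" where
  "partition_size d \<mu> = (\<Sum>i=1..d. \<mu> i)"

text \<open>The affine space \<open>R\<^sub>n\<^bsup>d+1\<^esup>\<close>; its coordinates are the coefficients of the entries.\<close>

definition tuples :: "nat \<Rightarrow> nat \<Rightarrow> (nat \<Rightarrow> 'k::comm_ring_1 poly poly) set" where
  "tuples n d = {a \<in> free_module {0..d}. \<forall>i\<in>{0..d}. a i \<in> homog (int n)}"

definition coordinates :: "nat \<Rightarrow> nat \<Rightarrow> ((nat \<Rightarrow> 'k::comm_ring_1 poly poly) \<Rightarrow> 'k) set" where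
  "coordinates n d = {(\<lambda>a. coeff (coeff (a i) j) (n - j)) | i j. i \<le> d \<and> j \<le> n}"

definition zariski :: "nat \<Rightarrow> nat \<Rightarrow> (nat \<Rightarrow> 'k::field poly poly) topology" where
  "zariski n d = zariski_topology (tuples n d) (coordinates n d)"

definition CP :: "nat \<Rightarrow> nat \<Rightarrow> (nat \<Rightarrow> 'k::field poly poly) set" where
  "CP n d = {a \<in> tuples n d.
     \<forall>c :: nat \<Rightarrow> 'k. (\<Sum>i=0..d. smult [:c i:] (a i)) = 0 \<longrightarrow> (\<forall>i\<in>{0..d}. c i = 0)}"

text \<open>
  \<open>module.span (*)\<close> is the ideal generated by a set.  The five conditions say that
  \<open>0 \<rightarrow> \<Oplus>\<^sub>i R(-n-\<mu>\<^sub>i) \<rightarrow> R(-n)\<^bsup>d+1\<^esup> \<rightarrow> I \<rightarrow> 0\<close> is a graded exact sequence whose right-hand map is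
  given by \<open>(a\<^sub>0,\<dots>,a\<^sub>d)\<close>.
\<close>

definition has_mu_type ::
    "nat \<Rightarrow> nat \<Rightarrow> (nat \<Rightarrow> 'k::field poly poly) \<Rightarrow> (nat \<Rightarrow> nat) \<Rightarrow> bool" where
  "has_mu_type n d a \<mu> \<longleftrightarrow>
     partition_parts d \<mu> \<and>
     (\<lambda>x. \<Sum>i=0..d. x i * a i) ` free_module {0..d} = module.span (*) (a ` {0..d}) \<and>
     (\<exists>\<phi>. graded_hom {1..d} (\<lambda>i. int n + int (\<mu> i)) {0..d} (\<lambda>_. int n) \<phi> \<and>
          inj_on \<phi> (free_module {1..d}) \<and>
          \<phi> ` free_module {1..d} = {x \<in> free_module {0..d}. (\<Sum>i=0..d. x i * a i) = 0})"

definition stratum :: "nat \<Rightarrow> nat \<Rightarrow> (nat \<Rightarrow> nat) \<Rightarrow> (nat \<Rightarrow> 'k::field poly poly) set" where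
  "stratum n d \<mu> = {a \<in> CP n d. has_mu_type n d a \<mu>}"

end

theory Submission
  imports Defs "Jordan_Normal_Form.Determinant" "HOL-Library.Function_Algebras"
begin

text \<open>
  In the chart \<open>t = 1\<close> a tuple \<open>a\<close> has type \<open>\<mu>\<close> iff its syzygy module has a basis
  \<open>\<sigma>\<^sub>1, \<dots>, \<sigma>\<^sub>d\<close> with \<open>deg \<sigma>\<^sub>j \<le> \<mu>\<^sub>j\<close> and no cancellation of degrees in
  combinations.  After a constant linear change of the entries of \<open>a\<close>, no nonzero syzygy \<open>x\<close>
  satisfies \<open>deg x\<^sub>i < \<mu>\<^sub>i\<close> for all \<open>i \<ge> 1\<close>; then there is a unique basis in Popov normal form,
  and \<open>a\<close> is a multiple \<open>g\<close> of its maximal minors (Hilbert--Burch).  The existence and the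
  absence of syzygies with prescribed support are closed and open conditions, respectively,
  which gives local closedness.  The entries of the Popov matrix and of \<open>g\<close> are free coordinates:
  they parametrise a dense subset of the stratum injectively, and their number is the claimed
  dimension.  Over an arbitrary infinite field the upper bound for the dimension follows by
  counting monomials in functions that separate the members of a chain, and the lower bound by
  releasing the coordinates one at a time.
\<close>

section \<open>Linear systems over a field\<close>

text \<open>No single chart covers the stratum: the \<open>(d + 1) \<times> d\<close> matrix of
  leading coefficients of a basis has rank \<open>d\<close>, but which \<open>d\<close> of its rows
  are independent depends on the tuple. Hence all invertible \<open>T\<close> are used at once: the
  stratum is an intersection of closed sets over all \<open>T\<close> and \<open>j\<close>, met with
  a union of open sets over all \<open>T\<close>.

  Only points over the given field are available, so irreducibility is read off along lines, on
  which polynomial functions become polynomials in one variable with infinitely many test values.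
  For the upper bound, a chain of length \<open>D + 1\<close> would yield
  \<open>(r + 1) ^ (D + 1)\<close> linearly independent functions, while their pullbacks to
  \<open>D\<close> parameters use a number of monomials that grows only like \<open>r ^ D\<close>.

  The correction term of the dimension comes from the pivots: row \<open>i \<ge> 1\<close> of column
  \<open>j\<close> has \<open>min (\<mu> i) (\<mu> j + 1)\<close> free coefficients, and for
  \<open>i > j\<close> the entries at \<open>(i, j)\<close> and \<open>(j, i)\<close> together fall
  short of \<open>\<mu> i + \<mu> j\<close> by exactly
  \<open>max 0 (\<mu> i - \<mu> j - 1)\<close>.\<close>

definition matrix_of :: "nat \<Rightarrow> (nat \<Rightarrow> nat \<Rightarrow> 'a) \<Rightarrow> 'a mat" where
  "matrix_of n A = mat n n (\<lambda>(i, j). A i j)"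

lemma matrix_of_carrier [simp]: "matrix_of n A \<in> carrier_mat n n"
  and dim_matrix_of [simp]: "dim_row (matrix_of n A) = n" "dim_col (matrix_of n A) = n"
  and index_matrix_of [simp]: "i < n \<Longrightarrow> j < n \<Longrightarrow> matrix_of n A $$ (i, j) = A i j"
  by (simp_all add: matrix_of_def)

lemma matrix_of_cong:
  "(\<And>i j. i < n \<Longrightarrow> j < n \<Longrightarrow> A i j = B i j) \<Longrightarrow> matrix_of n A = matrix_of n B"
  by (auto simp: matrix_of_def)

lemma matrix_of_mult:
  fixes A B :: "nat \<Rightarrow> nat \<Rightarrow> 'a::comm_ring_1"
  shows "matrix_of n A * matrix_of n B = matrix_of n (\<lambda>i j. \<Sum>l<n. A i l * B l j)"
  by (rule eq_matI) (auto simp: scalar_prod_def matrix_of_def atLeast0LessThan)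

lemma one_matrix_of: "1\<^sub>m n = matrix_of n (\<lambda>i j. if i = j then 1 else 0)"
  by (rule eq_matI) auto

lemma matrix_of_eqD:
  assumes "matrix_of n A = matrix_of n B" "i < n" "j < n"
  shows "A i j = B i j"
  using arg_cong[OF assms(1), of "\<lambda>M. M $$ (i, j)"] assms(2,3) by simp

lemma det_matrix_of:
  "det (matrix_of n A) = (\<Sum>p | p permutes {0..<n}. signof p * (\<Prod>i<n. A i (p i)))"
  unfolding det_def'[OF matrix_of_carrier]
  by (intro sum.cong refl) (auto simp: atLeast0LessThan permutes_in_image intro!: prod.cong)

lemma det_matrix_of_eq_0_iff:
  fixes A :: "nat \<Rightarrow> nat \<Rightarrow> 'a::idom"
  shows "det (matrix_of n A) = 0 \<longleftrightarrow>
    (\<exists>v. (\<exists>j<n. v j \<noteq> 0) \<and> (\<forall>i<n. (\<Sum>j<n. A i j * v j) = 0))"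
proof
  assume "det (matrix_of n A) = 0"
  then obtain v where v: "v \<in> carrier_vec n" "v \<noteq> 0\<^sub>v n" "matrix_of n A *\<^sub>v v = 0\<^sub>v n"
    unfolding det_0_iff_vec_prod_zero[OF matrix_of_carrier] by blast
  have "\<exists>j<n. v $ j \<noteq> 0"
    using v(1,2) by (metis carrier_vecD eq_vecI index_zero_vec(1) index_zero_vec(2))
  moreover have "(\<Sum>j<n. A i j * v $ j) = 0" if "i < n" for i
    using arg_cong[OF v(3), of "\<lambda>u. u $ i"] that v(1)
    by (simp add: scalar_prod_def atLeast0LessThan)
  ultimately show "\<exists>v. (\<exists>j<n. v j \<noteq> 0) \<and> (\<forall>i<n. (\<Sum>j<n. A i j * v j) = 0)"
    by blast
next
  assume "\<exists>v. (\<exists>j<n. v j \<noteq> 0) \<and> (\<forall>i<n. (\<Sum>j<n. A i j * v j) = 0)"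
  then obtain v j where v: "j < n" "v j \<noteq> 0" "\<forall>i<n. (\<Sum>j<n. A i j * v j) = 0"
    by blast
  have "vec n v \<in> carrier_vec n" by simp
  moreover have "vec n v \<noteq> 0\<^sub>v n"
    using v(1,2) by (metis index_vec index_zero_vec(1))
  moreover have "matrix_of n A *\<^sub>v vec n v = 0\<^sub>v n"
    by (rule eq_vecI) (use v(3) in \<open>auto simp: scalar_prod_def atLeast0LessThan\<close>)
  ultimately show "det (matrix_of n A) = 0"
    unfolding det_0_iff_vec_prod_zero[OF matrix_of_carrier] by blast
qed

lemma exists_inverse_matrix:
  fixes A :: "nat \<Rightarrow> nat \<Rightarrow> 'a::field"
  assumes "det (matrix_of n A) \<noteq> 0"
  obtains B where "\<And>i j. i < n \<Longrightarrow> j < n \<Longrightarrow> (\<Sum>l<n. A i l * B l j) = (if i = j then 1 else 0)"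
    and "\<And>i j. i < n \<Longrightarrow> j < n \<Longrightarrow> (\<Sum>l<n. B i l * A l j) = (if i = j then 1 else 0)"
proof -
  from det_non_zero_imp_unit[OF matrix_of_carrier assms]
  obtain M where M: "M \<in> carrier_mat n n" "matrix_of n A * M = 1\<^sub>m n" "M * matrix_of n A = 1\<^sub>m n"
    by (auto simp: Units_def ring_mat_def)
  have "M = matrix_of n (\<lambda>i j. M $$ (i, j))"
    by (rule eq_matI) (use M(1) in auto)
  then obtain B where B: "M = matrix_of n B" by blast
  show thesis
    by (rule that[of B]; rule matrix_of_eqD[of n])
       (use M in \<open>simp_all add: B matrix_of_mult one_matrix_of\<close>)
qed

lemma sum_reindex_lessThan:
  assumes "bij_betw h {..<n} I"
  shows "sum f I = (\<Sum>i<n. f (h i))"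
  using sum.reindex_bij_betw[OF assms, of f] by simp

lemma underdetermined_system:
  fixes A :: "'e \<Rightarrow> 'i \<Rightarrow> 'k::field"
  assumes "finite I" "finite E" "card E < card I"
  shows "\<exists>v. (\<exists>i\<in>I. v i \<noteq> 0) \<and> (\<forall>e\<in>E. (\<Sum>i\<in>I. A e i * v i) = 0)"
proof -
  let ?n = "card I"
  obtain h where h: "bij_betw h {..<?n} I"
    using ex_bij_betw_nat_finite[OF assms(1)] by (auto simp: atLeast0LessThan)
  obtain g where g: "bij_betw g {..<card E} E"
    using ex_bij_betw_nat_finite[OF assms(2)] by (auto simp: atLeast0LessThan)
  \<comment> \<open>The system is padded with zero rows to a square one; row \<open>card E\<close>
    is zero, so every product in the Leibniz expansion of the determinant vanishes.\<close>
  define B where "B = (\<lambda>i j. if i < card E then A (g i) (h j) else 0)"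
  have "det (matrix_of ?n B) = 0"
  proof -
    have *: "(\<Prod>i<?n. B i (p i)) = 0" for p
      by (rule prod_zero) (use assms(3) in \<open>auto simp: B_def intro!: bexI[of _ "card E"]\<close>)
    then show ?thesis unfolding det_matrix_of by (simp only: * mult_zero_right sum.neutral_const)
  qed
  then obtain v j where v: "j < ?n" "v j \<noteq> 0" "\<forall>i<?n. (\<Sum>j<?n. B i j * v j) = 0"
    unfolding det_matrix_of_eq_0_iff by blast
  let ?h' = "the_inv_into {..<?n} h"
  have inv: "?h' (h i) = i" if "i < ?n" for i
    using that h by (simp add: the_inv_into_f_f bij_betw_def)
  have "h j \<in> I" "v (?h' (h j)) \<noteq> 0"
    using v(1,2) h by (auto simp: inv bij_betw_def)
  moreover have "(\<Sum>i\<in>I. A e i * v (?h' i)) = 0" if "e \<in> E" for e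
  proof -
    obtain l where l: "l < card E" "e = g l"
      using \<open>e \<in> E\<close> g by (auto simp: bij_betw_def)
    have "(\<Sum>i\<in>I. A e i * v (?h' i)) = (\<Sum>j<?n. B l j * v j)"
      unfolding sum_reindex_lessThan[OF h] by (rule sum.cong) (auto simp: inv B_def l)
    then show ?thesis using v(3) l(1) assms(3) by simp
  qed
  ultimately show ?thesis by (intro exI[of _ "\<lambda>i. v (?h' i)"]) blast
qed

lemma sum_fun_apply: "sum f A x = (\<Sum>a\<in>A. f a x)"
  by (induction A rule: infinite_finite_induct) (auto simp: zero_fun_def plus_fun_def)

text \<open>An injective linear map has a linear left inverse; evaluating that inverse at the unit
  vectors of \<open>E\<close> gives the entries of \<open>C\<close>.\<close>

lemma exists_left_inverse_matrix:
  fixes A :: "'e \<Rightarrow> 'i \<Rightarrow> 'k::field"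
  assumes I: "finite I" and E: "finite E"
    and inj: "\<And>v. (\<And>e. e \<in> E \<Longrightarrow> (\<Sum>i\<in>I. A e i * v i) = 0) \<Longrightarrow> \<forall>i\<in>I. v i = 0"
  obtains C where "\<And>i j. i \<in> I \<Longrightarrow> j \<in> I \<Longrightarrow> (\<Sum>e\<in>E. C i e * A e j) = (if i = j then 1 else 0)"
proof -
  define sI :: "'k \<Rightarrow> ('i \<Rightarrow> 'k) \<Rightarrow> 'i \<Rightarrow> 'k" where "sI = (\<lambda>c f i. c * f i)"
  define sE :: "'k \<Rightarrow> ('e \<Rightarrow> 'k) \<Rightarrow> 'e \<Rightarrow> 'k" where "sE = (\<lambda>c f i. c * f i)"
  interpret vector_space_pair sI sE
    by unfold_locales (auto simp: sI_def sE_def algebra_simps fun_eq_iff plus_fun_def)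
  \<comment> \<open>The map sees only the values on \<open>I\<close>, so injectivity is claimed on
    functions supported in \<open>I\<close> and not on the whole function space.\<close>
  define V where "V = {v :: 'i \<Rightarrow> 'k. \<forall>i. i \<notin> I \<longrightarrow> v i = 0}"
  have V: "vs1.subspace V"
    unfolding vs1.subspace_def by (auto simp: V_def sI_def zero_fun_def plus_fun_def)
  define f where "f = (\<lambda>v e. if e \<in> E then \<Sum>i\<in>I. A e i * v i else 0)"
  have lf: "Vector_Spaces.linear sI sE f"
    by unfold_locales
       (auto simp: f_def sI_def sE_def fun_eq_iff algebra_simps sum.distrib sum_distrib_left plus_fun_def)
  have "inj_on f V"
  proof (rule inj_onI)
    fix x y assume xy: "x \<in> V" "y \<in> V" "f x = f y"
    have "(\<Sum>i\<in>I. A e i * (x i - y i)) = 0" if "e \<in> E" for e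
      using fun_cong[OF xy(3), of e] that by (simp add: f_def algebra_simps sum_subtractf)
    from inj[OF this] show "x = y"
      using xy(1,2) by (force simp: V_def fun_eq_iff)
  qed
  then obtain g where g: "Vector_Spaces.linear sE sI g" "\<forall>x\<in>V. g (f x) = x"
    using linear_exists_left_inverse_on[OF lf V] by (auto simp: linear_iff_module_hom)
  interpret g: Vector_Spaces.linear sE sI g by (rule g(1))
  define u :: "'e \<Rightarrow> 'e \<Rightarrow> 'k" where "u = (\<lambda>e e'. if e' = e then 1 else 0)"
  have "(\<Sum>e\<in>E. g (u e) i * A e j) = (if i = j then 1 else 0)" if ij: "i \<in> I" "j \<in> I" for i j
  proof -
    define x :: "'i \<Rightarrow> 'k" where "x = (\<lambda>i. if i = j then 1 else 0)"
    have fx: "f x = (\<Sum>e\<in>E. sE (A e j) (u e))"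
      by (auto simp: fun_eq_iff f_def x_def sE_def u_def sum_fun_apply if_distrib[of "\<lambda>z. _ * z"]
          sum.delta I E ij cong: if_cong)
    have "g (f x) = (\<Sum>e\<in>E. sI (A e j) (g (u e)))"
      unfolding fx by (simp add: g.sum g.scale)
    moreover have "g (f x) = x" using g(2) ij by (auto simp: V_def x_def)
    ultimately have "x i = (\<Sum>e\<in>E. A e j * g (u e) i)"
      by (simp add: sum_fun_apply sI_def)
    then show ?thesis by (simp add: x_def mult.commute)
  qed
  then show thesis by (rule that)
qed

section \<open>Zariski closed sets and dimension\<close>

lemma polynomial_functions_sum:
  "(\<And>i. i \<in> A \<Longrightarrow> f i \<in> polynomial_functions C) \<Longrightarrow>
    (\<lambda>x. \<Sum>i\<in>A. f i x) \<in> polynomial_functions C"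
  by (induction A rule: infinite_finite_induct)
     (auto intro: polynomial_functions.const polynomial_functions.add)

lemma polynomial_functions_prod:
  "(\<And>i. i \<in> A \<Longrightarrow> f i \<in> polynomial_functions C) \<Longrightarrow>
    (\<lambda>x. \<Prod>i\<in>A. f i x) \<in> polynomial_functions C"
  by (induction A rule: infinite_finite_induct)
     (auto intro: polynomial_functions.const polynomial_functions.mult)

lemma polynomial_functions_power:
  "f \<in> polynomial_functions C \<Longrightarrow> (\<lambda>x. f x ^ k) \<in> polynomial_functions C"
  by (induction k) (auto intro: polynomial_functions.const polynomial_functions.mult)

lemma polynomial_functions_diff:
  assumes "f \<in> polynomial_functions C" "g \<in> polynomial_functions C"
  shows "(\<lambda>x. f x - g x) \<in> polynomial_functions C"
  using polynomial_functions.add[OF assms(1) polynomial_functions.mult[OF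
        polynomial_functions.const[of "-1"] assms(2)]]
  by simp

lemma polynomial_functions_compose:
  assumes "f \<in> polynomial_functions C" "\<And>c. c \<in> C \<Longrightarrow> (\<lambda>w. c (\<psi> w)) \<in> polynomial_functions C'"
  shows "(\<lambda>w. f (\<psi> w)) \<in> polynomial_functions C'"
  using assms(1)
  by induction (auto intro: assms(2) polynomial_functions.intros(2-))

text \<open>Restriction to a polynomially parametrised curve turns questions about vanishing into
  questions about polynomials in one variable, where an infinite field suffices.\<close>

lemma polynomial_functions_curve:
  fixes f :: "'a \<Rightarrow> 'k::comm_ring_1"
  assumes "f \<in> polynomial_functions C" "\<And>c. c \<in> C \<Longrightarrow> \<exists>p. \<forall>\<tau>. c (\<gamma> \<tau>) = poly p \<tau>"
  shows "\<exists>p. \<forall>\<tau>. f (\<gamma> \<tau>) = poly p \<tau>"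
  using assms(1)
proof induction
  case (const c)
  show ?case by (rule exI[of _ "[:c:]"]) simp
next
  case (add f g)
  then show ?case by (metis poly_add)
next
  case (mult f g)
  then show ?case by (metis poly_mult)
qed (use assms(2) in blast)

lemma polynomial_functions_det:
  assumes "\<And>i j. i < n \<Longrightarrow> j < n \<Longrightarrow> (\<lambda>x. A x i j) \<in> polynomial_functions C"
  shows "(\<lambda>x. det (matrix_of n (A x))) \<in> polynomial_functions C"
  unfolding det_matrix_of
  by (intro polynomial_functions_sum polynomial_functions.mult polynomial_functions.const
      polynomial_functions_prod assms) (auto dest: permutes_in_image)

text \<open>Composing the system with a left inverse \<open>B\<close> of the matrix at \<open>x\<^sub>0\<close> makes it square,
  with a determinant that is \<open>1\<close> at \<open>x\<^sub>0\<close>.\<close>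

lemma injective_system_open:
  fixes A :: "'a \<Rightarrow> 'e \<Rightarrow> 'i \<Rightarrow> 'k::field"
  assumes "finite I" "finite E"
    and A: "\<And>e i. e \<in> E \<Longrightarrow> i \<in> I \<Longrightarrow> (\<lambda>x. A x e i) \<in> polynomial_functions C"
    and inj: "\<And>v. (\<And>e. e \<in> E \<Longrightarrow> (\<Sum>i\<in>I. A x\<^sub>0 e i * v i) = 0) \<Longrightarrow> \<forall>i\<in>I. v i = 0"
  obtains f where "f \<in> polynomial_functions C" "f x\<^sub>0 \<noteq> 0"
    "\<And>x v. f x \<noteq> 0 \<Longrightarrow> (\<And>e. e \<in> E \<Longrightarrow> (\<Sum>i\<in>I. A x e i * v i) = 0) \<Longrightarrow> \<forall>i\<in>I. v i = 0"
proof -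
  obtain B where B: "\<And>i j. i \<in> I \<Longrightarrow> j \<in> I \<Longrightarrow>
      (\<Sum>e\<in>E. B i e * A x\<^sub>0 e j) = (if i = j then 1 else 0)"
    using exists_left_inverse_matrix[OF assms(1,2) inj] by blast
  let ?n = "card I"
  obtain h where h: "bij_betw h {..<?n} I"
    using ex_bij_betw_nat_finite[OF assms(1)] by (auto simp: atLeast0LessThan)
  have hI: "h i \<in> I" if "i < ?n" for i
    using h that by (auto simp: bij_betw_def)
  define D where "D = (\<lambda>x i j. \<Sum>e\<in>E. B (h i) e * A x e (h j))"
  define f where "f = (\<lambda>x. det (matrix_of ?n (D x)))"
  have "matrix_of ?n (D x\<^sub>0) = 1\<^sub>m ?n"
    unfolding one_matrix_of using h
    by (intro matrix_of_cong) (auto simp: D_def B hI bij_betw_def inj_on_def)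
  then have "f x\<^sub>0 \<noteq> 0" by (simp add: f_def)
  moreover have "f \<in> polynomial_functions C"
    unfolding f_def D_def
    by (intro polynomial_functions_det polynomial_functions_sum polynomial_functions.mult
        polynomial_functions.const A hI)
  moreover have "\<forall>i\<in>I. v i = 0"
    if "f x \<noteq> 0" and v: "\<And>e. e \<in> E \<Longrightarrow> (\<Sum>i\<in>I. A x e i * v i) = 0" for x v
  proof (rule ccontr)
    assume "\<not> (\<forall>i\<in>I. v i = 0)"
    then obtain i where i: "i \<in> I" "v i \<noteq> 0" by blast
    then obtain j where j: "j < ?n" "v (h j) \<noteq> 0"
      using h unfolding bij_betw_def by (metis imageE lessThan_iff)
    have "(\<Sum>j<?n. D x i j * v (h j)) = 0" if "i < ?n" for i
    proof -
      have "(\<Sum>j<?n. D x i j * v (h j)) = (\<Sum>j<?n. \<Sum>e\<in>E. B (h i) e * (A x e (h j) * v (h j)))"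
        by (simp add: D_def sum_distrib_right mult.assoc)
      also have "\<dots> = (\<Sum>e\<in>E. B (h i) e * (\<Sum>j<?n. A x e (h j) * v (h j)))"
        by (subst sum.swap) (simp add: sum_distrib_left)
      also have "\<dots> = (\<Sum>e\<in>E. B (h i) e * (\<Sum>i\<in>I. A x e i * v i))"
        by (simp add: sum_reindex_lessThan[OF h])
      finally show ?thesis by (simp add: v)
    qed
    then have "det (matrix_of ?n (D x)) = 0"
      unfolding det_matrix_of_eq_0_iff using j by (intro exI[of _ "\<lambda>j. v (h j)"]) auto
    with \<open>f x \<noteq> 0\<close> show False by (simp add: f_def)
  qed
  ultimately show thesis using that[of f] by blast
qed

text \<open>By \<open>injective_system_open\<close>, each point outside the locus has a polynomial
  function that is nonzero there and vanishes on the locus. So the locus is the zero set of all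
  functions vanishing on it, and no list of minors has to be written down.\<close>

lemma closedin_singular_locus:
  fixes A :: "'a \<Rightarrow> 'e \<Rightarrow> 'i \<Rightarrow> 'k::field"
  assumes "finite I" "finite E"
    and "\<And>e i. e \<in> E \<Longrightarrow> i \<in> I \<Longrightarrow> (\<lambda>x. A x e i) \<in> polynomial_functions C"
  shows "closedin (zariski_topology S C)
    {x \<in> S. \<exists>v. (\<exists>i\<in>I. v i \<noteq> 0) \<and> (\<forall>e\<in>E. (\<Sum>i\<in>I. A x e i * v i) = 0)}" (is "closedin _ ?V")
proof -
  let ?F = "{f \<in> polynomial_functions C. \<forall>x\<in>?V. f x = 0}"
  have "x \<in> ?V" if "x \<in> zero_locus S ?F" for x
  proof (rule ccontr)
    assume "x \<notin> ?V"
    with that have x: "x \<in> S" "\<And>v. (\<And>e. e \<in> E \<Longrightarrow> (\<Sum>i\<in>I. A x e i * v i) = 0) \<Longrightarrow> \<forall>i\<in>I. v i = 0"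
      by (auto simp: zero_locus_def)
    obtain f where f: "f \<in> polynomial_functions C" "f x \<noteq> 0"
      "\<And>y v. f y \<noteq> 0 \<Longrightarrow> (\<And>e. e \<in> E \<Longrightarrow> (\<Sum>i\<in>I. A y e i * v i) = 0) \<Longrightarrow> \<forall>i\<in>I. v i = 0"
      using injective_system_open[of I E A C x, OF assms x(2)] by auto
    have "f \<in> ?F" using f(1,3) by blast
    with that have "f x = 0" unfolding zero_locus_def by blast
    with f(2) show False by simp
  qed
  moreover have "x \<in> zero_locus S ?F" if "x \<in> ?V" for x
    using that unfolding zero_locus_def by blast
  ultimately have "?V = zero_locus S ?F" by (intro equalityI subsetI)
  then show ?thesis unfolding closedin_zariski by (intro exI[of _ ?F]) blast
qed

text \<open>Irreducibility in the form "the functions restricted to \<open>Y\<close> form an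
  integral domain": two proper closed subsets covering \<open>Y\<close> are each missed by one
  function, and the product of the two functions vanishes on \<open>Y\<close>.\<close>

lemma irreducible_zariski_iff:
  assumes "Y \<subseteq> S"
  shows "irreducible_space (subtopology (zariski_topology S C) Y) \<longleftrightarrow>
    Y \<noteq> {} \<and> (\<forall>f\<in>polynomial_functions C. \<forall>g\<in>polynomial_functions C.
      (\<forall>y\<in>Y. f y * g y = 0) \<longrightarrow> (\<forall>y\<in>Y. f y = 0) \<or> (\<forall>y\<in>Y. g y = 0))"
    (is "_ \<longleftrightarrow> _ \<and> ?integral")
proof -
  have top: "topspace (subtopology (zariski_topology S C) Y) = Y"
    using assms by auto
  have closed: "closedin (subtopology (zariski_topology S C) Y) A \<longleftrightarrow>
      (\<exists>F\<subseteq>polynomial_functions C. A = {y \<in> Y. \<forall>f\<in>F. f y = 0})" for A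
  proof -
    have "zero_locus S F \<inter> Y = {y \<in> Y. \<forall>f\<in>F. f y = 0}" for F :: "('a \<Rightarrow> 'b) set"
      using assms by (auto simp: zero_locus_def)
    then show ?thesis unfolding closedin_subtopology closedin_zariski by metis
  qed
  show ?thesis
  proof (intro iffI conjI ballI impI)
    assume irr: "irreducible_space (subtopology (zariski_topology S C) Y)"
    then show "Y \<noteq> {}" unfolding irreducible_space_def top by blast
    fix f g
    assume fg: "f \<in> polynomial_functions C" "g \<in> polynomial_functions C" "\<forall>y\<in>Y. f y * g y = 0"
    have "closedin (subtopology (zariski_topology S C) Y) {y \<in> Y. h y = 0}"
      if "h \<in> polynomial_functions C" for h
      unfolding closed by (rule exI[of _ "{h}"]) (use that in auto)
    moreover have "{y \<in> Y. f y = 0} \<union> {y \<in> Y. g y = 0} = Y" using fg(3) by auto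
    ultimately have "{y \<in> Y. f y = 0} = Y \<or> {y \<in> Y. g y = 0} = Y"
      using irr fg(1,2) unfolding irreducible_space_def top by blast
    then show "(\<forall>y\<in>Y. f y = 0) \<or> (\<forall>y\<in>Y. g y = 0)" by blast
  next
    assume "Y \<noteq> {} \<and> ?integral"
    then have ne: "Y \<noteq> {}" and int: "?integral" by blast+
    have "A = Y \<or> B = Y" if AB: "closedin (subtopology (zariski_topology S C) Y) A"
        "closedin (subtopology (zariski_topology S C) Y) B" "A \<union> B = Y" for A B
    proof (rule ccontr)
      assume neq: "\<not> (A = Y \<or> B = Y)"
      obtain F G where F: "F \<subseteq> polynomial_functions C" "A = {y \<in> Y. \<forall>f\<in>F. f y = 0}"
        and G: "G \<subseteq> polynomial_functions C" "B = {y \<in> Y. \<forall>f\<in>G. f y = 0}"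
        using AB(1,2) unfolding closed by blast
      from neq F(2) obtain f y where f: "f \<in> F" "y \<in> Y" "f y \<noteq> 0" by blast
      from neq G(2) obtain g z where g: "g \<in> G" "z \<in> Y" "g z \<noteq> 0" by blast
      have "f y * g y = 0" if "y \<in> Y" for y
      proof -
        from that AB(3) have "y \<in> A \<or> y \<in> B" by blast
        with F(2) G(2) f(1) g(1) show ?thesis by auto
      qed
      with int F(1) G(1) f g show False by blast
    qed
    with ne show "irreducible_space (subtopology (zariski_topology S C) Y)"
      unfolding irreducible_space_def top by blast
  qed
qed

section \<open>Polynomial functions on affine space with bounded exponents\<close>

definition functions_of_degree :: "'x set \<Rightarrow> nat \<Rightarrow> (('x \<Rightarrow> 'k) \<Rightarrow> 'k::comm_ring_1) set" where
  "functions_of_degree X b =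
     {f. \<exists>c. \<forall>w. f w = (\<Sum>\<beta>\<in>PiE X (\<lambda>_. {..b}). c \<beta> * (\<Prod>x\<in>X. w x ^ \<beta> x))}"

lemma functions_of_degree_monomial:
  assumes "finite X" "\<And>x. x \<in> X \<Longrightarrow> \<gamma> x \<le> b"
  shows "(\<lambda>w. \<Prod>x\<in>X. w x ^ \<gamma> x) \<in> functions_of_degree X b"
proof -
  let ?c = "\<lambda>\<beta>. if \<beta> = restrict \<gamma> X then 1 else (0 :: 'b)"
  have "(\<Prod>x\<in>X. w x ^ \<gamma> x) = (\<Sum>\<beta>\<in>PiE X (\<lambda>_. {..b}). ?c \<beta> * (\<Prod>x\<in>X. w x ^ \<beta> x))"
    for w :: "'a \<Rightarrow> 'b"
  proof -
    have "restrict \<gamma> X \<in> PiE X (\<lambda>_. {..b})" "finite (PiE X (\<lambda>_. {..b}))"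
      using assms by (auto intro: finite_PiE)
    then have "(\<Sum>\<beta>\<in>PiE X (\<lambda>_. {..b}). ?c \<beta> * (\<Prod>x\<in>X. w x ^ \<beta> x)) =
        (\<Prod>x\<in>X. w x ^ restrict \<gamma> X x)"
      by (simp add: if_distrib[of "\<lambda>z. z * _"] sum.delta cong: if_cong)
    then show ?thesis by simp
  qed
  then show ?thesis unfolding functions_of_degree_def mem_Collect_eq by (rule_tac exI, rule_tac allI)
qed

lemma functions_of_degree_add:
  "f \<in> functions_of_degree X b \<Longrightarrow> g \<in> functions_of_degree X b \<Longrightarrow>
    (\<lambda>w. f w + g w) \<in> functions_of_degree X b"
proof -
  assume "f \<in> functions_of_degree X b" "g \<in> functions_of_degree X b"
  then obtain c c' where "\<forall>w. f w = (\<Sum>\<beta>\<in>PiE X (\<lambda>_. {..b}). c \<beta> * (\<Prod>x\<in>X. w x ^ \<beta> x))"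
    "\<forall>w. g w = (\<Sum>\<beta>\<in>PiE X (\<lambda>_. {..b}). c' \<beta> * (\<Prod>x\<in>X. w x ^ \<beta> x))"
    unfolding functions_of_degree_def by blast
  then show ?thesis unfolding functions_of_degree_def mem_Collect_eq
    by (intro exI[of _ "\<lambda>\<beta>. c \<beta> + c' \<beta>"]) (simp add: sum.distrib algebra_simps)
qed

lemma functions_of_degree_scale:
  "f \<in> functions_of_degree X b \<Longrightarrow> (\<lambda>w. a * f w) \<in> functions_of_degree X b"
proof -
  assume "f \<in> functions_of_degree X b"
  then obtain c where "\<forall>w. f w = (\<Sum>\<beta>\<in>PiE X (\<lambda>_. {..b}). c \<beta> * (\<Prod>x\<in>X. w x ^ \<beta> x))"
    unfolding functions_of_degree_def by blast
  then show ?thesis unfolding functions_of_degree_def mem_Collect_eq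
    by (intro exI[of _ "\<lambda>\<beta>. a * c \<beta>"]) (simp add: sum_distrib_left algebra_simps)
qed

lemma functions_of_degree_sum:
  "(\<And>i. i \<in> A \<Longrightarrow> f i \<in> functions_of_degree X b) \<Longrightarrow>
    (\<lambda>w. \<Sum>i\<in>A. f i w) \<in> functions_of_degree X b"
proof (induction A rule: infinite_finite_induct)
  case empty
  show ?case unfolding functions_of_degree_def by (auto intro: exI[of _ "\<lambda>_. 0"])
next
  case (infinite A)
  then show ?case unfolding functions_of_degree_def by (auto intro: exI[of _ "\<lambda>_. 0"])
qed (auto intro: functions_of_degree_add)

lemma functions_of_degree_mult:
  assumes "finite X" "f \<in> functions_of_degree X b" "g \<in> functions_of_degree X b'"
  shows "(\<lambda>w. f w * g w) \<in> functions_of_degree X (b + b')"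
proof -
  let ?m = "\<lambda>\<beta> w. \<Prod>x\<in>X. w x ^ \<beta> x"
  let ?B = "PiE X (\<lambda>_. {..b})" and ?B' = "PiE X (\<lambda>_. {..b'})"
  obtain c c' where "\<And>w. f w = (\<Sum>\<beta>\<in>?B. c \<beta> * ?m \<beta> w)" "\<And>w. g w = (\<Sum>\<beta>\<in>?B'. c' \<beta> * ?m \<beta> w)"
    using assms(2,3) unfolding functions_of_degree_def by blast
  note expand = this
  have "(\<lambda>w. f w * g w) =
      (\<lambda>w. \<Sum>\<beta>\<in>?B. \<Sum>\<beta>'\<in>?B'. (c \<beta> * c' \<beta>') * (\<Prod>x\<in>X. w x ^ (\<beta> x + \<beta>' x)))"
    unfolding expand sum_product
    by (intro ext sum.cong refl) (simp add: power_add prod.distrib mult_ac)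
  also have "\<dots> \<in> functions_of_degree X (b + b')"
    by (intro functions_of_degree_sum functions_of_degree_scale functions_of_degree_monomial assms(1))
       (auto intro: add_mono simp: PiE_iff)
  finally show ?thesis .
qed

lemma functions_of_degree_mono:
  assumes "finite X" "b \<le> b'" "f \<in> functions_of_degree X b"
  shows "f \<in> functions_of_degree X b'"
proof -
  \<comment> \<open>This is the constant \<open>1\<close>, regarded as a function of degree
    \<open>b' - b\<close>; multiplying by it raises the bound.\<close>
  have "(\<lambda>w. \<Prod>x\<in>X. w x ^ 0) \<in> functions_of_degree X (b' - b)"
    by (rule functions_of_degree_monomial[OF assms(1), where \<gamma> = "\<lambda>_. 0"]) simp
  from functions_of_degree_mult[OF assms(1) assms(3) this] assms(2) show ?thesis by simp
qed

lemma functions_of_degree_power: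
  assumes "finite X" "f \<in> functions_of_degree X b"
  shows "(\<lambda>w. f w ^ k) \<in> functions_of_degree X (k * b)"
proof (induction k)
  case 0
  show ?case
    using functions_of_degree_monomial[OF assms(1), where \<gamma> = "\<lambda>_. 0" and b = 0] by simp
next
  case (Suc k)
  from functions_of_degree_mult[OF assms(1) assms(2) Suc] show ?case by simp
qed

lemma functions_of_degree_prod:
  assumes "finite X" "\<And>i. i < (m::nat) \<Longrightarrow> f i \<in> functions_of_degree X b"
  shows "(\<lambda>w. \<Prod>i<m. f i w) \<in> functions_of_degree X (m * b)"
  using assms(2)
proof (induction m)
  case 0
  show ?case
    using functions_of_degree_monomial[OF assms(1), where \<gamma> = "\<lambda>_. 0" and b = 0] by simp
next
  case (Suc m)
  from functions_of_degree_mult[OF assms(1) Suc.IH Suc.prems] show ?case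
    using Suc.prems by (simp add: add.commute)
qed

definition coordinate_functions :: "'x set \<Rightarrow> (('x \<Rightarrow> 'k) \<Rightarrow> 'k) set" where
  "coordinate_functions X = (\<lambda>x w. w x) ` X"

lemma polynomial_functions_degree:
  fixes f :: "('x \<Rightarrow> 'k::comm_ring_1) \<Rightarrow> 'k"
  assumes "finite X" "f \<in> polynomial_functions (coordinate_functions X)"
  shows "\<exists>b. f \<in> functions_of_degree X b"
  using assms(2)
proof induction
  case (coordinate f)
  then obtain x where x: "x \<in> X" "f = (\<lambda>w. w x)" by (auto simp: coordinate_functions_def)
  have mono: "(\<lambda>w :: 'x \<Rightarrow> 'k. \<Prod>y\<in>X. w y ^ (if y = x then 1 else 0)) \<in> functions_of_degree X 1"
    by (rule functions_of_degree_monomial[OF assms(1)]) simp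
  have eq: "(\<lambda>w :: 'x \<Rightarrow> 'k. \<Prod>y\<in>X. w y ^ (if y = x then 1 else 0)) = (\<lambda>w. w x)"
    using x(1) assms(1) by (simp add: if_distrib[of "\<lambda>k. _ ^ k"] cong: if_cong)
  show ?case unfolding x(2) using mono unfolding eq by blast
next
  case (const c)
  have "(\<lambda>w. \<Prod>x\<in>X. w x ^ 0) \<in> functions_of_degree X 0"
    by (rule functions_of_degree_monomial[OF assms(1), where \<gamma> = "\<lambda>_. 0"]) simp
  from functions_of_degree_scale[OF this, of c] show ?case by auto
next
  case (add f g)
  then obtain b b' where "f \<in> functions_of_degree X b" "g \<in> functions_of_degree X b'" by blast
  then have "f \<in> functions_of_degree X (max b b')" "g \<in> functions_of_degree X (max b b')"
    using functions_of_degree_mono[OF assms(1)] by (meson max.cobounded1 max.cobounded2)+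
  then show ?case by (blast intro: functions_of_degree_add)
next
  case (mult f g)
  then show ?case using functions_of_degree_mult[OF assms(1)] by blast
qed

text \<open>The exponent of each variable is bounded separately, so there are exactly
  \<open>(b + 1) ^ card X\<close> monomials; more functions than that have linearly dependent
  coefficient families.\<close>

lemma functions_of_degree_dependent:
  fixes F :: "nat \<Rightarrow> ('x \<Rightarrow> 'k::field) \<Rightarrow> 'k"
  assumes "finite X" "\<And>q. q < n \<Longrightarrow> F q \<in> functions_of_degree X b" "(b + 1) ^ card X < n"
  shows "\<exists>c. (\<exists>q<n. c q \<noteq> 0) \<and> (\<forall>w. (\<Sum>q<n. c q * F q w) = 0)"
proof -
  let ?B = "PiE X (\<lambda>_. {..b})"
  have "\<exists>c. \<forall>w. F q w = (\<Sum>\<beta>\<in>?B. c \<beta> * (\<Prod>x\<in>X. w x ^ \<beta> x))" if "q < n" for q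
    using assms(2)[OF that] unfolding functions_of_degree_def by blast
  then obtain C where C: "\<And>q w. q < n \<Longrightarrow> F q w = (\<Sum>\<beta>\<in>?B. C q \<beta> * (\<Prod>x\<in>X. w x ^ \<beta> x))"
    by metis
  have "card ?B < card {..<n}"
    using assms(1,3) by (simp add: card_PiE)
  from underdetermined_system[OF _ _ this, of "\<lambda>\<beta> q. C q \<beta>"]
  obtain v where v: "\<exists>q<n. v q \<noteq> 0" "\<And>\<beta>. \<beta> \<in> ?B \<Longrightarrow> (\<Sum>q<n. C q \<beta> * v q) = 0"
    using assms(1) by (auto simp: finite_PiE)
  have "(\<Sum>q<n. v q * F q w) = 0" for w
  proof -
    have "(\<Sum>q<n. v q * F q w) = (\<Sum>q<n. \<Sum>\<beta>\<in>?B. (C q \<beta> * v q) * (\<Prod>x\<in>X. w x ^ \<beta> x))"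
      by (simp add: C sum_distrib_left mult_ac)
    also have "\<dots> = (\<Sum>\<beta>\<in>?B. (\<Sum>q<n. C q \<beta> * v q) * (\<Prod>x\<in>X. w x ^ \<beta> x))"
      by (subst sum.swap) (simp add: sum_distrib_right)
    finally show ?thesis by (simp add: v(2))
  qed
  with v(1) show ?thesis by blast
qed

text \<open>Functions \<open>f i\<close> vanishing on \<open>Z i\<close> but not on \<open>Z (i + 1)\<close> are algebraically independent on
  \<open>Z m\<close>; the monomials in them with exponents at most \<open>r\<close> are indexed by the base \<open>r + 1\<close>
  digits of \<open>q\<close>.\<close>

lemma chain_monomials_independent:
  fixes f :: "nat \<Rightarrow> 'a \<Rightarrow> 'k::field"
  assumes pol: "\<And>i. i < m \<Longrightarrow> f i \<in> polynomial_functions C"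
    and integral: "\<And>i g h. i \<le> m \<Longrightarrow> g \<in> polynomial_functions C \<Longrightarrow> h \<in> polynomial_functions C \<Longrightarrow>
      (\<And>z. z \<in> Z i \<Longrightarrow> g z * h z = 0) \<Longrightarrow> (\<forall>z\<in>Z i. g z = 0) \<or> (\<forall>z\<in>Z i. h z = 0)"
    and sub: "\<And>i. i < m \<Longrightarrow> Z i \<subseteq> Z (Suc i)" and "Z 0 \<noteq> {}"
    and vanish: "\<And>i z. i < m \<Longrightarrow> z \<in> Z i \<Longrightarrow> f i z = 0"
    and nonzero: "\<And>i. i < m \<Longrightarrow> \<exists>z\<in>Z (Suc i). f i z \<noteq> 0"
    and zero: "\<And>z. z \<in> Z m \<Longrightarrow>
      (\<Sum>q<(r + 1) ^ m. c q * (\<Prod>i<m. f i z ^ (q div (r + 1) ^ i mod (r + 1)))) = 0"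
  shows "\<forall>q<(r + 1) ^ m. c q = 0"
  using assms(1,2,3,5,6,7)
proof (induction m arbitrary: c)
  case 0
  then show ?case using assms(4) by auto
next
  case (Suc m)
  let ?R = "r + 1"
  let ?N = "?R ^ m"
  define F where "F = (\<lambda>q z. \<Prod>i<m. f i z ^ (q div ?R ^ i mod ?R))"
  define G where "G = (\<lambda>k z. \<Sum>q<?N. c (k * ?N + q) * F q z)"
  have F: "F q \<in> polynomial_functions C" for q
    unfolding F_def
    by (intro polynomial_functions_prod polynomial_functions_power Suc.prems(1)) auto
  have digits: "(\<Prod>i<Suc m. f i z ^ ((k * ?N + q) div ?R ^ i mod ?R)) = F q z * f m z ^ k"
    if "k < ?R" "q < ?N" for k q z
  proof -
    have "(k * ?N + q) div ?R ^ i mod ?R = q div ?R ^ i mod ?R" if "i < m" for i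
    proof -
      \<comment> \<open>\<open>?N\<close> is a multiple of \<open>?R ^ (i + 1)\<close>, so adding
        \<open>k * ?N\<close> leaves digit \<open>i\<close> unchanged.\<close>
      have "?N = ?R ^ i * (?R * ?R ^ (m - Suc i))"
        using that by (simp flip: power_Suc power_add add: Suc_diff_Suc)
      then have "k * ?N + q = q + ?R ^ i * (?R * (k * ?R ^ (m - Suc i)))"
        by (simp add: algebra_simps)
      also have "\<dots> div ?R ^ i = q div ?R ^ i + ?R * (k * ?R ^ (m - Suc i))"
        by (subst div_mult_self2) auto
      finally show ?thesis by (metis mod_mult_self2)
    qed
    moreover have "(k * ?N + q) div ?N mod ?R = k"
      using that by (simp add: div_mult_self3)
    ultimately show ?thesis by (simp add: F_def)
  qed
  have total: "(\<Sum>k<?R. f m z ^ k * G k z) = 0" if "z \<in> Z (Suc m)" for z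
  proof -
    let ?T = "\<lambda>q. c q * (\<Prod>i<Suc m. f i z ^ (q div ?R ^ i mod ?R))"
    have "(\<Sum>q<?R ^ Suc m. ?T q) = (\<Sum>k<?R. \<Sum>q\<in>{k * ?N..<k * ?N + ?N}. ?T q)"
      by (simp only: sum.nat_group power_Suc)
    also have "\<dots> = (\<Sum>k<?R. \<Sum>q<?N. ?T (k * ?N + q))"
      by (simp add: sum.atLeastLessThan_shift_0 atLeast0LessThan)
    also have "\<dots> = (\<Sum>k<?R. f m z ^ k * G k z)"
      unfolding G_def sum_distrib_left
      by (intro sum.cong refl) (simp only: lessThan_iff digits mult_ac)
    finally show ?thesis using Suc.prems(6)[OF that] by simp
  qed
  have "k < ?R \<longrightarrow> (\<forall>q<?N. c (k * ?N + q) = 0)" for k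
  proof (induction k rule: less_induct)
    case (less k)
    show ?case
    proof
      assume k: "k < ?R"
      have G0: "G l z = 0" if "l < k" for l z
        using less[OF that] that k unfolding G_def by simp
      \<comment> \<open>With the coefficients for digits below \<open>k\<close> already zero,
        \<open>f m ^ k\<close> splits off. It can be cancelled on the irreducible set
        \<open>Z (Suc m)\<close>, where \<open>f m\<close> is not identically zero. On the smaller
        set \<open>Z m\<close>, where \<open>f m\<close> vanishes, the cofactor \<open>H\<close>
        reduces to \<open>G k\<close>, to which the induction hypothesis applies.\<close>
      define H where "H = (\<lambda>z. \<Sum>l\<in>{k..<?R}. f m z ^ (l - k) * G l z)"
      have "f m z ^ k * H z = 0" if "z \<in> Z (Suc m)" for z
      proof -
        have "(\<Sum>l<?R. f m z ^ l * G l z) = (\<Sum>l\<in>{k..<?R}. f m z ^ l * G l z)"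
          by (rule sum.mono_neutral_right) (auto simp: G0)
        also have "\<dots> = f m z ^ k * H z"
          unfolding H_def sum_distrib_left
          by (intro sum.cong refl) (simp add: mult.assoc[symmetric] power_add[symmetric])
        finally show ?thesis using total[OF that] by simp
      qed
      moreover have "H \<in> polynomial_functions C" "(\<lambda>z. f m z ^ k) \<in> polynomial_functions C"
        unfolding H_def G_def
        by (intro polynomial_functions_sum polynomial_functions.mult polynomial_functions_power
            polynomial_functions.const F Suc.prems(1); simp)+
      ultimately have "(\<forall>z\<in>Z (Suc m). f m z ^ k = 0) \<or> (\<forall>z\<in>Z (Suc m). H z = 0)"
        using Suc.prems(2)[of "Suc m" "\<lambda>z. f m z ^ k" H] by blast
      with Suc.prems(5)[of m] have H: "\<forall>z\<in>Z (Suc m). H z = 0" by auto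
      have "(\<Sum>q<?N. c (k * ?N + q) * F q z) = 0" if "z \<in> Z m" for z
      proof -
        have "f m z = 0" using Suc.prems(4)[of m] that by simp
        then have "H z = (\<Sum>l\<in>{k..<?R}. if l = k then G l z else 0)"
          unfolding H_def by (intro sum.cong refl) auto
        then have "H z = G k z" using k by simp
        with H Suc.prems(3)[of m] that show ?thesis by (auto simp: G_def)
      qed
      then have "(\<Sum>q<?N. c (k * ?N + q) * (\<Prod>i<m. f i z ^ (q div ?R ^ i mod ?R))) = 0"
        if "z \<in> Z m" for z
        using that by (simp only: F_def)
      from Suc.IH[of "\<lambda>q. c (k * ?N + q)", OF _ _ _ _ _ this]
      show "\<forall>q<?N. c (k * ?N + q) = 0"
        using Suc.prems(1-5) by simp
    qed
  qed
  moreover have "\<exists>k l. q = k * ?N + l \<and> k < ?R \<and> l < ?N" if "q < ?R ^ Suc m" for q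
  proof (intro exI conjI)
    show "q = q div ?N * ?N + q mod ?N" by (rule div_mult_mod_eq[symmetric])
    show "q div ?N < ?R" using that by (simp add: less_mult_imp_div_less)
  qed simp
  ultimately show ?case by (metis (full_types))
qed

text \<open>On the line from \<open>w\<close> to \<open>w'\<close> the product of \<open>f\<close>,
  \<open>g\<close> and \<open>q\<close> vanishes at every parameter: either \<open>q\<close> is zero
  there, or the point lies in the locus where \<open>f * g\<close> is known to vanish. Since
  \<open>f\<close> and \<open>q\<close> are nonzero at \<open>w\<close>, the restriction of
  \<open>g\<close> is the zero polynomial.\<close>

lemma union_of_nonzero_loci_integral:
  fixes f g :: "('x \<Rightarrow> 'k::field) \<Rightarrow> 'k"
  assumes inf: "infinite (UNIV :: 'k set)"
    and pol: "f \<in> polynomial_functions (coordinate_functions X)"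
      "g \<in> polynomial_functions (coordinate_functions X)" "Q \<subseteq> polynomial_functions (coordinate_functions X)"
    and line: "\<And>w w' \<tau>. w \<in> L \<Longrightarrow> w' \<in> L \<Longrightarrow> (\<lambda>x. w x + \<tau> * (w' x - w x)) \<in> L"
    and zero: "\<And>w. w \<in> L \<Longrightarrow> \<exists>q\<in>Q. q w \<noteq> 0 \<Longrightarrow> f w * g w = 0"
    and w: "w \<in> L" "q \<in> Q" "q w \<noteq> 0" "f w \<noteq> 0"
    and w': "w' \<in> L" 
  shows "g w' = 0"
proof -
  define \<gamma> where "\<gamma> = (\<lambda>\<tau> x. w x + \<tau> * (w' x - w x))"
  have "\<exists>p. \<forall>\<tau>. h (\<gamma> \<tau>) = poly p \<tau>" if "h \<in> polynomial_functions (coordinate_functions X)" for h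
    using that
  proof (rule polynomial_functions_curve)
    fix c :: "('x \<Rightarrow> 'k) \<Rightarrow> 'k" assume "c \<in> coordinate_functions X"
    then obtain x where "c = (\<lambda>w. w x)" by (auto simp: coordinate_functions_def)
    then show "\<exists>p. \<forall>\<tau>. c (\<gamma> \<tau>) = poly p \<tau>"
      by (intro exI[of _ "[:w x, w' x - w x:]"]) (simp add: \<gamma>_def)
  qed
  then obtain pf pg pq where p: "\<And>\<tau>. f (\<gamma> \<tau>) = poly pf \<tau>" "\<And>\<tau>. g (\<gamma> \<tau>) = poly pg \<tau>"
      "\<And>\<tau>. q (\<gamma> \<tau>) = poly pq \<tau>"
    using pol w(2) by (metis subsetD)
  have "poly (pf * pg * pq) \<tau> = 0" for \<tau>
  proof (cases "q (\<gamma> \<tau>) = 0")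
    case False
    have "\<gamma> \<tau> \<in> L" unfolding \<gamma>_def by (rule line[OF w(1) w'])
    then have "f (\<gamma> \<tau>) * g (\<gamma> \<tau>) = 0" using zero False w(2) by blast
    then show ?thesis by (simp add: p)
  qed (simp add: p)
  then have "pf * pg * pq = 0"
    using inf by (metis (mono_tags, lifting) UNIV_eq_I mem_Collect_eq poly_roots_finite)
  moreover have "\<gamma> 0 = w" "\<gamma> 1 = w'" by (auto simp: \<gamma>_def)
  then have "pf \<noteq> 0" "pq \<noteq> 0" using w p by (metis poly_0)+
  ultimately have "pg = 0" by simp
  with p(2)[of 1] \<open>\<gamma> 1 = w'\<close> show ?thesis by simp
qed

text \<open>The closures of the images of the affine subspaces through \<open>w\<^sub>0\<close> in which only the first \<open>i\<close>
  coordinates vary form the required chain.\<close>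

theorem krull_dim_parametrised:
  fixes S P :: "'a set" and C :: "('a \<Rightarrow> 'k::field) set" and \<psi> :: "('x \<Rightarrow> 'k) \<Rightarrow> 'a"
  assumes inf: "infinite (UNIV :: 'k set)" and "P \<subseteq> S"
    and \<psi>: "\<And>f. f \<in> C \<Longrightarrow> (\<lambda>w. f (\<psi> w)) \<in> polynomial_functions (coordinate_functions X)"
    and Q: "Q \<subseteq> polynomial_functions (coordinate_functions X)" and W: "W = {w. \<exists>q\<in>Q. q w \<noteq> 0}"
    and \<psi>P: "\<And>w. w \<in> W \<Longrightarrow> \<psi> w \<in> P"
    and dense: "\<And>f a. f \<in> polynomial_functions C \<Longrightarrow> (\<And>w. w \<in> W \<Longrightarrow> f (\<psi> w) = 0) \<Longrightarrow> a \<in> P \<Longrightarrow> f a = 0"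
    and w\<^sub>0: "w\<^sub>0 \<in> W" and \<xi>: "bij_betw \<xi> {..<D} X"
    and sep: "\<And>i w'. i < D \<Longrightarrow> w' \<in> W \<Longrightarrow> (\<And>k. i < k \<Longrightarrow> k < D \<Longrightarrow> w' (\<xi> k) = w\<^sub>0 (\<xi> k)) \<Longrightarrow>
      w' (\<xi> i) \<noteq> w\<^sub>0 (\<xi> i) \<Longrightarrow>
      \<exists>f\<in>polynomial_functions C. f (\<psi> w') \<noteq> 0 \<and>
        (\<forall>w\<in>W. (\<forall>k. i \<le> k \<and> k < D \<longrightarrow> w (\<xi> k) = w\<^sub>0 (\<xi> k)) \<longrightarrow> f (\<psi> w) = 0)"
  shows "irreducible_space (subtopology (zariski_topology S C) P)"
    and "krull_dim (subtopology (zariski_topology S C) P) = ereal (real D)"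
proof -
  let ?X = "zariski_topology S C"
  let ?pf = "polynomial_functions C"
  let ?pw = "polynomial_functions (coordinate_functions X)"
  have X: "finite X" "card X = D"
    using \<xi> by (auto simp: bij_betw_finite[symmetric] dest: bij_betw_same_card)
  have pull: "(\<lambda>w. f (\<psi> w)) \<in> ?pw" if "f \<in> ?pf" for f
    using that \<psi> by (rule polynomial_functions_compose)
  \<comment> \<open>Used with \<open>L = UNIV\<close> for \<open>P\<close> itself and with the
    affine subspaces \<open>L i\<close> for the members of the chain.\<close>
  have integral: "(\<forall>w\<in>W \<inter> L. f (\<psi> w) = 0) \<or> (\<forall>w\<in>W \<inter> L. g (\<psi> w) = 0)"
    if "f \<in> ?pf" "g \<in> ?pf" "\<And>w. w \<in> W \<inter> L \<Longrightarrow> f (\<psi> w) * g (\<psi> w) = 0"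
      and "\<And>w w' \<tau>. w \<in> L \<Longrightarrow> w' \<in> L \<Longrightarrow> (\<lambda>x. w x + \<tau> * (w' x - w x)) \<in> L" for f g L
  proof (rule ccontr)
    assume "\<not> ?thesis"
    then obtain w w' where w: "w \<in> W" "w \<in> L" "f (\<psi> w) \<noteq> 0" "w' \<in> L" "g (\<psi> w') \<noteq> 0" by blast
    from w(1) obtain q where "q \<in> Q" "q w \<noteq> 0" unfolding W by blast
    then have "g (\<psi> w') = 0"
      using union_of_nonzero_loci_integral[OF inf pull[OF that(1)] pull[OF that(2)] Q that(4) _ w(2) _ _ w(3,4)]
        that(3) unfolding W by blast
    with w(5) show False by simp
  qed
  show irr: "irreducible_space (subtopology ?X P)"
    unfolding irreducible_zariski_iff[OF \<open>P \<subseteq> S\<close>]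
  proof (intro conjI ballI impI)
    show "P \<noteq> {}" using w\<^sub>0 \<psi>P by blast
    fix f g assume "f \<in> ?pf" "g \<in> ?pf" "\<forall>y\<in>P. f y * g y = 0"
    with integral[of f g UNIV] \<psi>P have "(\<forall>w\<in>W. f (\<psi> w) = 0) \<or> (\<forall>w\<in>W. g (\<psi> w) = 0)" by simp
    with dense \<open>f \<in> ?pf\<close> \<open>g \<in> ?pf\<close> show "(\<forall>y\<in>P. f y = 0) \<or> (\<forall>y\<in>P. g y = 0)" by metis
  qed
  define L where "L = (\<lambda>i. {w. \<forall>k. i \<le> k \<and> k < D \<longrightarrow> w (\<xi> k) = w\<^sub>0 (\<xi> k)})"
  define Z where "Z = (\<lambda>i. P \<inter> zero_locus S {f \<in> ?pf. \<forall>w\<in>W \<inter> L i. f (\<psi> w) = 0})"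
  have \<psi>Z: "\<psi> w \<in> Z i" if "w \<in> W \<inter> L i" for w i
    using that \<psi>P \<open>P \<subseteq> S\<close> by (auto simp: Z_def zero_locus_def)
  have w\<^sub>0L: "w\<^sub>0 \<in> L i" for i by (auto simp: L_def)
  have chain: "\<exists>Z. (\<forall>i\<le>D. closedin (subtopology ?X P) (Z i) \<and>
        irreducible_space (subtopology (subtopology ?X P) (Z i))) \<and> (\<forall>i<D. Z i \<subset> Z (Suc i))"
  proof (intro exI[of _ Z] conjI allI impI)
    fix i
    show "closedin (subtopology ?X P) (Z i)"
      unfolding closedin_subtopology closedin_zariski Z_def by (metis (no_types, lifting) Int_commute mem_Collect_eq subsetI)
    have ZP: "Z i \<subseteq> P" by (simp add: Z_def)
    have "irreducible_space (subtopology ?X (Z i))"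
      unfolding irreducible_zariski_iff[OF subset_trans[OF ZP \<open>P \<subseteq> S\<close>]]
    proof (intro conjI ballI impI)
      show "Z i \<noteq> {}" using \<psi>Z[of w\<^sub>0 i] w\<^sub>0 w\<^sub>0L by blast
      fix f g assume fg: "f \<in> ?pf" "g \<in> ?pf" "\<forall>y\<in>Z i. f y * g y = 0"
      have "(\<forall>w\<in>W \<inter> L i. f (\<psi> w) = 0) \<or> (\<forall>w\<in>W \<inter> L i. g (\<psi> w) = 0)"
        by (rule integral[OF fg(1,2)]) (use fg(3) \<psi>Z in \<open>auto simp: L_def\<close>)
      with fg(1,2) show "(\<forall>y\<in>Z i. f y = 0) \<or> (\<forall>y\<in>Z i. g y = 0)"
        by (auto simp: Z_def zero_locus_def)
    qed
    then show "irreducible_space (subtopology (subtopology ?X P) (Z i))"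
      using ZP by (simp add: subtopology_subtopology Int_absorb1)
  next
    fix i assume i: "i < D"
    have "L i \<subseteq> L (Suc i)" by (auto simp: L_def)
    then have "Z i \<subseteq> Z (Suc i)" by (fastforce simp: Z_def zero_locus_def)
    moreover have "Z i \<noteq> Z (Suc i)"
    proof -
      obtain q where q: "q \<in> Q" "q w\<^sub>0 \<noteq> 0" using w\<^sub>0 unfolding W by blast
      \<comment> \<open>Only the newly released coordinate moves. \<open>q\<close> is a nonzero
        polynomial along this line, so some \<open>\<tau> \<noteq> 0\<close> stays inside
        \<open>W\<close> and gives a point to which \<open>sep\<close> applies.\<close>
      define \<gamma> where "\<gamma> = (\<lambda>\<tau>. w\<^sub>0(\<xi> i := w\<^sub>0 (\<xi> i) + \<tau>))"
      have "\<exists>p. \<forall>\<tau>. q (\<gamma> \<tau>) = poly p \<tau>"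
      proof (rule polynomial_functions_curve[of q "coordinate_functions X" \<gamma>])
        show "q \<in> ?pw" using q Q by blast
        fix c :: "('x \<Rightarrow> 'k) \<Rightarrow> 'k" assume "c \<in> coordinate_functions X"
        then obtain x where x: "c = (\<lambda>w. w x)" by (auto simp: coordinate_functions_def)
        have "c (\<gamma> \<tau>) = poly [:w\<^sub>0 x, if x = \<xi> i then 1 else 0:] \<tau>" for \<tau>
          by (simp add: x \<gamma>_def)
        then show "\<exists>p. \<forall>\<tau>. c (\<gamma> \<tau>) = poly p \<tau>" by blast
      qed
      then obtain p where p: "\<And>\<tau>. q (\<gamma> \<tau>) = poly p \<tau>" by blast
      have "\<gamma> 0 = w\<^sub>0" by (simp add: \<gamma>_def)
      with q(2) p have "p \<noteq> 0" by (metis poly_0)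
      then have "finite (insert 0 {\<tau>. poly p \<tau> = 0})" by (simp add: poly_roots_finite)
      then obtain \<tau> where \<tau>: "\<tau> \<noteq> 0" "poly p \<tau> \<noteq> 0"
        using inf by (metis (mono_tags, lifting) ex_new_if_finite insert_iff mem_Collect_eq)
      let ?w = "\<gamma> \<tau>"
      have inj: "\<xi> k = \<xi> i \<longleftrightarrow> k = i" if "k < D" for k
        using \<xi> i that by (auto simp: bij_betw_def inj_on_def)
      have "?w \<in> W" unfolding W using q(1) \<tau>(2) p by (auto intro!: bexI[of _ q])
      moreover have "?w (\<xi> k) = w\<^sub>0 (\<xi> k)" if "i < k" "k < D" for k
        using inj[OF that(2)] that(1) by (simp add: \<gamma>_def)
      moreover have "?w (\<xi> i) \<noteq> w\<^sub>0 (\<xi> i)" using \<tau>(1) by (simp add: \<gamma>_def)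
      ultimately obtain f where f: "f \<in> ?pf" "f (\<psi> ?w) \<noteq> 0" "\<forall>w\<in>W \<inter> L i. f (\<psi> w) = 0"
        using sep[OF i, of ?w] unfolding L_def by auto
      have "?w \<in> L (Suc i)"
        using \<open>\<And>k. i < k \<Longrightarrow> k < D \<Longrightarrow> ?w (\<xi> k) = w\<^sub>0 (\<xi> k)\<close> by (simp add: L_def)
      then have "\<psi> ?w \<in> Z (Suc i)" using \<open>?w \<in> W\<close> by (intro \<psi>Z) blast
      moreover have "\<psi> ?w \<notin> Z i" using f by (auto simp: Z_def zero_locus_def)
      ultimately show ?thesis by blast
    qed
    ultimately show "Z i \<subset> Z (Suc i)" by blast
  qed
  have bound: "m \<le> D" if Z: "\<forall>i\<le>m. closedin (subtopology ?X P) (Z i) \<and>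
        irreducible_space (subtopology (subtopology ?X P) (Z i))" "\<forall>i<m. Z i \<subset> Z (Suc i)" for m Z
  proof (rule ccontr)
    assume "\<not> m \<le> D"
    \<comment> \<open>A longer chain is cut off after \<open>D + 1\<close> steps, one more than the
      number of parameters.\<close>
    define M where "M = Suc D"
    have M: "M \<le> m" using \<open>\<not> m \<le> D\<close> by (simp add: M_def)
    have ZP: "Z i \<subseteq> P" if "i \<le> M" for i
      using Z(1) that M by (metis closedin_subset le_trans topspace_subtopology_subset topspace_zariski \<open>P \<subseteq> S\<close>)
    have irrZ: "irreducible_space (subtopology ?X (Z i))" if "i \<le> M" for i
    proof -
      have "P \<inter> Z i = Z i" using ZP[OF that] by blast
      with Z(1) that M show ?thesis by (metis le_trans subtopology_subtopology)
    qed
    have "\<exists>f\<in>?pf. (\<forall>z\<in>Z i. f z = 0) \<and> (\<exists>z\<in>Z (Suc i). f z \<noteq> 0)" if "i < M" for i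
    proof -
      from Z(1) that M obtain T where "closedin ?X T" "Z i = T \<inter> P"
        unfolding closedin_subtopology by (meson le_trans less_imp_le_nat)
      then obtain F where F: "F \<subseteq> ?pf" "Z i = zero_locus S F \<inter> P"
        unfolding closedin_zariski by blast
      have "Z i \<subset> Z (Suc i)" using Z(2) that M by simp
      then obtain z where z: "z \<in> Z (Suc i)" "z \<notin> Z i" by blast
      then have "z \<in> P" using ZP[of "Suc i"] that by auto
      with z F \<open>P \<subseteq> S\<close> show ?thesis by (fastforce simp: zero_locus_def)
    qed
    then obtain f where f: "\<And>i. i < M \<Longrightarrow> f i \<in> ?pf" "\<And>i z. i < M \<Longrightarrow> z \<in> Z i \<Longrightarrow> f i z = 0"
        "\<And>i. i < M \<Longrightarrow> \<exists>z\<in>Z (Suc i). f i z \<noteq> 0" by metis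
    have "\<exists>b. (\<lambda>w. f i (\<psi> w)) \<in> functions_of_degree X b" if "i < M" for i
      using polynomial_functions_degree[OF X(1) pull[OF f(1)[OF that]]] .
    then obtain B where B: "\<And>i. i < M \<Longrightarrow> (\<lambda>w. f i (\<psi> w)) \<in> functions_of_degree X (B i)" by metis
    define b where "b = (\<Sum>i<M. B i)"
    have b: "(\<lambda>w. f i (\<psi> w)) \<in> functions_of_degree X b" if "i < M" for i
      using functions_of_degree_mono[OF X(1) _ B[OF that], of b] that by (auto simp: b_def member_le_sum)
    \<comment> \<open>From \<open>M * r * b + 1 \<le> (M * b + 1) * (r + 1)\<close> the number of
      available monomials is at most \<open>(M * b + 1) ^ D * (r + 1) ^ D\<close>; this choice of
      \<open>r\<close> makes it \<open>r * (r + 1) ^ D\<close>, which is less than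
      \<open>(r + 1) ^ M\<close>.\<close>
    define r where "r = (M * b + 1) ^ D"
    define F where "F = (\<lambda>q z. \<Prod>i<M. f i z ^ (q div (r + 1) ^ i mod (r + 1)))"
    have Fpf: "F q \<in> ?pf" for q
      unfolding F_def by (intro polynomial_functions_prod polynomial_functions_power f(1)) simp
    have "(\<lambda>w. F q (\<psi> w)) \<in> functions_of_degree X (M * (r * b))" for q
      unfolding F_def
    proof (rule functions_of_degree_prod[OF X(1)])
      fix i assume "i < M"
      have "q div (r + 1) ^ i mod (r + 1) * b \<le> r * b"
        by (intro mult_right_mono) (simp_all add: less_Suc_eq_le[symmetric])
      then show "(\<lambda>w. f i (\<psi> w) ^ (q div (r + 1) ^ i mod (r + 1))) \<in> functions_of_degree X (r * b)"
        using functions_of_degree_mono[OF X(1) _ functions_of_degree_power[OF X(1) b[OF \<open>i < M\<close>]]] by blast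
    qed
    moreover have "(M * (r * b) + 1) ^ card X < (r + 1) ^ M"
    proof -
      have "(M * (r * b) + 1) ^ D \<le> ((M * b + 1) * (r + 1)) ^ D"
        by (intro power_mono) (simp_all add: algebra_simps)
      also have "\<dots> = r * (r + 1) ^ D" by (simp only: r_def power_mult_distrib)
      also have "\<dots> < (r + 1) ^ M" by (simp add: M_def)
      finally show ?thesis by (simp add: X(2))
    qed
    ultimately obtain c where c: "\<exists>q<(r + 1) ^ M. c q \<noteq> 0"
        "\<And>w. (\<Sum>q<(r + 1) ^ M. c q * F q (\<psi> w)) = 0"
      using functions_of_degree_dependent[OF X(1), of "(r + 1) ^ M" "\<lambda>q w. F q (\<psi> w)" "M * (r * b)"] by blast
    \<comment> \<open>The relation is found on the parameter space; being a polynomial function on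
      \<open>S\<close>, it passes to all of \<open>P\<close> by density.\<close>
    have cpf: "(\<lambda>z. \<Sum>q<(r + 1) ^ M. c q * F q z) \<in> ?pf"
      by (intro polynomial_functions_sum polynomial_functions.mult polynomial_functions.const Fpf)
    have "\<forall>q<(r + 1) ^ M. c q = 0"
    proof (rule chain_monomials_independent[where f = f and C = C and Z = Z])
      show "Z 0 \<noteq> {}" using irrZ[of 0] by (auto simp: irreducible_space_def)
      fix z assume "z \<in> Z M"
      then have "z \<in> P" using ZP by blast
      from dense[OF cpf c(2) this]
      show "(\<Sum>q<(r + 1) ^ M. c q * (\<Prod>i<M. f i z ^ (q div (r + 1) ^ i mod (r + 1)))) = 0"
        unfolding F_def .
    next
      fix i g h
      assume gh: "i \<le> M" "g \<in> ?pf" "h \<in> ?pf" "\<And>z. z \<in> Z i \<Longrightarrow> g z * h z = 0"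
      have "Z i \<subseteq> S" using ZP[OF gh(1)] \<open>P \<subseteq> S\<close> by blast
      from irrZ[OF gh(1)] gh(2-4) show "(\<forall>z\<in>Z i. g z = 0) \<or> (\<forall>z\<in>Z i. h z = 0)"
        unfolding irreducible_zariski_iff[OF \<open>Z i \<subseteq> S\<close>] by simp
    next
      fix i assume "i < M"
      with Z(2) M show "Z i \<subseteq> Z (Suc i)" by (simp add: psubset_imp_subset)
    qed (use f in auto)
    with c(1) show False by blast
  qed
  show "krull_dim (subtopology ?X P) = ereal (real D)"
    unfolding krull_dim_def
  proof (rule Sup_eqI)
    fix y :: ereal
    assume "y \<in> {ereal (real m) | m. \<exists>Z :: nat \<Rightarrow> 'a set.
      (\<forall>i\<le>m. closedin (subtopology ?X P) (Z i) \<and>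
        irreducible_space (subtopology (subtopology ?X P) (Z i))) \<and> (\<forall>i<m. Z i \<subset> Z (Suc i))}"
    then obtain m Z where "y = ereal (real m)" "\<forall>i\<le>m. closedin (subtopology ?X P) (Z i) \<and>
        irreducible_space (subtopology (subtopology ?X P) (Z i))" "\<forall>i<m. Z i \<subset> Z (Suc i)"
      by blast
    with bound[of m Z] show "y \<le> ereal (real D)" by simp
  next
    fix y :: ereal
    assume "\<And>x. x \<in> {ereal (real m) | m. \<exists>Z :: nat \<Rightarrow> 'a set.
      (\<forall>i\<le>m. closedin (subtopology ?X P) (Z i) \<and>
        irreducible_space (subtopology (subtopology ?X P) (Z i))) \<and> (\<forall>i<m. Z i \<subset> Z (Suc i))} \<Longrightarrow> x \<le> y"
    from this[OF CollectI] chain show "ereal (real D) \<le> y" by blast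
  qed
qed

section \<open>Dehomogenisation of the resolution\<close>

lemma homog_zero [simp]: "0 \<in> homog e"
  and homog_add: "p \<in> homog e \<Longrightarrow> q \<in> homog e \<Longrightarrow> p + q \<in> homog e"
  and homog_one: "1 \<in> homog 0"
proof -
  show "0 \<in> homog e" by (simp add: homog_def)
  show "p + q \<in> homog e" if "p \<in> homog e" "q \<in> homog e"
    using that unfolding homog_def mem_Collect_eq by (metis add.right_neutral coeff_add)
  show "1 \<in> homog 0" by (auto simp: homog_def coeff_1)
qed

lemma homog_sum: "(\<And>i. i \<in> A \<Longrightarrow> f i \<in> homog e) \<Longrightarrow> (\<Sum>i\<in>A. f i) \<in> homog e"
  by (induction A rule: infinite_finite_induct) (auto intro: homog_add)

lemma homog_mult:
  assumes "p \<in> homog e" "q \<in> homog e'"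
  shows "p * q \<in> homog (e + e')"
proof -
  have "int i + int l = e + e'" if "coeff (coeff (p * q) l) i \<noteq> 0" for i l
  proof -
    have "(\<Sum>j\<le>l. \<Sum>k\<le>i. coeff (coeff p j) k * coeff (coeff q (l - j)) (i - k)) \<noteq> 0"
      using that by (simp add: coeff_mult coeff_sum)
    then obtain j where j: "j \<le> l" "(\<Sum>k\<le>i. coeff (coeff p j) k * coeff (coeff q (l - j)) (i - k)) \<noteq> 0"
      by (metis (no_types, lifting) atMost_iff sum.neutral)
    then obtain k where k: "k \<le> i" "coeff (coeff p j) k * coeff (coeff q (l - j)) (i - k) \<noteq> 0"
      by (metis (no_types, lifting) atMost_iff sum.neutral)
    then have "coeff (coeff p j) k \<noteq> 0" "coeff (coeff q (l - j)) (i - k) \<noteq> 0" by auto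
    then have "int k + int j = e" "int (i - k) + int (l - j) = e'"
      using assms by (auto simp: homog_def)
    with j(1) k(1) show ?thesis by (simp add: of_nat_diff)
  qed
  then show ?thesis by (simp add: homog_def)
qed

lemma homog_coeff_eq_0: "p \<in> homog (int e) \<Longrightarrow> i + j \<noteq> e \<Longrightarrow> coeff (coeff p j) i = 0"
  unfolding homog_def mem_Collect_eq by (metis of_nat_add of_nat_eq_iff)

lemma coeff_dehomogenize:
  assumes "p \<in> homog (int e)"
  shows "coeff (poly p 1) i = (if i \<le> e then coeff (coeff p (e - i)) i else 0)"
proof -
  have "coeff (poly p 1) i = (\<Sum>j\<le>degree p. coeff (coeff p j) i)"
    by (simp add: poly_altdef coeff_sum)
  also have "\<dots> = (\<Sum>j\<le>degree p. if j = e - i \<and> i \<le> e then coeff (coeff p (e - i)) i else 0)"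
  proof (rule sum.cong[OF refl])
    fix j
    show "coeff (coeff p j) i = (if j = e - i \<and> i \<le> e then coeff (coeff p (e - i)) i else 0)"
      using homog_coeff_eq_0[OF assms, of i j] by auto
  qed
  also have "\<dots> = (if i \<le> e then coeff (coeff p (e - i)) i else 0)"
    by (auto simp: coeff_eq_0)
  finally show ?thesis .
qed

lemma degree_dehomogenize: "p \<in> homog (int e) \<Longrightarrow> degree (poly p 1) \<le> e"
  by (rule degree_le) (simp add: coeff_dehomogenize)

lemma homog_eq_0:
  assumes "p \<in> homog (int e)" "poly p 1 = 0"
  shows "p = 0"
proof -
  have "coeff (coeff p j) i = 0" for i j
  proof (cases "i + j = e")
    case True
    then show ?thesis using coeff_dehomogenize[OF assms(1), of i] assms(2) by auto
  next
    case False
    then show ?thesis by (rule homog_coeff_eq_0[OF assms(1)])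
  qed
  then show ?thesis by (simp add: poly_eq_iff)
qed

lemma homog_eqI:
  assumes "p \<in> homog (int e)" "q \<in> homog (int e)" "poly p 1 = poly q 1"
  shows "p = q"
proof -
  have "p - q \<in> homog (int e)"
    using assms(1,2) unfolding homog_def mem_Collect_eq by (metis coeff_diff diff_zero)
  from homog_eq_0[OF this] assms(3) show ?thesis by simp
qed

text \<open>Coefficients above \<open>e\<close> are dropped, so setting \<open>t = 1\<close>
  recovers \<open>q\<close> only if its degree is at most \<open>e\<close>.\<close>

definition homogenize :: "nat \<Rightarrow> 'k::comm_ring_1 poly \<Rightarrow> 'k poly poly" where
  "homogenize e q = (\<Sum>i\<le>e. monom (monom (coeff q i) i) (e - i))"

lemma coeff_homogenize: "coeff (coeff (homogenize e q) j) i = (if i + j = e then coeff q i else 0)"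
proof -
  have "coeff (coeff (homogenize e q) j) i =
      (\<Sum>l\<le>e. if l = i then (if i + j = e then coeff q i else 0) else 0)"
    unfolding homogenize_def coeff_sum by (intro sum.cong refl) auto
  then show ?thesis by auto
qed

lemma homogenize_homog [simp]: "homogenize e q \<in> homog (int e)"
  by (auto simp: homog_def coeff_homogenize split: if_splits)

lemma poly_homogenize:
  assumes "degree q \<le> e"
  shows "poly (homogenize e q) 1 = q"
  by (rule poly_eqI) (use assms in \<open>auto simp: coeff_dehomogenize[OF homogenize_homog]
      coeff_homogenize coeff_eq_0\<close>)

definition component :: "nat \<Rightarrow> 'k::comm_ring_1 poly poly \<Rightarrow> 'k poly poly" where
  "component e p = (\<Sum>j\<le>e. monom (monom (coeff (coeff p j) (e - j)) (e - j)) j)"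

lemma coeff_component:
  "coeff (coeff (component e p) j) i = (if i + j = e then coeff (coeff p j) i else 0)"
proof -
  have "coeff (coeff (component e p) j) i =
      (\<Sum>l\<le>e. if l = j then (if i + j = e then coeff (coeff p j) i else 0) else 0)"
    unfolding component_def coeff_sum by (intro sum.cong refl) auto
  then show ?thesis by auto
qed

lemma component_homog [simp]: "component e p \<in> homog (int e)"
  by (auto simp: homog_def coeff_component split: if_splits)

lemma component_of_homog:
  "p \<in> homog (int e) \<Longrightarrow> component e' p = (if e' = e then p else 0)"
  by (auto simp: poly_eq_iff coeff_component homog_coeff_eq_0)

lemma component_add: "component e (p + q) = component e p + component e q"
  by (simp add: poly_eq_iff coeff_component)

lemma component_sum: "component e (\<Sum>i\<in>A. f i) = (\<Sum>i\<in>A. component e (f i))"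
  by (induction A rule: infinite_finite_induct)
     (simp_all add: component_add, simp_all add: poly_eq_iff coeff_component)

text \<open>The decomposition holds for every sufficiently large cutoff, so that several polynomials
  can share one cutoff.\<close>

lemma component_decomposition:
  obtains B where "\<And>b. B \<le> b \<Longrightarrow> p = (\<Sum>e\<le>b. component e p)"
proof
  define B where "B = degree p + (\<Sum>j\<le>degree p. degree (coeff p j))"
  fix b assume "B \<le> b"
  have "coeff (coeff p j) i = (\<Sum>e\<le>b. if i + j = e then coeff (coeff p j) i else 0)" for i j
  proof (cases "i + j \<le> b")
    case False
    have "coeff (coeff p j) i = 0"
    proof (cases "j \<le> degree p")
      case True
      then have "degree (coeff p j) \<le> (\<Sum>j\<le>degree p. degree (coeff p j))"
        by (intro member_le_sum) auto
      with False True \<open>B \<le> b\<close> show ?thesis by (simp add: B_def coeff_eq_0)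
    qed (simp add: coeff_eq_0)
    then show ?thesis by simp
  qed simp
  then show "p = (\<Sum>e\<le>b. component e p)"
    by (simp add: poly_eq_iff coeff_sum coeff_component)
qed

lemma component_mult:
  assumes h: "h \<in> homog (int m)"
  shows "component e (p * h) = (if m \<le> e then component (e - m) p * h else 0)"
proof -
  obtain B where B: "\<And>b. B \<le> b \<Longrightarrow> p = (\<Sum>e\<le>b. component e p)"
    using component_decomposition[of p] by blast
  have "component e (component l p * h) = (if l + m = e then component l p * h else 0)" for l
    using component_of_homog[of "component l p * h" "l + m" e] homog_mult[OF component_homog h, of l p]
    by auto
  then have "component e (p * h) = (\<Sum>l\<le>B + e. if l + m = e then component l p * h else 0)"
    by (subst B[of "B + e"]) (simp_all add: sum_distrib_right component_sum)
  also have "\<dots> = (\<Sum>l\<le>B + e. if l = e - m \<and> m \<le> e then component (e - m) p * h else 0)"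
    by (intro sum.cong refl) auto
  also have "\<dots> = (if m \<le> e then component (e - m) p * h else 0)"
    by auto
  finally show ?thesis .
qed

lemma component_eq_0:
  assumes "\<And>e. component e p = 0"
  shows "p = 0"
proof -
  obtain B where "\<And>b. B \<le> b \<Longrightarrow> p = (\<Sum>e\<le>b. component e p)"
    using component_decomposition[of p] by blast
  from this[of B] show ?thesis by (simp add: assms)
qed

section \<open>Graded resolutions expressed in the chart\<close>

definition syzygy :: "nat \<Rightarrow> (nat \<Rightarrow> 'k::comm_ring_1 poly) \<Rightarrow> (nat \<Rightarrow> 'k poly) \<Rightarrow> bool" where
  "syzygy d b x \<longleftrightarrow> (\<Sum>i\<le>d. x i * b i) = 0"

text \<open>The dehomogenised form of the resolution: in the chart \<open>t = 1\<close> a homogeneous syzygy of degree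
  \<open>e\<close> is a syzygy all of whose entries have degree at most \<open>e\<close>.\<close>

definition mu_basis ::
    "nat \<Rightarrow> (nat \<Rightarrow> nat) \<Rightarrow> (nat \<Rightarrow> 'k::comm_ring_1 poly) \<Rightarrow> (nat \<Rightarrow> nat \<Rightarrow> 'k poly) \<Rightarrow> bool" where
  "mu_basis d \<mu> b \<sigma> \<longleftrightarrow>
     (\<forall>j\<in>{1..d}. syzygy d b (\<sigma> j) \<and> (\<forall>i\<le>d. degree (\<sigma> j i) \<le> \<mu> j)) \<and>
     (\<forall>p. (\<forall>i\<le>d. (\<Sum>j=1..d. p j * \<sigma> j i) = 0) \<longrightarrow> (\<forall>j\<in>{1..d}. p j = 0)) \<and>
     (\<forall>e x. syzygy d b x \<longrightarrow> (\<forall>i\<le>d. degree (x i) \<le> e) \<longrightarrow>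
        (\<exists>p. (\<forall>i\<le>d. x i = (\<Sum>j=1..d. p j * \<sigma> j i)) \<and>
             (\<forall>j\<in>{1..d}. p j \<noteq> 0 \<longrightarrow> degree (p j) + \<mu> j \<le> e)))"

text \<open>Provides surjectivity onto the ideal: adding a multiple of one generator to a
  combination changes a single coefficient.\<close>

lemma linear_combinations_eq_span:
  fixes a :: "nat \<Rightarrow> 'k::comm_ring_1"
  shows "(\<lambda>x. \<Sum>i=0..d. x i * a i) ` {x. \<forall>i. i \<notin> {0..d} \<longrightarrow> x i = 0} =
    Modules.module.span (*) (a ` {0..d})"
proof -
  interpret Modules.module "(*) :: 'k \<Rightarrow> 'k \<Rightarrow> 'k"
    by unfold_locales (simp_all add: algebra_simps)
  let ?F = "{x. \<forall>i. i \<notin> {0..d} \<longrightarrow> x i = (0 :: 'k)}"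
  show ?thesis
  proof (intro equalityI subsetI)
    fix y assume "y \<in> (\<lambda>x. \<Sum>i=0..d. x i * a i) ` ?F"
    then obtain x where "y = (\<Sum>i=0..d. x i * a i)" by blast
    also have "\<dots> \<in> span (a ` {0..d})" by (intro span_sum span_scale span_base) simp
    finally show "y \<in> span (a ` {0..d})" .
  next
    fix y assume "y \<in> span (a ` {0..d})"
    then show "y \<in> (\<lambda>x. \<Sum>i=0..d. x i * a i) ` ?F"
    proof (induction rule: span_induct_alt)
      case base
      show ?case by (rule image_eqI[of _ _ "\<lambda>_. 0"]) auto
    next
      case (step c x y)
      then obtain i z where i: "i \<le> d" "x = a i" and z: "z \<in> ?F" "y = (\<Sum>i=0..d. z i * a i)" by auto
      have "(\<Sum>l=0..d. (z(i := z i + c)) l * a l) =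
          (\<Sum>l=0..d. z l * a l + (if l = i then c * a i else 0))"
        by (intro sum.cong refl) (auto simp: algebra_simps)
      also have "\<dots> = c * x + y" using i z by (simp add: sum.distrib)
      finally show ?case by (intro image_eqI[of _ _ "z(i := z i + c)"]) (use i z in auto)
    qed
  qed
qed

text \<open>A homomorphism of free modules is determined by the images of the unit vectors, so the
  resolution can be replaced by a matrix of forms.\<close>

lemma graded_hom_linear_combination:
  assumes "graded_hom {1..d} m J m' \<phi>" "x \<in> free_module {1..d}"
  shows "\<phi> x = (\<lambda>i. \<Sum>j=1..d. x j * \<phi> (\<lambda>l. if l = j then 1 else 0) i)"
proof -
  let ?u = "\<lambda>j l. if l = j then 1 else 0"
  have add: "\<phi> (\<lambda>i. x i + y i) = (\<lambda>j. \<phi> x j + \<phi> y j)"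
    if "x \<in> free_module {1..d}" "y \<in> free_module {1..d}" for x y
    using assms(1) that unfolding graded_hom_def by blast
  have scale: "\<phi> (\<lambda>i. c * x i) = (\<lambda>j. c * \<phi> x j)" if "x \<in> free_module {1..d}" for c x
    using assms(1) that unfolding graded_hom_def by blast
  have "\<phi> (\<lambda>l. \<Sum>j\<in>A. x j * ?u j l) = (\<lambda>i. \<Sum>j\<in>A. x j * \<phi> (?u j) i)" if "A \<subseteq> {1..d}" "finite A" for A
    using that(2,1)
  proof (induction A)
    case empty
    have "\<phi> (\<lambda>l. 0 * x l) = (\<lambda>j. 0 * \<phi> x j)" by (rule scale[OF assms(2)])
    then show ?case by simp
  next
    case (insert j A)
    have u: "?u j \<in> free_module {1..d}" "(\<lambda>l. x j * ?u j l) \<in> free_module {1..d}"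
      "(\<lambda>l. \<Sum>j\<in>A. x j * ?u j l) \<in> free_module {1..d}"
      using insert.prems by (auto simp: free_module_def intro!: sum.neutral)
    have "(\<lambda>l. \<Sum>j\<in>insert j A. x j * ?u j l) = (\<lambda>l. x j * ?u j l + (\<Sum>j\<in>A. x j * ?u j l))"
      using insert.hyps by (intro ext) (subst sum.insert, auto)
    then have "\<phi> (\<lambda>l. \<Sum>j\<in>insert j A. x j * ?u j l) =
        (\<lambda>i. \<phi> (\<lambda>l. x j * ?u j l) i + \<phi> (\<lambda>l. \<Sum>j\<in>A. x j * ?u j l) i)"
      using add[OF u(2,3)] by (simp only:)
    also have "\<dots> = (\<lambda>i. x j * \<phi> (?u j) i + (\<Sum>j\<in>A. x j * \<phi> (?u j) i))"
      using insert.IH insert.prems by (simp only: scale[OF u(1)]) simp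
    also have "\<dots> = (\<lambda>i. \<Sum>j\<in>insert j A. x j * \<phi> (?u j) i)"
      using insert.hyps by simp
    finally show ?case .
  qed
  from this[of "{1..d}"]
  have "\<phi> (\<lambda>l. \<Sum>j=1..d. x j * ?u j l) = (\<lambda>i. \<Sum>j=1..d. x j * \<phi> (?u j) i)" by simp
  moreover have "(\<lambda>l. \<Sum>j=1..d. x j * ?u j l) = x"
    using assms(2) by (auto simp: free_module_def fun_eq_iff if_distrib[of "\<lambda>z. _ * z"] cong: if_cong)
  ultimately show ?thesis by simp
qed

lemma tuples_homog: "a \<in> tuples n d \<Longrightarrow> i \<le> d \<Longrightarrow> a i \<in> homog (int n)"
  by (auto simp: tuples_def)

text \<open>The columns are the images of the unit vectors at \<open>t = 1\<close>. A relation or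
  syzygy in the chart is first homogenised to a common degree, where injectivity and exactness of
  the graded sequence apply, and the answer is dehomogenised again.\<close>

lemma mu_basis_of_mu_type:
  fixes a :: "nat \<Rightarrow> 'k::field poly poly"
  assumes a: "a \<in> tuples n d" and type: "has_mu_type n d a \<mu>"
  shows "\<exists>\<sigma>. mu_basis d \<mu> (\<lambda>i. poly (a i) 1) \<sigma>"
proof -
  obtain \<phi> where \<phi>: "graded_hom {1..d} (\<lambda>i. int n + int (\<mu> i)) {0..d} (\<lambda>_. int n) \<phi>"
    and inj: "inj_on \<phi> (free_module {1..d})"
    and image: "\<phi> ` free_module {1..d} = {x \<in> free_module {0..d}. (\<Sum>i=0..d. x i * a i) = 0}"
    using type unfolding has_mu_type_def by blast
  define \<Phi> where "\<Phi> = (\<lambda>j. \<phi> (\<lambda>l. if l = j then 1 else 0))"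
  have lin: "\<phi> x = (\<lambda>i. \<Sum>j=1..d. x j * \<Phi> j i)" if "x \<in> free_module {1..d}" for x
    unfolding \<Phi>_def by (rule graded_hom_linear_combination[OF \<phi> that])
  have unit: "(\<lambda>l. if l = j then 1 else 0) \<in> free_module {1..d}" if "j \<in> {1..d}" for j
    using that by (auto simp: free_module_def)
  have \<Phi>_homog: "\<Phi> j i \<in> homog (int (\<mu> j))" if "j \<in> {1..d}" "i \<le> d" for i j
  proof -
    have "(\<lambda>l. if l = j then 1 else 0) \<in>
        graded_piece {1..d} (\<lambda>i. int n + int (\<mu> i)) (int n + int (\<mu> j))"
      using unit[OF that(1)] by (auto simp: graded_piece_def homog_one)
    then have "\<Phi> j \<in> graded_piece {0..d} (\<lambda>_. int n) (int n + int (\<mu> j))"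
      using \<phi> unfolding graded_hom_def \<Phi>_def by blast
    then show ?thesis using that(2) by (auto simp: graded_piece_def)
  qed
  have \<Phi>_syz: "(\<Sum>i\<le>d. \<Phi> j i * a i) = 0" if "j \<in> {1..d}" for j
    using image unit[OF that] unfolding \<Phi>_def atLeast0AtMost by blast
  define \<sigma> where "\<sigma> = (\<lambda>j i. poly (\<Phi> j i) 1)"
  have "syzygy d (\<lambda>i. poly (a i) 1) (\<sigma> j)" if "j \<in> {1..d}" for j
    using arg_cong[OF \<Phi>_syz[OF that], of "\<lambda>p. poly p 1"] by (simp add: syzygy_def \<sigma>_def poly_sum)
  moreover have "degree (\<sigma> j i) \<le> \<mu> j" if "j \<in> {1..d}" "i \<le> d" for i j
    unfolding \<sigma>_def by (rule degree_dehomogenize[OF \<Phi>_homog[OF that]])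
  moreover have "p j = 0" if p: "\<forall>i\<le>d. (\<Sum>j=1..d. p j * \<sigma> j i) = 0" and j: "j \<in> {1..d}" for p j
  proof -
    \<comment> \<open>A common total degree: \<open>p j\<close> is homogenised to degree
      \<open>m - \<mu> j\<close>, which is large enough to keep all its coefficients.\<close>
    define m where "m = (\<Sum>j=1..d. degree (p j) + \<mu> j)"
    have m: "degree (p j) + \<mu> j \<le> m" if "j \<in> {1..d}" for j
      unfolding m_def by (rule member_le_sum) (use that in auto)
    define P where "P = (\<lambda>j. if j \<in> {1..d} then homogenize (m - \<mu> j) (p j) else 0)"
    have P: "P \<in> free_module {1..d}" by (auto simp: P_def free_module_def)
    have dP: "poly (P j) 1 = p j" if "j \<in> {1..d}" for j
      using m[OF that] that by (auto simp: P_def poly_homogenize)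
    have inside: "(\<Sum>j=1..d. P j * \<Phi> j i) = 0" if "i \<le> d" for i
    proof (rule homog_eq_0)
      show "(\<Sum>j=1..d. P j * \<Phi> j i) \<in> homog (int m)"
      proof (rule homog_sum)
        fix j assume j: "j \<in> {1..d}"
        have "P j \<in> homog (int (m - \<mu> j))" using j by (simp add: P_def)
        from homog_mult[OF this \<Phi>_homog[OF j that]] m[OF j]
        show "P j * \<Phi> j i \<in> homog (int m)" by (simp add: of_nat_diff)
      qed
      show "poly (\<Sum>j=1..d. P j * \<Phi> j i) 1 = 0"
        using p that by (simp add: poly_sum dP \<sigma>_def)
    qed
    have "\<phi> P \<in> free_module {0..d}"
      using \<phi> P unfolding graded_hom_def by blast
    then have outside: "\<phi> P i = 0" if "\<not> i \<le> d" for i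
      using that by (simp add: free_module_def)
    have "\<phi> P i = 0" for i
    proof (cases "i \<le> d")
      case True
      from inside[OF this] show ?thesis unfolding lin[OF P] .
    qed (rule outside)
    then have "\<phi> P = (\<lambda>_. 0)" by blast
    moreover have "\<phi> (\<lambda>_. 0) = (\<lambda>_. 0)" by (subst lin) (auto simp: free_module_def)
    ultimately have "P = (\<lambda>_. 0)"
      using inj_onD[OF inj _ P, of "\<lambda>_. 0"] by (simp add: free_module_def)
    then show "p j = 0" using dP[OF j] by simp
  qed
  moreover have "\<exists>p. (\<forall>i\<le>d. x i = (\<Sum>j=1..d. p j * \<sigma> j i)) \<and>
      (\<forall>j\<in>{1..d}. p j \<noteq> 0 \<longrightarrow> degree (p j) + \<mu> j \<le> e)"
    if x: "syzygy d (\<lambda>i. poly (a i) 1) x" "\<forall>i\<le>d. degree (x i) \<le> e" for e x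
  proof -
    define X where "X = (\<lambda>i. if i \<le> d then homogenize e (x i) else 0)"
    have dX: "poly (X i) 1 = x i" if "i \<le> d" for i
      using x(2) that by (simp add: X_def poly_homogenize)
    have X: "X i \<in> homog (int e)" for i by (simp add: X_def)
    have "(\<Sum>i=0..d. X i * a i) = 0"
    proof (rule homog_eq_0)
      show "(\<Sum>i=0..d. X i * a i) \<in> homog (int (e + n))"
        using homog_mult[OF X tuples_homog[OF a]] by (auto intro!: homog_sum)
      show "poly (\<Sum>i=0..d. X i * a i) 1 = 0"
        using x(1) by (simp add: syzygy_def poly_sum dX atLeast0AtMost)
    qed
    moreover have "X \<in> free_module {0..d}" by (auto simp: X_def free_module_def)
    ultimately obtain P where P: "P \<in> free_module {1..d}" "X = \<phi> P" using image by blast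
    \<comment> \<open>In degree \<open>e\<close> only the component of \<open>P j\<close> of degree
      \<open>e - \<mu> j\<close> contributes, which is the source of the degree bound on
      \<open>p j\<close>; for \<open>\<mu> j > e\<close> there is no such component.\<close>
    define p where "p = (\<lambda>j. if \<mu> j \<le> e then poly (component (e - \<mu> j) (P j)) 1 else 0)"
    have "x i = (\<Sum>j=1..d. p j * \<sigma> j i)" if i: "i \<le> d" for i
    proof -
      have "X i = component e (X i)" by (simp add: component_of_homog[OF X])
      also have "\<dots> = (\<Sum>j=1..d. component e (P j * \<Phi> j i))"
        unfolding P(2) lin[OF P(1)] component_sum ..
      also have "\<dots> = (\<Sum>j=1..d. if \<mu> j \<le> e then component (e - \<mu> j) (P j) * \<Phi> j i else 0)"
        by (intro sum.cong refl component_mult \<Phi>_homog i)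
      finally have "poly (X i) 1 = (\<Sum>j=1..d. p j * \<sigma> j i)"
        unfolding p_def \<sigma>_def by (simp add: poly_sum if_distrib[of "\<lambda>q. poly q 1"] if_distrib[of "\<lambda>q. q * _"] cong: if_cong)
      with dX[OF i] show ?thesis by simp
    qed
    moreover have "degree (p j) + \<mu> j \<le> e" if "p j \<noteq> 0" for j
      using degree_dehomogenize[OF component_homog[of "e - \<mu> j" "P j"]] that
      by (auto simp: p_def split: if_splits)
    ultimately show ?thesis by blast
  qed
  ultimately show ?thesis unfolding mu_basis_def by blast
qed

text \<open>The homogenised columns define the map. Elements of the free modules need not be
  homogeneous, so injectivity and exactness are checked one graded component at a time, where a form
  is determined by its value at \<open>t = 1\<close>.\<close>

lemma mu_type_of_mu_basis:
  fixes a :: "nat \<Rightarrow> 'k::field poly poly"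
  assumes a: "a \<in> tuples n d" and \<sigma>: "mu_basis d \<mu> (\<lambda>i. poly (a i) 1) \<sigma>" and "partition_parts d \<mu>"
  shows "has_mu_type n d a \<mu>"
proof -
  define H where "H = (\<lambda>j i. homogenize (\<mu> j) (\<sigma> j i))"
  have H: "H j i \<in> homog (int (\<mu> j))" for i j by (simp add: H_def)
  have dH: "poly (H j i) 1 = \<sigma> j i" if "j \<in> {1..d}" "i \<le> d" for i j
    using \<sigma> that unfolding mu_basis_def H_def by (simp add: poly_homogenize)
  have indep: "p j = 0" if "\<And>i. i \<le> d \<Longrightarrow> (\<Sum>j=1..d. p j * \<sigma> j i) = 0" "j \<in> {1..d}" for p j
    using \<sigma> that unfolding mu_basis_def by blast
  define \<phi> where "\<phi> = (\<lambda>p i. if i \<le> d then \<Sum>j=1..d. p j * H j i else 0)"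
  have "\<phi> x \<in> graded_piece {0..d} (\<lambda>_. int n) e"
    if "x \<in> graded_piece {1..d} (\<lambda>i. int n + int (\<mu> i)) e" for x e
  proof -
    have "x j * H j i \<in> homog (e - int n)" if "j \<in> {1..d}" for i j
    proof -
      have "x j \<in> homog (e - (int n + int (\<mu> j)))"
        using \<open>x \<in> _\<close> that by (auto simp: graded_piece_def)
      from homog_mult[OF this H[of j i]] show ?thesis by (simp add: algebra_simps)
    qed
    then show ?thesis by (auto simp: graded_piece_def \<phi>_def free_module_def intro!: homog_sum)
  qed
  then have hom: "graded_hom {1..d} (\<lambda>i. int n + int (\<mu> i)) {0..d} (\<lambda>_. int n) \<phi>"
    unfolding graded_hom_def
    by (auto simp: \<phi>_def free_module_def fun_eq_iff algebra_simps sum.distrib sum_distrib_left)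
  have inj: "inj_on \<phi> (free_module {1..d})"
  proof (rule inj_onI)
    fix x y assume xy: "x \<in> free_module {1..d}" "y \<in> free_module {1..d}" "\<phi> x = \<phi> y"
    define z where "z = (\<lambda>j. x j - y j)"
    have z: "(\<Sum>j=1..d. z j * H j i) = 0" if "i \<le> d" for i
      using fun_cong[OF xy(3), of i] that by (simp add: \<phi>_def z_def algebra_simps sum_subtractf)
    have comp: "component f (z j) = 0" if j: "j \<in> {1..d}" for f j
    proof -
      \<comment> \<open>The part of the relation in degree \<open>f + \<mu> j\<close>; the case
        distinction guards the truncated subtraction, and at \<open>l = j\<close> the coefficient is
        the component \<open>f\<close> of \<open>z j\<close>.\<close>
      let ?p = "\<lambda>l. if \<mu> l \<le> f + \<mu> j then poly (component (f + \<mu> j - \<mu> l) (z l)) 1 else 0"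
      have "(\<Sum>l=1..d. ?p l * \<sigma> l i) = 0" if i: "i \<le> d" for i
      proof -
        have "0 = component (f + \<mu> j) (\<Sum>l=1..d. z l * H l i)"
          unfolding z[OF i] by (simp add: poly_eq_iff coeff_component)
        also have "\<dots> = (\<Sum>l=1..d. if \<mu> l \<le> f + \<mu> j then component (f + \<mu> j - \<mu> l) (z l) * H l i else 0)"
          unfolding component_sum by (intro sum.cong refl component_mult H)
        finally have "0 = poly \<dots> 1" by (metis poly_0)
        also have "\<dots> = (\<Sum>l=1..d. ?p l * \<sigma> l i)"
          unfolding poly_sum by (intro sum.cong refl) (simp add: dH i)
        finally show ?thesis by simp
      qed
      from indep[of ?p, OF this j] have "poly (component f (z j)) 1 = 0" by simp
      then show ?thesis by (rule homog_eq_0[OF component_homog])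
    qed
    have "x j = y j" for j
    proof (cases "j \<in> {1..d}")
      case True
      from component_eq_0[OF comp[OF this]] have "z j = 0" .
      then show ?thesis by (simp add: z_def)
    qed (use xy in \<open>auto simp: free_module_def\<close>)
    then show "x = y" by blast
  qed
  have H_syz: "(\<Sum>i\<le>d. H j i * a i) = 0" if j: "j \<in> {1..d}" for j
  proof (rule homog_eq_0)
    show "(\<Sum>i\<le>d. H j i * a i) \<in> homog (int (\<mu> j + n))"
      using homog_mult[OF H tuples_homog[OF a]] by (auto intro!: homog_sum)
    show "poly (\<Sum>i\<le>d. H j i * a i) 1 = 0"
      using \<sigma> j by (simp add: poly_sum dH mu_basis_def syzygy_def)
  qed
  have "\<phi> ` free_module {1..d} = {x \<in> free_module {0..d}. (\<Sum>i=0..d. x i * a i) = 0}"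
  proof (intro equalityI subsetI)
    fix y assume "y \<in> \<phi> ` free_module {1..d}"
    then obtain p where p: "y = \<phi> p" by blast
    have "(\<Sum>i\<le>d. \<phi> p i * a i) = (\<Sum>i\<le>d. \<Sum>j=1..d. p j * (H j i * a i))"
      by (intro sum.cong refl) (simp add: \<phi>_def sum_distrib_right mult.assoc)
    also have "\<dots> = (\<Sum>j=1..d. p j * (\<Sum>i\<le>d. H j i * a i))"
      by (subst sum.swap) (simp add: sum_distrib_left)
    also have "\<dots> = 0" by (simp add: H_syz)
    finally show "y \<in> {x \<in> free_module {0..d}. (\<Sum>i=0..d. x i * a i) = 0}"
      by (auto simp: p free_module_def \<phi>_def atLeast0AtMost)
  next
    fix x assume x: "x \<in> {x \<in> free_module {0..d}. (\<Sum>i=0..d. x i * a i) = 0}"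
    have "\<exists>p. (\<forall>i\<le>d. poly (component e (x i)) 1 = (\<Sum>j=1..d. p j * \<sigma> j i)) \<and>
        (\<forall>j\<in>{1..d}. p j \<noteq> 0 \<longrightarrow> degree (p j) + \<mu> j \<le> e)" for e
    proof -
      have "0 = component (e + n) (\<Sum>i\<le>d. x i * a i)"
        using x by (simp add: atLeast0AtMost poly_eq_iff coeff_component)
      also have "\<dots> = (\<Sum>i\<le>d. component e (x i) * a i)"
        unfolding component_sum
        by (intro sum.cong refl) (simp add: component_mult[OF tuples_homog[OF a]])
      finally have "0 = poly (\<Sum>i\<le>d. component e (x i) * a i) 1" by (metis poly_0)
      then have "syzygy d (\<lambda>i. poly (a i) 1) (\<lambda>i. poly (component e (x i)) 1)"
        by (simp add: syzygy_def poly_sum)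
      moreover have "\<forall>i\<le>d. degree (poly (component e (x i)) 1) \<le> e"
        by (simp add: degree_dehomogenize)
      ultimately show ?thesis using \<sigma> unfolding mu_basis_def by blast
    qed
    then obtain p where p: "\<And>e i. i \<le> d \<Longrightarrow> poly (component e (x i)) 1 = (\<Sum>j=1..d. p e j * \<sigma> j i)"
      "\<And>e j. j \<in> {1..d} \<Longrightarrow> p e j \<noteq> 0 \<Longrightarrow> degree (p e j) + \<mu> j \<le> e" by metis
    have "\<exists>B. \<forall>b\<ge>B. x i = (\<Sum>e\<le>b. component e (x i))" for i
      using component_decomposition[of "x i"] by metis
    then obtain B where B: "\<And>i b. B i \<le> b \<Longrightarrow> x i = (\<Sum>e\<le>b. component e (x i))" by metis
    define b where "b = (\<Sum>i\<le>d. B i)"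
    have b: "x i = (\<Sum>e\<le>b. component e (x i))" if "i \<le> d" for i
      using that by (intro B) (auto simp: b_def intro!: member_le_sum)
    \<comment> \<open>The case \<open>p e j = 0\<close> is split off because
      \<open>\<mu> j \<le> e\<close> is known only for nonzero coefficients.\<close>
    let ?h = "\<lambda>e j. if p e j = 0 then 0 else homogenize (e - \<mu> j) (p e j)"
    define P where "P = (\<lambda>j. if j \<in> {1..d} then \<Sum>e\<le>b. ?h e j else 0)"
    have "\<phi> P i = x i" for i
    proof (cases "i \<le> d")
      case True
      have "(\<Sum>j=1..d. ?h e j * H j i) = component e (x i)" for e
      proof (rule homog_eqI)
        show "(\<Sum>j=1..d. ?h e j * H j i) \<in> homog (int e)"
        proof (rule homog_sum)
          fix j assume j: "j \<in> {1..d}"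
          from p(2)[OF j, of e] homog_mult[OF homogenize_homog H, of "e - \<mu> j" "p e j" j i]
          show "?h e j * H j i \<in> homog (int e)" by (auto simp: of_nat_diff)
        qed
        have "poly (?h e j * H j i) 1 = p e j * \<sigma> j i" if "j \<in> {1..d}" for j
          using p(2)[OF that, of e] that True by (auto simp: poly_homogenize dH)
        then show "poly (\<Sum>j=1..d. ?h e j * H j i) 1 = poly (component e (x i)) 1"
          by (simp add: poly_sum p(1)[OF True])
      qed simp
      then have "(\<Sum>e\<le>b. \<Sum>j=1..d. ?h e j * H j i) = x i"
        by (simp add: b[OF True, symmetric])
      moreover have "\<phi> P i = (\<Sum>j=1..d. \<Sum>e\<le>b. ?h e j * H j i)"
        using True unfolding \<phi>_def P_def sum_distrib_right[symmetric] by (auto intro!: sum.cong)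
      ultimately show ?thesis by (simp only: sum.swap[of _ "{1..d}"])
    qed (use x in \<open>auto simp: \<phi>_def free_module_def\<close>)
    then have "x = \<phi> P" by (intro ext) simp
    moreover have "P \<in> free_module {1..d}" by (auto simp: P_def free_module_def)
    ultimately show "x \<in> \<phi> ` free_module {1..d}" by blast
  qed
  with hom inj show ?thesis
    unfolding has_mu_type_def using \<open>partition_parts d \<mu>\<close> linear_combinations_eq_span[where a = a and d = d]
    by (auto simp: free_module_def)
qed

section \<open>Popov bases and maximal minors\<close>

lemma coeff_mult_top:
  fixes p q :: "'k::comm_ring_1 poly"
  assumes "degree p \<le> a" "degree q \<le> b"
  shows "coeff (p * q) (a + b) = coeff p a * coeff q b"
proof -
  have "coeff (p * q) (a + b) = (\<Sum>i\<le>a + b. if i = a then coeff p a * coeff q b else 0)"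
    unfolding coeff_mult
  proof (rule sum.cong[OF refl])
    fix i assume "i \<in> {..a + b}"
    then show "coeff p i * coeff q (a + b - i) = (if i = a then coeff p a * coeff q b else 0)"
      using assms by (cases i a rule: linorder_cases) (auto simp: coeff_eq_0)
  qed
  then show ?thesis by simp
qed

lemma coeff_prod_top:
  fixes f :: "'i \<Rightarrow> 'k::comm_ring_1 poly"
  assumes "finite A" "\<And>i. i \<in> A \<Longrightarrow> degree (f i) \<le> m i"
  shows "degree (\<Prod>i\<in>A. f i) \<le> (\<Sum>i\<in>A. m i)"
    and "coeff (\<Prod>i\<in>A. f i) (\<Sum>i\<in>A. m i) = (\<Prod>i\<in>A. coeff (f i) (m i))"
proof -
  have "degree (\<Prod>i\<in>A. f i) \<le> (\<Sum>i\<in>A. m i) \<and>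
      coeff (\<Prod>i\<in>A. f i) (\<Sum>i\<in>A. m i) = (\<Prod>i\<in>A. coeff (f i) (m i))"
    using assms
  proof (induction A)
    case (insert x A)
    then have IH: "degree (\<Prod>i\<in>A. f i) \<le> (\<Sum>i\<in>A. m i)"
      "coeff (\<Prod>i\<in>A. f i) (\<Sum>i\<in>A. m i) = (\<Prod>i\<in>A. coeff (f i) (m i))" "degree (f x) \<le> m x"
      by auto
    have "degree (f x * (\<Prod>i\<in>A. f i)) \<le> m x + (\<Sum>i\<in>A. m i)"
      by (rule order_trans[OF degree_mult_le add_mono[OF IH(3,1)]])
    with coeff_mult_top[OF IH(3,1)] IH(2) insert.hyps show ?case by simp
  qed simp
  then show "degree (\<Prod>i\<in>A. f i) \<le> (\<Sum>i\<in>A. m i)"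
    and "coeff (\<Prod>i\<in>A. f i) (\<Sum>i\<in>A. m i) = (\<Prod>i\<in>A. coeff (f i) (m i))" by auto
qed

lemma coeff_mult_eq_0:
  fixes p q :: "'k::comm_ring_1 poly"
  assumes "\<And>k. m \<le> k \<Longrightarrow> coeff p k = 0" "q \<noteq> 0 \<Longrightarrow> degree q + m \<le> w"
  shows "coeff (p * q) w = 0"
proof (cases "q = 0")
  case False
  show ?thesis
    unfolding coeff_mult
  proof (rule sum.neutral, rule ballI)
    fix i assume "i \<in> {..w}"
    with assms(1)[of i] assms(2)[OF False] show "coeff p i * coeff q (w - i) = 0"
      by (cases "m \<le> i") (auto simp: coeff_eq_0)
  qed
qed simp

text \<open>The strict bound \<open>deg (x i) < \<mu> i\<close> in terms of coefficients, which
  covers the zero polynomial as well; entry \<open>0\<close> is unrestricted.\<close>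

definition below :: "nat \<Rightarrow> (nat \<Rightarrow> nat) \<Rightarrow> (nat \<Rightarrow> 'k::comm_ring_1 poly) \<Rightarrow> bool" where
  "below d \<mu> x \<longleftrightarrow> (\<forall>i\<in>{1..d}. \<forall>k\<ge>\<mu> i. coeff (x i) k = 0)"

text \<open>A generic Popov normal form: among the rows \<open>1, \<dots>, d\<close> the pivot of column \<open>j\<close> is in row \<open>j\<close>,
  and row \<open>0\<close> is only restricted by the degree of the column.\<close>

definition popov :: "nat \<Rightarrow> (nat \<Rightarrow> nat) \<Rightarrow> (nat \<Rightarrow> nat \<Rightarrow> 'k::comm_ring_1 poly) \<Rightarrow> bool" where
  "popov d \<mu> \<sigma> \<longleftrightarrow> (\<forall>j\<in>{1..d}. (\<forall>i\<le>d. degree (\<sigma> j i) \<le> \<mu> j) \<and>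
     (\<forall>i\<in>{1..d}. \<forall>k\<ge>\<mu> i. coeff (\<sigma> j i) k = (if i = j \<and> k = \<mu> j then 1 else 0)))"

definition act :: "nat \<Rightarrow> (nat \<Rightarrow> nat \<Rightarrow> 'k) \<Rightarrow> (nat \<Rightarrow> 'k::comm_ring_1 poly) \<Rightarrow> nat \<Rightarrow> 'k poly" where
  "act d T x = (\<lambda>i. \<Sum>l\<le>d. Polynomial.smult (T i l) (x l))"

lemma smult_sum_right: "Polynomial.smult a (\<Sum>i\<in>A. f i) = (\<Sum>i\<in>A. Polynomial.smult a (f i))"
  by (induction A rule: infinite_finite_induct) (auto simp: smult_add_right)

lemma smult_sum_left: "Polynomial.smult (\<Sum>i\<in>A. f i) p = (\<Sum>i\<in>A. Polynomial.smult (f i) p)"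
  by (induction A rule: infinite_finite_induct) (auto simp: smult_add_left)

text \<open>If the tuple is changed by the transpose of \<open>T\<close>, its syzygies are changed
  by \<open>T\<close>: pairing \<open>x\<close> with the transposed action on \<open>b\<close> is
  pairing \<open>T x\<close> with \<open>b\<close>.\<close>

lemma syzygy_act:
  "syzygy d (act d (\<lambda>i l. T l i) b) x \<longleftrightarrow> syzygy d b (act d T x)"
proof -
  have "(\<Sum>i\<le>d. x i * act d (\<lambda>i l. T l i) b i) = (\<Sum>i\<le>d. \<Sum>l\<le>d. Polynomial.smult (T l i) (x i * b l))"
    by (simp add: act_def sum_distrib_left)
  also have "\<dots> = (\<Sum>i\<le>d. act d T x i * b i)"
    by (subst sum.swap) (simp add: act_def sum_distrib_right)
  finally show ?thesis by (simp add: syzygy_def)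
qed

lemma act_act: "act d T (act d T' x) i = act d (\<lambda>i j. \<Sum>l\<le>d. T i l * T' l j) x i"
proof -
  have "act d T (act d T' x) i = (\<Sum>l\<le>d. \<Sum>j\<le>d. Polynomial.smult (T i l * T' l j) (x j))"
    by (simp add: act_def smult_sum_right)
  also have "\<dots> = (\<Sum>j\<le>d. Polynomial.smult (\<Sum>l\<le>d. T i l * T' l j) (x j))"
    by (subst sum.swap) (simp add: smult_sum_left)
  finally show ?thesis by (simp add: act_def)
qed

lemma act_inverse:
  assumes "\<And>i j. i \<le> d \<Longrightarrow> j \<le> d \<Longrightarrow> (\<Sum>l\<le>d. T i l * T' l j) = (if i = j then 1 else 0)" "i \<le> d"
  shows "act d T (act d T' x) i = x i"
proof -
  have "act d T (act d T' x) i = (\<Sum>j\<le>d. if j = i then x i else 0)"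
    unfolding act_act unfolding act_def by (intro sum.cong refl) (simp add: assms)
  then show ?thesis using assms(2) by simp
qed

lemma act_sum: "act d T (\<lambda>l. \<Sum>j\<in>A. p j * \<sigma> j l) i = (\<Sum>j\<in>A. p j * act d T (\<sigma> j) i)"
proof -
  have "act d T (\<lambda>l. \<Sum>j\<in>A. p j * \<sigma> j l) i = (\<Sum>l\<le>d. \<Sum>j\<in>A. p j * Polynomial.smult (T i l) (\<sigma> j l))"
    by (simp add: act_def smult_sum_right)
  also have "\<dots> = (\<Sum>j\<in>A. p j * act d T (\<sigma> j) i)"
    by (subst sum.swap) (simp add: act_def sum_distrib_left)
  finally show ?thesis .
qed

lemma act_cong: "(\<And>l. l \<le> d \<Longrightarrow> x l = y l) \<Longrightarrow> act d T x i = act d T y i"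
  by (simp add: act_def)

lemma degree_act: "(\<And>l. l \<le> d \<Longrightarrow> degree (x l) \<le> e) \<Longrightarrow> degree (act d T x i) \<le> e"
  unfolding act_def by (intro degree_sum_le) (auto intro: order_trans[OF degree_smult_le])

lemma syzygy_cong:
  "(\<And>i. i \<le> d \<Longrightarrow> x i = y i) \<Longrightarrow> (\<And>i. i \<le> d \<Longrightarrow> b i = c i) \<Longrightarrow> syzygy d b x \<longleftrightarrow> syzygy d c y"
  by (simp add: syzygy_def)

lemma mu_basis_cong:
  "(\<And>i. i \<le> d \<Longrightarrow> b i = c i) \<Longrightarrow> mu_basis d \<mu> b \<sigma> \<longleftrightarrow> mu_basis d \<mu> c \<sigma>"
  unfolding mu_basis_def syzygy_def by simp

text \<open>The tuple moves by the transpose of \<open>T\<close> and the syzygies by the inverse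
  \<open>T'\<close>; constant matrices do not raise degrees, so both degree bounds survive.\<close>

lemma mu_basis_act:
  assumes \<sigma>: "mu_basis d \<mu> b \<sigma>"
    and T: "\<And>i j. i \<le> d \<Longrightarrow> j \<le> d \<Longrightarrow> (\<Sum>l\<le>d. T i l * T' l j) = (if i = j then 1 else 0)"
      "\<And>i j. i \<le> d \<Longrightarrow> j \<le> d \<Longrightarrow> (\<Sum>l\<le>d. T' i l * T l j) = (if i = j then 1 else 0)"
  shows "mu_basis d \<mu> (act d (\<lambda>i l. T l i) b) (\<lambda>j. act d T' (\<sigma> j))"
  unfolding mu_basis_def
proof (intro conjI ballI allI impI)
  fix j assume j: "j \<in> {1..d}"
  have "syzygy d b (act d T (act d T' (\<sigma> j)))"
    using \<sigma> j by (subst syzygy_cong[OF act_inverse[OF T(1)] refl]) (auto simp: mu_basis_def)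
  then show "syzygy d (act d (\<lambda>i l. T l i) b) (act d T' (\<sigma> j))"
    by (simp add: syzygy_act)
  fix i
  show "degree (act d T' (\<sigma> j) i) \<le> \<mu> j"
    using \<sigma> j by (intro degree_act) (auto simp: mu_basis_def)
next
  fix p j assume p: "\<forall>i\<le>d. (\<Sum>j=1..d. p j * act d T' (\<sigma> j) i) = 0" and j: "j \<in> {1..d}"
  have "(\<Sum>j=1..d. p j * \<sigma> j i) = 0" if "i \<le> d" for i
  proof -
    let ?z = "\<lambda>l. \<Sum>j=1..d. p j * \<sigma> j l"
    have "?z i = act d T (act d T' ?z) i" by (rule act_inverse[OF T(1) that, symmetric])
    also have "\<dots> = act d T (\<lambda>_. 0) i"
      by (rule act_cong) (simp only: act_sum p)
    finally show ?thesis by (simp add: act_def)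
  qed
  with \<sigma> j show "p j = 0" unfolding mu_basis_def by blast
next
  fix e x assume x: "syzygy d (act d (\<lambda>i l. T l i) b) x" "\<forall>i\<le>d. degree (x i) \<le> e"
  then have "syzygy d b (act d T x)" "\<forall>i\<le>d. degree (act d T x i) \<le> e"
    by (simp_all add: syzygy_act degree_act)
  with \<sigma> obtain p where p: "\<forall>i\<le>d. act d T x i = (\<Sum>j=1..d. p j * \<sigma> j i)"
    "\<forall>j\<in>{1..d}. p j \<noteq> 0 \<longrightarrow> degree (p j) + \<mu> j \<le> e"
    unfolding mu_basis_def by blast
  have "x i = (\<Sum>j=1..d. p j * act d T' (\<sigma> j) i)" if "i \<le> d" for i
  proof -
    have "x i = act d T' (act d T x) i" by (rule act_inverse[OF T(2) that, symmetric])
    also have "\<dots> = act d T' (\<lambda>l. \<Sum>j=1..d. p j * \<sigma> j l) i"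
      by (rule act_cong) (use p(1) in blast)
    finally show ?thesis unfolding act_sum .
  qed
  with p(2) show "\<exists>p. (\<forall>i\<le>d. x i = (\<Sum>j=1..d. p j * act d T' (\<sigma> j) i)) \<and>
      (\<forall>j\<in>{1..d}. p j \<noteq> 0 \<longrightarrow> degree (p j) + \<mu> j \<le> e)" by blast
qed

lemma syzygy_sum:
  assumes "\<And>j. j \<in> A \<Longrightarrow> syzygy d b (\<sigma> j)"
  shows "syzygy d b (\<lambda>i. \<Sum>j\<in>A. p j * \<sigma> j i)"
proof -
  have "(\<Sum>i\<le>d. (\<Sum>j\<in>A. p j * \<sigma> j i) * b i) = (\<Sum>j\<in>A. p j * (\<Sum>i\<le>d. \<sigma> j i * b i))"
    unfolding sum_distrib_left sum_distrib_right by (subst sum.swap) (simp add: mult.assoc)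
  with assms show ?thesis by (simp add: syzygy_def)
qed

text \<open>A relation \<open>c\<close> among leading vectors makes \<open>x\<close>, the sum of the
  \<open>c j * s ^ (m - \<mu> j) * \<sigma> j\<close>, drop below degree \<open>m\<close>, the
  largest \<open>\<mu> j\<close> with \<open>c j \<noteq> 0\<close>. The degree clause of
  \<open>mu_basis\<close> then rewrites \<open>x\<close> with coefficients satisfying
  \<open>degree (p j) + \<mu> j < m\<close>. By uniqueness these equal the original ones, impossible
  at an index with \<open>\<mu> l = m\<close>.\<close>

lemma mu_basis_leading_independent:
  fixes c :: "nat \<Rightarrow> 'k::field"
  assumes \<sigma>: "mu_basis d \<mu> b \<sigma>"
    and c: "\<And>i. i \<le> d \<Longrightarrow> (\<Sum>j=1..d. c j * coeff (\<sigma> j i) (\<mu> j)) = 0" and "j \<in> {1..d}"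
  shows "c j = 0"
proof (rule ccontr)
  assume "c j \<noteq> 0"
  let ?J = "{j \<in> {1..d}. c j \<noteq> 0}"
  define m where "m = Max (\<mu> ` ?J)"
  have m: "\<mu> l \<le> m" if "l \<in> ?J" for l
    unfolding m_def using that by (intro Max_ge) auto
  have "m \<in> \<mu> ` ?J"
    unfolding m_def using \<open>j \<in> _\<close> \<open>c j \<noteq> 0\<close> by (intro Max_in) auto
  then obtain l where l: "l \<in> {1..d}" "c l \<noteq> 0" "\<mu> l = m" by blast
  define q where "q = (\<lambda>j. if c j = 0 then 0 else monom (c j) (m - \<mu> j))"
  define x where "x = (\<lambda>i. \<Sum>j=1..d. q j * \<sigma> j i)"
  have \<sigma>deg: "degree (\<sigma> j i) \<le> \<mu> j" if "j \<in> {1..d}" "i \<le> d" for i j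
    using \<sigma> that by (simp add: mu_basis_def)
  have coeff_q: "coeff (q j * \<sigma> j i) k = (if k = m then c j * coeff (\<sigma> j i) (\<mu> j) else 0)"
    if "j \<in> {1..d}" "i \<le> d" "m \<le> k" for i j k
    using m[of j] \<sigma>deg[OF that(1,2)] that by (auto simp: q_def coeff_monom_mult coeff_eq_0)
  have x0: "coeff (x i) k = 0" if "i \<le> d" "m \<le> k" for i k
    using c[OF that(1)] that by (cases "k = m") (simp_all add: x_def coeff_sum coeff_q)
  have syz: "syzygy d b x"
    unfolding x_def by (rule syzygy_sum) (use \<sigma> in \<open>simp add: mu_basis_def\<close>)
  have "\<exists>p. (\<forall>i\<le>d. x i = (\<Sum>j=1..d. p j * \<sigma> j i)) \<and> (\<forall>j\<in>{1..d}. p j \<noteq> 0 \<longrightarrow> degree (p j) + \<mu> j < m)"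
  \<comment> \<open>For \<open>m = 0\<close> there is no degree bound \<open>m - 1\<close> to use;
    all coefficients of \<open>x\<close> vanish directly.\<close>
  proof (cases m)
    case 0
    have "x i = 0" if "i \<le> d" for i
      by (rule poly_eqI) (simp add: x0 that 0)
    then show ?thesis by (intro exI[of _ "\<lambda>_. 0"]) simp
  next
    case (Suc m')
    have "\<forall>i\<le>d. degree (x i) \<le> m'"
      by (auto intro!: degree_le x0 simp: Suc)
    with \<sigma> syz have "\<exists>p. (\<forall>i\<le>d. x i = (\<Sum>j=1..d. p j * \<sigma> j i)) \<and>
        (\<forall>j\<in>{1..d}. p j \<noteq> 0 \<longrightarrow> degree (p j) + \<mu> j \<le> m')"
      unfolding mu_basis_def by blast
    then show ?thesis unfolding Suc less_Suc_eq_le .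
  qed
  then obtain p where p: "\<forall>i\<le>d. x i = (\<Sum>j=1..d. p j * \<sigma> j i)"
    "\<forall>j\<in>{1..d}. p j \<noteq> 0 \<longrightarrow> degree (p j) + \<mu> j < m" by blast
  have "\<forall>i\<le>d. (\<Sum>j=1..d. (p j - q j) * \<sigma> j i) = 0"
    using p(1) by (simp add: x_def algebra_simps sum_subtractf)
  then have "p l - q l = 0"
    using \<sigma> l(1) unfolding mu_basis_def by (elim conjE allE[of _ "\<lambda>j. p j - q j"]) blast
  moreover have "q l \<noteq> 0" using l(2) by (simp add: q_def)
  ultimately show False using bspec[OF p(2) l(1)] l(3) by auto
qed

section \<open>Division with remainder by a Popov basis\<close>

lemma popov_degree: "popov d \<mu> \<sigma> \<Longrightarrow> j \<in> {1..d} \<Longrightarrow> i \<le> d \<Longrightarrow> degree (\<sigma> j i) \<le> \<mu> j"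
  and popov_coeff: "popov d \<mu> \<sigma> \<Longrightarrow> j \<in> {1..d} \<Longrightarrow> i \<in> {1..d} \<Longrightarrow> \<mu> i \<le> k \<Longrightarrow>
    coeff (\<sigma> j i) k = (if i = j \<and> k = \<mu> j then 1 else 0)"
  unfolding popov_def by blast+

text \<open>Division proceeds by the excess \<open>w\<close> over the pivot degrees. Subtracting the
  \<open>c j * s ^ w * \<sigma> j\<close> clears position \<open>\<mu> i + w\<close> in every row
  \<open>i \<ge> 1\<close> simultaneously, because off the pivot row \<open>i\<close> has degree
  less than \<open>\<mu> i\<close>. A nonzero \<open>c j\<close> forces
  \<open>\<mu> j + w \<le> e\<close>, which also keeps row \<open>0\<close> within degree
  \<open>e\<close>.\<close>

lemma popov_division:
  fixes x :: "nat \<Rightarrow> 'k::field poly"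
  assumes \<sigma>: "popov d \<mu> \<sigma>" and x: "\<And>i. i \<le> d \<Longrightarrow> degree (x i) \<le> e"
  obtains p y where "\<And>i. i \<le> d \<Longrightarrow> x i = (\<Sum>j=1..d. p j * \<sigma> j i) + y i" "below d \<mu> y"
    "\<And>j. j \<in> {1..d} \<Longrightarrow> p j \<noteq> 0 \<Longrightarrow> degree (p j) + \<mu> j \<le> e"
proof -
  have "\<exists>p y. (\<forall>i\<le>d. x i = (\<Sum>j=1..d. p j * \<sigma> j i) + y i) \<and> below d \<mu> y \<and>
      (\<forall>j\<in>{1..d}. p j \<noteq> 0 \<longrightarrow> degree (p j) + \<mu> j \<le> e)"
    if "\<And>i. i \<le> d \<Longrightarrow> degree (x i) \<le> e" "\<And>i k. i \<in> {1..d} \<Longrightarrow> \<mu> i + w \<le> k \<Longrightarrow> coeff (x i) k = 0"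
    for w x
    using that
  proof (induction w arbitrary: x)
    case 0
    then show ?case by (intro exI[of _ "\<lambda>_. 0"] exI[of _ x]) (auto simp: below_def)
  next
    case (Suc w)
    define c where "c = (\<lambda>j. coeff (x j) (\<mu> j + w))"
    define x' where "x' = (\<lambda>i. x i - (\<Sum>j=1..d. monom (c j) w * \<sigma> j i))"
    have c: "\<mu> j + w \<le> e" if "j \<in> {1..d}" "c j \<noteq> 0" for j
      using Suc.prems(1)[of j] that by (auto simp: c_def intro: order_trans[OF le_degree])
    have "degree (monom (c j) w * \<sigma> j i) \<le> e" if "j \<in> {1..d}" "i \<le> d" for i j
    proof (cases "c j = 0")
      case False
      have "degree (monom (c j) w * \<sigma> j i) \<le> w + \<mu> j"
        by (rule order_trans[OF degree_mult_le add_mono[OF degree_monom_le popov_degree[OF \<sigma> that]]])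
      with c[OF that(1) False] show ?thesis by simp
    qed simp
    then have "degree (x' i) \<le> e" if "i \<le> d" for i
      unfolding x'_def using that by (intro degree_diff_le degree_sum_le Suc.prems) auto
    moreover have "coeff (x' i) k = 0" if i: "i \<in> {1..d}" and k: "\<mu> i + w \<le> k" for i k
    proof -
      have "coeff (monom (c j) w * \<sigma> j i) k = (if j = i then if k = \<mu> i + w then c i else 0 else 0)"
        if j: "j \<in> {1..d}" for j
        using k by (auto simp: coeff_monom_mult popov_coeff[OF \<sigma> j i])
      then have "coeff (x' i) k = coeff (x i) k - (\<Sum>j=1..d. if j = i then if k = \<mu> i + w then c i else 0 else 0)"
        by (simp add: x'_def coeff_sum)
      also have "\<dots> = coeff (x i) k - (if k = \<mu> i + w then c i else 0)" using i by simp
      also have "\<dots> = 0"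
        using Suc.prems(2)[OF i, of k] k by (auto simp: c_def)
      finally show ?thesis .
    qed
    ultimately obtain p y where p: "\<And>i. i \<le> d \<Longrightarrow> x' i = (\<Sum>j=1..d. p j * \<sigma> j i) + y i"
      "below d \<mu> y" "\<And>j. j \<in> {1..d} \<Longrightarrow> p j \<noteq> 0 \<Longrightarrow> degree (p j) + \<mu> j \<le> e"
      using Suc.IH[of x'] by blast
    let ?p = "\<lambda>j. p j + monom (c j) w"
    have "x i = (\<Sum>j=1..d. ?p j * \<sigma> j i) + y i" if "i \<le> d" for i
      using p(1)[OF that] by (simp add: x'_def algebra_simps sum.distrib)
    moreover have "degree (?p j) + \<mu> j \<le> e" if j: "j \<in> {1..d}" "?p j \<noteq> 0" for j
    proof -
      consider "p j = 0" "c j \<noteq> 0" | "c j = 0" "p j \<noteq> 0" | "p j \<noteq> 0" "c j \<noteq> 0" using j(2) by force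
      then show ?thesis
      proof cases
        case 3
        have "degree (?p j) \<le> max (degree (p j)) w"
          by (rule order_trans[OF degree_add_le_max]) (simp add: 3 degree_monom_eq)
        with p(3)[OF j(1) 3(1)] c[OF j(1) 3(2)] show ?thesis by linarith
      qed (use p(3)[OF j(1)] c[OF j(1)] in \<open>simp_all add: degree_monom_eq add.commute\<close>)
    qed
    ultimately show ?case using p(2) by (intro exI[of _ ?p] exI[of _ y]) simp
  qed
  note division = this
  have hi: "coeff (x i) k = 0" if "i \<in> {1..d}" "\<mu> i + Suc e \<le> k" for i k
    using x[of i] that by (auto simp: coeff_eq_0)
  have "\<exists>p y. (\<forall>i\<le>d. x i = (\<Sum>j=1..d. p j * \<sigma> j i) + y i) \<and> below d \<mu> y \<and>
      (\<forall>j\<in>{1..d}. p j \<noteq> 0 \<longrightarrow> degree (p j) + \<mu> j \<le> e)"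
    by (rule division[of x "Suc e"]) (use x hi in auto)
  with that show thesis by blast
qed

text \<open>Take \<open>i\<close> with \<open>p i\<close> of maximal degree \<open>w\<close>. In row
  \<open>i\<close> only the diagonal entry reaches degree \<open>\<mu> i\<close>, so the coefficient
  at \<open>w + \<mu> i\<close> is the leading coefficient of \<open>p i\<close>, in a position that
  \<open>below\<close> forces to be zero.\<close>

lemma popov_independent:
  fixes p :: "nat \<Rightarrow> 'k::field poly"
  assumes \<sigma>: "popov d \<mu> \<sigma>" and below: "below d \<mu> (\<lambda>i. \<Sum>j=1..d. p j * \<sigma> j i)" and "j \<in> {1..d}"
  shows "p j = 0"
proof (rule ccontr)
  assume "p j \<noteq> 0"
  let ?J = "{j \<in> {1..d}. p j \<noteq> 0}"
  define w where "w = Max ((\<lambda>j. degree (p j)) ` ?J)"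
  have w: "degree (p l) \<le> w" if "l \<in> {1..d}" for l
  proof (cases "p l = 0")
    case False
    then show ?thesis unfolding w_def using that by (intro Max_ge) auto
  qed simp
  have "w \<in> (\<lambda>j. degree (p j)) ` ?J"
    unfolding w_def using \<open>j \<in> _\<close> \<open>p j \<noteq> 0\<close> by (intro Max_in) auto
  then obtain i where i: "i \<in> {1..d}" "p i \<noteq> 0" "w = degree (p i)" by blast
  have "coeff (p l * \<sigma> l i) (w + \<mu> i) = (if l = i then coeff (p i) w else 0)" if l: "l \<in> {1..d}" for l
  proof -
    have "degree (\<sigma> l i) \<le> \<mu> i"
      by (rule degree_le) (use popov_coeff[OF \<sigma> l i(1)] in auto)
    from coeff_mult_top[OF w[OF l] this] popov_coeff[OF \<sigma> l i(1), of "\<mu> i"] show ?thesis by simp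
  qed
  then have "coeff (\<Sum>l=1..d. p l * \<sigma> l i) (w + \<mu> i) = coeff (p i) w"
    using i(1) by (simp add: coeff_sum)
  moreover have "coeff (\<Sum>l=1..d. p l * \<sigma> l i) (w + \<mu> i) = 0"
    using below i(1) by (simp add: below_def)
  ultimately show False using i(2,3) by simp
qed

text \<open>Dividing a syzygy by the Popov columns leaves a remainder that is again a syzygy and
  lies below \<open>\<mu>\<close>, hence is zero.\<close>

lemma mu_basis_of_popov:
  fixes b :: "nat \<Rightarrow> 'k::field poly"
  assumes \<sigma>: "popov d \<mu> \<sigma>" and syz: "\<And>j. j \<in> {1..d} \<Longrightarrow> syzygy d b (\<sigma> j)"
    and zero: "\<And>x i. syzygy d b x \<Longrightarrow> below d \<mu> x \<Longrightarrow> i \<le> d \<Longrightarrow> x i = 0"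
  shows "mu_basis d \<mu> b \<sigma>"
  unfolding mu_basis_def
proof (intro conjI ballI allI impI)
  fix p j assume p: "\<forall>i\<le>d. (\<Sum>j=1..d. p j * \<sigma> j i) = 0" and j: "j \<in> {1..d}"
  have "below d \<mu> (\<lambda>i. \<Sum>j=1..d. p j * \<sigma> j i)" using p by (simp add: below_def)
  then show "p j = 0" by (rule popov_independent[OF \<sigma> _ j])
next
  fix e x assume x: "syzygy d b x" "\<forall>i\<le>d. degree (x i) \<le> e"
  obtain p y where p: "\<And>i. i \<le> d \<Longrightarrow> x i = (\<Sum>j=1..d. p j * \<sigma> j i) + y i" "below d \<mu> y"
    "\<And>j. j \<in> {1..d} \<Longrightarrow> p j \<noteq> 0 \<Longrightarrow> degree (p j) + \<mu> j \<le> e"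
    using popov_division[OF \<sigma>, of x e] x(2) by blast
  have "syzygy d b (\<lambda>i. \<Sum>j=1..d. p j * \<sigma> j i)" by (rule syzygy_sum[OF syz])
  with x(1) have "syzygy d b y"
    by (simp add: syzygy_def p(1) distrib_right sum.distrib)
  then have "y i = 0" if "i \<le> d" for i using zero p(2) that by blast
  with p show "\<exists>p. (\<forall>i\<le>d. x i = (\<Sum>j=1..d. p j * \<sigma> j i)) \<and>
      (\<forall>j\<in>{1..d}. p j \<noteq> 0 \<longrightarrow> degree (p j) + \<mu> j \<le> e)" by (intro exI[of _ p]) simp
qed (use syz popov_degree[OF \<sigma>] in auto)

lemma sum_atMost_split_first:
  fixes d :: nat
  shows "(\<Sum>i\<le>d. f i) = f 0 + (\<Sum>i=1..d. f i :: 'b::comm_monoid_add)"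
  by (induction d) (simp_all add: add.assoc)

text \<open>With \<open>w = max\<^sub>i (deg b\<^sub>i + \<mu>\<^sub>i)\<close> attained at \<open>j\<close>, the syzygy \<open>\<sigma>\<^sub>j\<close> gives \<open>w \<le> deg b\<^sub>0 + \<mu>\<^sub>j\<close>, and
  any other syzygy \<open>x\<close> as below gives \<open>deg x\<^sub>0 + deg b\<^sub>0 < w\<close>.\<close>

lemma below_syzygy_zero:
  fixes b :: "nat \<Rightarrow> 'k::field poly"
  assumes \<sigma>: "popov d \<mu> \<sigma>" and syz: "\<And>j. j \<in> {1..d} \<Longrightarrow> syzygy d b (\<sigma> j)"
    and E: "\<And>j. j \<in> {1..d} \<Longrightarrow> \<mu> j \<le> E"
    and zero: "\<And>x i. syzygy d b x \<Longrightarrow> below d \<mu> x \<Longrightarrow> (\<And>i. i \<le> d \<Longrightarrow> degree (x i) \<le> E) \<Longrightarrow> i \<le> d \<Longrightarrow> x i = 0"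
    and x: "syzygy d b x" "below d \<mu> x" and "i \<le> d"
  shows "x i = 0"
proof (rule zero[OF x _ \<open>i \<le> d\<close>])
  have b0: "b 0 \<noteq> 0"
  proof
    assume "b 0 = 0"
    let ?u = "\<lambda>i. if i = 0 then 1 else 0 :: 'k poly"
    have u: "syzygy d b ?u" using \<open>b 0 = 0\<close> by (auto simp: syzygy_def intro!: sum.neutral)
    have u': "below d \<mu> ?u" by (simp add: below_def)
    have "degree (?u i) \<le> E" if "i \<le> d" for i by simp
    from zero[OF u u' this, of 0] show False by simp
  qed
  \<comment> \<open>What remains is the degree bound \<open>E\<close>; it turns the absence of
    syzygies below \<open>\<mu>\<close> into injectivity of a finite linear system.\<close>
  fix l assume l: "l \<le> d"
  show "degree (x l) \<le> E"
  proof (cases "l = 0")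
    case False
    with l x(2) have "\<And>k. \<mu> l \<le> k \<Longrightarrow> coeff (x l) k = 0" "\<mu> l \<le> E"
      using E[of l] by (auto simp: below_def)
    then show ?thesis by (intro degree_le) auto
  next
    case True
    let ?J = "{i \<in> {1..d}. b i \<noteq> 0}"
    define w where "w = Max ((\<lambda>i. degree (b i) + \<mu> i) ` ?J)"
    have w: "degree (b i) + \<mu> i \<le> w" if "i \<in> {1..d}" "b i \<noteq> 0" for i
      unfolding w_def by (rule Max_ge) (use that in auto)
    have x0: "x 0 * b 0 = - (\<Sum>i=1..d. x i * b i)"
      using x(1) unfolding syzygy_def sum_atMost_split_first by (simp add: eq_neg_iff_add_eq_0)
    show ?thesis
    proof (cases "x 0 = 0 \<or> ?J = {}")
      case True
      then have "x 0 = 0"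
      proof
        assume "?J = {}"
        then have "x 0 * b 0 = 0" unfolding x0 by (auto intro!: sum.neutral)
        with b0 show ?thesis by simp
      qed
      with \<open>l = 0\<close> show ?thesis by simp
    next
      case False
      have "w \<in> (\<lambda>i. degree (b i) + \<mu> i) ` ?J"
        unfolding w_def using False by (intro Max_in) auto
      then obtain j where j: "j \<in> {1..d}" "b j \<noteq> 0" "w = degree (b j) + \<mu> j" by blast
      have "coeff (x i * b i) k = 0" if "i \<in> {1..d}" "w \<le> k" for i k
        by (rule coeff_mult_eq_0[of "\<mu> i"]) (use x(2) w[OF that(1)] that in \<open>auto simp: below_def\<close>)
      then have "coeff (x 0 * b 0) k = 0" if "w \<le> k" for k
        using that unfolding x0 by (simp add: coeff_sum)
      moreover have "x 0 * b 0 \<noteq> 0" using False b0 by simp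
      ultimately have "degree (x 0 * b 0) < w"
        by (metis leading_coeff_0_iff not_le)
      then have *: "degree (x 0) + degree (b 0) < w" using False b0 by (simp add: degree_mult_eq)
      have "coeff (\<sigma> j i * b i) w = (if i = j then lead_coeff (b j) else 0)" if i: "i \<in> {1..d}" for i
      proof (cases "i = j")
        case True
        from coeff_mult_top[OF popov_degree[OF \<sigma> j(1), of j] order_refl, of "b j"] j
          popov_coeff[OF \<sigma> j(1,1), of "\<mu> j"] True show ?thesis by (simp add: add.commute)
      next
        case False
        have "coeff (\<sigma> j i * b i) w = 0"
          by (rule coeff_mult_eq_0[of "\<mu> i"]) (use popov_coeff[OF \<sigma> j(1) i] w[OF i] False in auto)
        with False show ?thesis by simp
      qed
      then have "coeff (\<Sum>i=1..d. \<sigma> j i * b i) w = lead_coeff (b j)"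
        using j(1) by (simp add: coeff_sum)
      moreover have "coeff (\<sigma> j 0 * b 0) w + coeff (\<Sum>i=1..d. \<sigma> j i * b i) w = 0"
        using syz[OF j(1)] unfolding syzygy_def sum_atMost_split_first by (metis coeff_0 coeff_add)
      ultimately have "coeff (\<sigma> j 0 * b 0) w \<noteq> 0" using j(2) by auto
      then have "w \<le> degree (\<sigma> j 0) + degree (b 0)"
        by (meson degree_mult_le le_degree order_trans)
      with * popov_degree[OF \<sigma> j(1), of 0] E[OF j(1)] \<open>l = 0\<close> show ?thesis by simp
    qed
  qed
qed

section \<open>Existence of Popov bases after a generic linear change\<close>

definition popov_vector ::
    "nat \<Rightarrow> (nat \<Rightarrow> nat) \<Rightarrow> nat \<Rightarrow> (nat \<Rightarrow> 'k::comm_ring_1 poly) \<Rightarrow> bool" where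
  "popov_vector d \<mu> j x \<longleftrightarrow> (\<forall>i\<le>d. degree (x i) \<le> \<mu> j) \<and>
     (\<forall>i\<in>{1..d}. \<forall>k\<ge>\<mu> i. i = j \<and> k = \<mu> j \<or> coeff (x i) k = 0)"

text \<open>A combination of the \<open>\<sigma>\<^sub>l\<close> of degree \<open>\<mu>\<^sub>j\<close> has as many free coefficients as there are positions
  \<open>(i, k)\<close> with \<open>\<mu>\<^sub>i \<le> k \<le> \<mu>\<^sub>j\<close>, and all but one of these positions are required to vanish.\<close>

lemma exists_popov_vector:
  fixes b :: "nat \<Rightarrow> 'k::field poly"
  assumes \<sigma>: "mu_basis d \<mu> b \<sigma>" and j: "j \<in> {1..d}"
  shows "\<exists>x. (\<exists>i\<le>d. x i \<noteq> 0) \<and> syzygy d b x \<and> popov_vector d \<mu> j x"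
proof -
  let ?e = "\<mu> j"
  let ?K = "\<lambda>l. {k. k + \<mu> l \<le> ?e}"
  let ?I = "SIGMA l:{1..d}. ?K l"
  let ?E' = "SIGMA i:{1..d}. {k. \<mu> i \<le> k \<and> k \<le> ?e}"
  let ?E = "?E' - {(j, ?e)}"
  have finK: "finite (?K l)" for l by (rule finite_subset[of _ "{..?e}"]) auto
  then have finI: "finite ?I" by auto
  have finE: "finite ?E'" by (auto intro!: finite_subset[of "{k. _ \<le> k \<and> k \<le> ?e}" "{..?e}"])
  have "bij_betw (\<lambda>(l, k). (l, k + \<mu> l)) ?I ?E'"
    by (rule bij_betw_byWitness[of _ "\<lambda>(l, k). (l, k - \<mu> l)"]) auto
  then have "card ?I = card ?E'" by (rule bij_betw_same_card)
  moreover have "(j, ?e) \<in> ?E'" using j by simp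
  ultimately have "card ?E < card ?I" using card_Diff1_less[OF finE, of "(j, ?e)"] by (simp only:)
  \<comment> \<open>The contribution of \<open>s ^ k\<close> times column \<open>l\<close> to the
    coefficient \<open>m\<close> of row \<open>i\<close>.\<close>
  let ?A = "\<lambda>i m (l, k). if k \<le> m then coeff (\<sigma> l i) (m - k) else 0"
  have "\<exists>v. (\<exists>q\<in>?I. v q \<noteq> 0) \<and> (\<forall>e\<in>?E. (\<Sum>q\<in>?I. ?A (fst e) (snd e) q * v q) = 0)"
    by (rule underdetermined_system[OF finI _ \<open>card ?E < card ?I\<close>]) (use finE in blast)
  then obtain v where v: "\<exists>q\<in>?I. v q \<noteq> 0" "\<forall>e\<in>?E. (\<Sum>q\<in>?I. ?A (fst e) (snd e) q * v q) = 0"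
    by blast
  define p where "p = (\<lambda>l. \<Sum>k\<in>?K l. monom (v (l, k)) k)"
  define x where "x = (\<lambda>i. \<Sum>l=1..d. p l * \<sigma> l i)"
  have coeff_p: "coeff (p l) k = (if k \<in> ?K l then v (l, k) else 0)" for l k
    unfolding p_def coeff_sum using finK[of l] by (simp add: sum.delta' if_distrib cong: if_cong)
  have syz: "syzygy d b x"
    unfolding x_def by (rule syzygy_sum) (use \<sigma> in \<open>simp add: mu_basis_def\<close>)
  have degree: "degree (x i) \<le> ?e" if "i \<le> d" for i
    unfolding x_def
  proof (rule degree_sum_le)
    fix l assume l: "l \<in> {1..d}"
    show "degree (p l * \<sigma> l i) \<le> ?e"
    proof (cases "p l = 0")
      case False
      then have "degree (p l) + \<mu> l \<le> ?e"
        using coeff_p[of l "degree (p l)"] by (auto split: if_splits)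
      moreover have "degree (\<sigma> l i) \<le> \<mu> l" using \<sigma> l that by (simp add: mu_basis_def)
      ultimately show ?thesis using degree_mult_le[of "p l" "\<sigma> l i"] by linarith
    qed simp
  qed simp
  have "coeff (x i) m = 0" if i: "i \<in> {1..d}" and m: "\<mu> i \<le> m" and neq: "\<not> (i = j \<and> m = ?e)" for i m
  proof (cases "m \<le> ?e")
    case True
    have "coeff (p l * \<sigma> l i) m = (\<Sum>k\<in>?K l. (if k \<le> m then coeff (\<sigma> l i) (m - k) else 0) * v (l, k))" for l
      unfolding p_def sum_distrib_right coeff_sum coeff_monom_mult
      by (intro sum.cong refl) (simp add: mult.commute)
    then have "coeff (x i) m =
        (\<Sum>l=1..d. \<Sum>k\<in>?K l. (if k \<le> m then coeff (\<sigma> l i) (m - k) else 0) * v (l, k))"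
      by (simp add: x_def coeff_sum)
    also have "\<dots> = (\<Sum>(l, k)\<in>?I. (if k \<le> m then coeff (\<sigma> l i) (m - k) else 0) * v (l, k))"
      by (rule sum.Sigma) (use finK in auto)
    also have "\<dots> = (\<Sum>q\<in>?I. ?A i m q * v q)"
      by (intro sum.cong refl) (simp add: case_prod_unfold)
    also have "\<dots> = 0"
    proof -
      have "(i, m) \<in> ?E" using i m True neq by simp
      from bspec[OF v(2) this] show ?thesis by (simp only: fst_conv snd_conv)
    qed
    finally show ?thesis .
  next
    case False
    with degree[of i] i show ?thesis by (auto simp: coeff_eq_0)
  qed
  moreover have "\<exists>i\<le>d. x i \<noteq> 0"
  proof (rule ccontr)
    assume "\<not> ?thesis"
    then have "\<forall>i\<le>d. (\<Sum>l=1..d. p l * \<sigma> l i) = 0" by (auto simp: x_def)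
    with \<sigma> have "\<forall>l\<in>{1..d}. p l = 0" unfolding mu_basis_def by blast
    moreover obtain l k where lk: "(l, k) \<in> ?I" "v (l, k) \<noteq> 0" using v(1) by blast
    ultimately have "coeff (p l) k = 0" by simp
    with lk show False by (simp add: coeff_p)
  qed
  ultimately show ?thesis using syz degree unfolding popov_vector_def by blast
qed

text \<open>\<open>popov_vector\<close> leaves the pivot coefficient free, so its conditions are
  linear. A vanishing pivot would put the vector below \<open>\<mu>\<close> and make it zero;
  otherwise dividing by the pivot normalises the column.\<close>

lemma exists_popov:
  fixes b :: "nat \<Rightarrow> 'k::field poly"
  assumes vec: "\<And>j. j \<in> {1..d} \<Longrightarrow> \<exists>x. (\<exists>i\<le>d. x i \<noteq> 0) \<and> syzygy d b x \<and> popov_vector d \<mu> j x"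
    and zero: "\<And>x i j. j \<in> {1..d} \<Longrightarrow> syzygy d b x \<Longrightarrow> below d \<mu> x \<Longrightarrow>
      (\<And>i. i \<le> d \<Longrightarrow> degree (x i) \<le> \<mu> j) \<Longrightarrow> i \<le> d \<Longrightarrow> x i = 0"
  obtains \<sigma> where "popov d \<mu> \<sigma>" "\<And>j. j \<in> {1..d} \<Longrightarrow> syzygy d b (\<sigma> j)"
proof -
  from vec obtain x where x: "\<And>j. j \<in> {1..d} \<Longrightarrow> \<exists>i\<le>d. x j i \<noteq> 0"
    "\<And>j. j \<in> {1..d} \<Longrightarrow> syzygy d b (x j)" "\<And>j. j \<in> {1..d} \<Longrightarrow> popov_vector d \<mu> j (x j)"
    by metis
  have c: "coeff (x j j) (\<mu> j) \<noteq> 0" if j: "j \<in> {1..d}" for j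
  proof
    assume "coeff (x j j) (\<mu> j) = 0"
    with x(3)[OF j] have "below d \<mu> (x j)" by (auto simp: below_def popov_vector_def)
    with zero[OF j x(2)[OF j]] x(1,3)[OF j] show False unfolding popov_vector_def by blast
  qed
  define \<sigma> where "\<sigma> = (\<lambda>j i. Polynomial.smult (inverse (coeff (x j j) (\<mu> j))) (x j i))"
  have "syzygy d b (\<sigma> j)" if "j \<in> {1..d}" for j
    using x(2)[OF that] by (simp add: syzygy_def \<sigma>_def smult_sum_right[symmetric])
  moreover have "popov d \<mu> \<sigma>"
    unfolding popov_def
  proof (intro ballI conjI allI impI)
    fix j i assume j: "j \<in> {1..d}"
    show "degree (\<sigma> j i) \<le> \<mu> j" if "i \<le> d"
      using x(3)[OF j] that by (simp add: popov_vector_def \<sigma>_def)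
    fix k assume ik: "i \<in> {1..d}" "\<mu> i \<le> k"
    show "coeff (\<sigma> j i) k = (if i = j \<and> k = \<mu> j then 1 else 0)"
    proof (cases "i = j \<and> k = \<mu> j")
      case True
      with c[OF j] show ?thesis by (simp add: \<sigma>_def)
    next
      case False
      with x(3)[OF j] ik have "coeff (x j i) k = 0" unfolding popov_vector_def by blast
      with False show ?thesis by (simp add: \<sigma>_def)
    qed
  qed
  ultimately show thesis by (intro that)
qed

text \<open>The leading vectors of the basis are independent, so one unit vector completes them to
  an invertible matrix \<open>T\<close>. Its inverse carries the leading vector of column
  \<open>j\<close> to the unit vector \<open>e_j\<close>, and then leading terms in rows
  \<open>1, ..., d\<close> cannot cancel.\<close>

lemma exists_generic_transform:
  fixes b :: "nat \<Rightarrow> 'k::field poly"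
  assumes \<sigma>: "mu_basis d \<mu> b \<sigma>"
  obtains T T' where
    "\<And>i j. i \<le> d \<Longrightarrow> j \<le> d \<Longrightarrow> (\<Sum>l\<le>d. T i l * T' l j) = (if i = j then 1 else 0)"
    "\<And>i j. i \<le> d \<Longrightarrow> j \<le> d \<Longrightarrow> (\<Sum>l\<le>d. T' i l * T l j) = (if i = j then 1 else 0)"
    "\<And>x i. syzygy d (act d (\<lambda>i l. T l i) b) x \<Longrightarrow> below d \<mu> x \<Longrightarrow> i \<le> d \<Longrightarrow> x i = 0"
proof -
  define V where "V = (\<lambda>i j. coeff (\<sigma> j i) (\<mu> j))"
  \<comment> \<open>\<open>\<alpha>\<close> is orthogonal to all leading vectors; a unit vector at
    an index where \<open>\<alpha>\<close> is nonzero therefore lies outside their span.\<close>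
  have "\<exists>\<alpha>. (\<exists>i\<in>{..d}. \<alpha> i \<noteq> 0) \<and> (\<forall>j\<in>{1..d}. (\<Sum>i\<in>{..d}. V i j * \<alpha> i) = 0)"
    by (rule underdetermined_system) auto
  then obtain \<alpha> i\<^sub>0 where i\<^sub>0: "i\<^sub>0 \<in> {..d}" "\<alpha> i\<^sub>0 \<noteq> 0"
    and \<alpha>: "\<And>j. j \<in> {1..d} \<Longrightarrow> (\<Sum>i\<le>d. V i j * \<alpha> i) = 0" by blast
  define T where "T = (\<lambda>i j. if j = 0 then if i = i\<^sub>0 then 1 else 0 else V i j)"
  have inj: "c j = 0" if c: "\<And>i. i \<le> d \<Longrightarrow> (\<Sum>j\<le>d. T i j * c j) = 0" and j: "j \<le> d" for c j
  proof -
    have split: "(\<Sum>j\<le>d. T i j * c j) = (if i = i\<^sub>0 then c 0 else 0) + (\<Sum>j=1..d. c j * V i j)" for i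
      unfolding sum_atMost_split_first by (auto simp: T_def mult.commute intro!: sum.cong)
    have "(\<Sum>i\<le>d. \<alpha> i * (\<Sum>j=1..d. c j * V i j)) = (\<Sum>j=1..d. c j * (\<Sum>i\<le>d. V i j * \<alpha> i))"
      unfolding sum_distrib_left by (subst sum.swap) (simp add: mult_ac)
    also have "\<dots> = 0" using \<alpha> by simp
    finally have "(\<Sum>i\<le>d. \<alpha> i * (\<Sum>j\<le>d. T i j * c j)) = (\<Sum>i\<le>d. if i = i\<^sub>0 then \<alpha> i\<^sub>0 * c 0 else 0)"
      unfolding split by (simp add: distrib_left sum.distrib if_distrib[of "\<lambda>z. _ * z"] cong: if_cong)
    then have "\<alpha> i\<^sub>0 * c 0 = 0" using c i\<^sub>0(1) by simp
    then have "c 0 = 0" using i\<^sub>0(2) by simp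
    then have "(\<Sum>j=1..d. c j * coeff (\<sigma> j i) (\<mu> j)) = 0" if "i \<le> d" for i
      using c[OF that] unfolding split V_def by (simp split: if_splits)
    with mu_basis_leading_independent[OF \<sigma>] \<open>c 0 = 0\<close> j show ?thesis by (cases "j = 0") auto
  qed
  have "det (matrix_of (Suc d) T) \<noteq> 0"
  proof
    assume "det (matrix_of (Suc d) T) = 0"
    then obtain c j where "j \<le> d" "c j \<noteq> 0" "\<forall>i\<le>d. (\<Sum>j\<le>d. T i j * c j) = 0"
      unfolding det_matrix_of_eq_0_iff less_Suc_eq_le lessThan_Suc_atMost by blast
    with inj[of c j] show False by blast
  qed
  then obtain T' where T':
    "\<And>i j. i < Suc d \<Longrightarrow> j < Suc d \<Longrightarrow> (\<Sum>l<Suc d. T i l * T' l j) = (if i = j then 1 else 0)"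
    "\<And>i j. i < Suc d \<Longrightarrow> j < Suc d \<Longrightarrow> (\<Sum>l<Suc d. T' i l * T l j) = (if i = j then 1 else 0)"
    by (rule exists_inverse_matrix) (rule that)
  note T = T'[unfolded less_Suc_eq_le lessThan_Suc_atMost]
  define \<sigma>' where "\<sigma>' = (\<lambda>j. act d T' (\<sigma> j))"
  have \<sigma>': "mu_basis d \<mu> (act d (\<lambda>i l. T l i) b) \<sigma>'"
    unfolding \<sigma>'_def by (rule mu_basis_act[OF \<sigma> T])
  have lead: "coeff (\<sigma>' j i) (\<mu> j) = (if i = j then 1 else 0)" if "j \<in> {1..d}" "i \<le> d" for i j
  proof -
    have "coeff (\<sigma>' j i) (\<mu> j) = (\<Sum>l\<le>d. T' i l * T l j)"
      using that by (simp add: \<sigma>'_def act_def coeff_sum T_def V_def)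
    with T(2) that show ?thesis by simp
  qed
  have "x i = 0" if x: "syzygy d (act d (\<lambda>i l. T l i) b) x" "below d \<mu> x" and i: "i \<le> d" for x i
  proof -
    define e where "e = (\<Sum>i\<le>d. degree (x i))"
    have "\<forall>i\<le>d. degree (x i) \<le> e" unfolding e_def by (auto intro: member_le_sum)
    with \<sigma>' x(1) obtain p where p: "\<forall>i\<le>d. x i = (\<Sum>j=1..d. p j * \<sigma>' j i)"
      unfolding mu_basis_def by blast
    have "p j = 0" if "j \<in> {1..d}" for j
    proof (rule ccontr)
      assume "p j \<noteq> 0"
      let ?J = "{j \<in> {1..d}. p j \<noteq> 0}"
      \<comment> \<open>Choose \<open>k\<close> with \<open>degree (p k) + \<mu> k = m\<close>
        maximal. Leading vectors are unit vectors, so in row \<open>k\<close> only the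
        \<open>k\<close>-th summand reaches degree \<open>m\<close>, against the bound imposed by
        \<open>below\<close>.\<close>
      define m where "m = Max ((\<lambda>j. degree (p j) + \<mu> j) ` ?J)"
      have m: "degree (p l) + \<mu> l \<le> m" if "l \<in> {1..d}" "p l \<noteq> 0" for l
        unfolding m_def by (rule Max_ge) (use that in auto)
      have "m \<in> (\<lambda>j. degree (p j) + \<mu> j) ` ?J"
        unfolding m_def using \<open>j \<in> _\<close> \<open>p j \<noteq> 0\<close> by (intro Max_in) auto
      then obtain k where k: "k \<in> {1..d}" "p k \<noteq> 0" "m = degree (p k) + \<mu> k" by blast
      have "coeff (p l * \<sigma>' l k) m = (if l = k then lead_coeff (p k) else 0)" if l: "l \<in> {1..d}" for l
      proof (cases "p l = 0")
        case False
        have "degree (p l) \<le> m - \<mu> l" "m - \<mu> l + \<mu> l = m" using m[OF l False] by simp_all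
        moreover have "degree (\<sigma>' l k) \<le> \<mu> l" using \<sigma>' l k(1) by (simp add: mu_basis_def)
        ultimately have "coeff (p l * \<sigma>' l k) m = coeff (p l) (m - \<mu> l) * coeff (\<sigma>' l k) (\<mu> l)"
          using coeff_mult_top by metis
        then show ?thesis using lead[OF l, of k] k(1,3) by auto
      qed (use k(2) in auto)
      then have "coeff (x k) m = lead_coeff (p k)"
        using p k(1) by (simp add: coeff_sum)
      moreover have "coeff (x k) m = 0" using x(2) k(1,3) by (auto simp: below_def)
      ultimately show False using k(2) by simp
    qed
    with p i show ?thesis by simp
  qed
  with T show thesis by (rule that)
qed

section \<open>Maximal minors and the Hilbert--Burch factorisation\<close>

definition minor_matrix ::
    "(nat \<Rightarrow> nat \<Rightarrow> 'k poly) \<Rightarrow> (nat \<Rightarrow> 'k::comm_ring_1 poly) \<Rightarrow> nat \<Rightarrow> nat \<Rightarrow> 'k poly" where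
  "minor_matrix \<sigma> u = (\<lambda>i j. if j = 0 then u i else \<sigma> j i)"

text \<open>Prepending the unit vector \<open>e\<^sub>i\<close> as column \<open>0\<close> yields the \<open>i\<close>-th maximal minor with its sign.\<close>

definition minor :: "nat \<Rightarrow> (nat \<Rightarrow> nat \<Rightarrow> 'k::comm_ring_1 poly) \<Rightarrow> nat \<Rightarrow> 'k poly" where
  "minor d \<sigma> i = det (matrix_of (Suc d) (minor_matrix \<sigma> (\<lambda>l. if l = i then 1 else 0)))"

text \<open>Laplace expansion along column \<open>0\<close>, whose cofactors do not involve
  \<open>u\<close>.\<close>

lemma det_minor_matrix:
  "det (matrix_of (Suc d) (minor_matrix \<sigma> u)) = (\<Sum>i\<le>d. u i * minor d \<sigma> i)"
proof -
  let ?M = "\<lambda>u. matrix_of (Suc d) (minor_matrix \<sigma> u)"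
  let ?c = "\<lambda>i. cofactor (?M (\<lambda>_. 0)) i 0"
  have delete: "mat_delete (?M u) i 0 = mat_delete (?M (\<lambda>_. 0)) i 0" for u i
    unfolding mat_delete_def by (rule eq_matI) (auto simp: minor_matrix_def)
  have cofactor: "cofactor (?M u) i 0 = ?c i" for u i
    unfolding cofactor_def by (subst delete) (rule refl)
  have expand: "det (?M u) = (\<Sum>i\<le>d. u i * ?c i)" for u
  proof -
    have "det (?M u) = (\<Sum>i<Suc d. ?M u $$ (i, 0) * cofactor (?M u) i 0)"
      by (rule laplace_expansion_column) auto
    also have "\<dots> = (\<Sum>i<Suc d. u i * ?c i)"
      by (intro sum.cong refl arg_cong2[where f = "(*)"] cofactor) (simp add: minor_matrix_def)
    finally show ?thesis unfolding lessThan_Suc_atMost .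
  qed
  have "minor d \<sigma> i = ?c i" if "i \<le> d" for i
    unfolding minor_def expand using that by (simp add: if_distrib[of "\<lambda>z. z * _"] cong: if_cong)
  then show ?thesis unfolding expand[of u] by simp
qed

text \<open>With \<open>u\<close> equal to column \<open>j\<close> the determinant has two equal
  columns.\<close>

lemma syzygy_minor:
  assumes "j \<in> {1..d}"
  shows "syzygy d (minor d \<sigma>) (\<sigma> j)"
proof -
  have "det (matrix_of (Suc d) (minor_matrix \<sigma> (\<sigma> j))) = 0"
    by (rule det_identical_columns[of _ "Suc d" 0 j])
       (use assms in \<open>auto simp: minor_matrix_def intro!: eq_vecI\<close>)
  then show ?thesis unfolding det_minor_matrix syzygy_def .
qed

lemma degree_minor:
  assumes "\<And>i j. i \<le> d \<Longrightarrow> j \<in> {1..d} \<Longrightarrow> degree (\<sigma> j i) \<le> \<mu> j"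
  shows "degree (minor d \<sigma> i) \<le> (\<Sum>j=1..d. \<mu> j)"
  unfolding minor_def det_matrix_of
proof (rule degree_sum_le)
  show "finite {p. p permutes {0..<Suc d}}" by (simp add: finite_permutations)
  fix p assume "p \<in> {p. p permutes {0..<Suc d}}"
  then have p: "p permutes {..<Suc d}" by (simp add: atLeast0LessThan)
  let ?A = "minor_matrix \<sigma> (\<lambda>l. if l = i then 1 else 0)"
  let ?m = "\<lambda>j. if j = 0 then 0 else \<mu> j"
  have entry: "degree (?A l (p l)) \<le> ?m (p l)" if "l \<in> {..<Suc d}" for l
    using assms[of l "p l"] permutes_in_image[OF p, of l] that by (auto simp: minor_matrix_def)
  have "degree (\<Prod>l<Suc d. ?A l (p l)) \<le> (\<Sum>l<Suc d. ?m (p l))"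
    by (rule coeff_prod_top(1)) (use entry in auto)
  also have "\<dots> = (\<Sum>l<Suc d. ?m l)"
    using sum.permute[OF p, of ?m] by (simp add: comp_def)
  also have "\<dots> = (\<Sum>j=1..d. \<mu> j)"
    unfolding lessThan_Suc_atMost sum_atMost_split_first by simp
  finally have "degree (\<Prod>l<Suc d. ?A l (p l)) \<le> (\<Sum>j=1..d. \<mu> j)" .
  then show "degree (signof p * (\<Prod>l<Suc d. ?A l (p l))) \<le> (\<Sum>j=1..d. \<mu> j)"
    by (auto simp: sign_def)
qed

text \<open>The bounds \<open>\<mu>\<^sub>i\<close> on the degrees of the rows \<open>i = 1, \<dots>, d\<close> of a Popov matrix are attained on
  the diagonal only.\<close>

lemma coeff_minor_popov:
  fixes \<sigma> :: "nat \<Rightarrow> nat \<Rightarrow> 'k::field poly"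
  assumes \<sigma>: "popov d \<mu> \<sigma>"
  shows "coeff (minor d \<sigma> 0) (\<Sum>j=1..d. \<mu> j) = 1"
proof -
  let ?A = "minor_matrix \<sigma> (\<lambda>l. if l = 0 then 1 else 0)"
  let ?m = "\<lambda>j. if j = 0 then 0 else \<mu> j"
  have m: "(\<Sum>l<Suc d. ?m l) = (\<Sum>j=1..d. \<mu> j)"
    unfolding lessThan_Suc_atMost sum_atMost_split_first by simp
  have "coeff (signof p * (\<Prod>l<Suc d. ?A l (p l))) (\<Sum>j=1..d. \<mu> j) = (if p = id then 1 else 0)"
    if "p permutes {0..<Suc d}" for p
  proof -
    from that have p: "p permutes {..<Suc d}" by (simp add: atLeast0LessThan)
    show ?thesis
    proof (cases "p 0 = 0")
      case False
      \<comment> \<open>Column \<open>0\<close> is the unit vector \<open>e_0\<close>, so a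
        permutation that moves \<open>0\<close> picks a zero entry from it.\<close>
      obtain l where l: "p l = 0" "l < Suc d" using permutes_surj[OF p] permutes_in_image[OF p]
        by (metis lessThan_iff surjD zero_less_Suc)
      moreover have "l \<noteq> 0" using l(1) False by metis
      ultimately have "?A l (p l) = 0" by (simp add: minor_matrix_def)
      then have "(\<Prod>l<Suc d. ?A l (p l)) = 0" using l(2) by (intro prod_zero) auto
      moreover have "p \<noteq> id" using False by auto
      ultimately show ?thesis by (simp only: mult_zero_right coeff_0 if_False)
    next
      case True
      have p_pos: "p l \<in> {1..d}" if "l \<in> {1..d}" for l
      proof -
        have "p l \<noteq> p 0" using that permutes_inj[OF p] by (auto dest: injD)
        moreover have "p l < Suc d" using permutes_in_image[OF p, of l] that by simp
        ultimately show ?thesis using True by simp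
      qed
      have entry: "degree (?A l (p l)) \<le> ?m l \<and> coeff (?A l (p l)) (?m l) = (if p l = l then 1 else 0)"
        if "l \<in> {..<Suc d}" for l
      proof (cases "l = 0")
        case False
        with that have l: "l \<in> {1..d}" by auto
        have "degree (\<sigma> (p l) l) \<le> \<mu> l"
          by (rule degree_le) (use popov_coeff[OF \<sigma> p_pos[OF l] l] in auto)
        then show ?thesis
          using popov_coeff[OF \<sigma> p_pos[OF l] l order_refl] p_pos[OF l] False
          by (auto simp: minor_matrix_def)
      qed (simp add: True minor_matrix_def)
      have "coeff (\<Prod>l<Suc d. ?A l (p l)) (\<Sum>l<Suc d. ?m l) = (\<Prod>l<Suc d. if p l = l then 1 else 0)"
        using coeff_prod_top(2)[of "{..<Suc d}" "\<lambda>l. ?A l (p l)" ?m] entry by simp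
      also have "\<dots> = (if p = id then 1 else 0)"
      proof (cases "p = id")
        case False
        then obtain l where "p l \<noteq> l" by (auto simp: fun_eq_iff)
        then have "l < Suc d" using p by (auto simp: permutes_def)
        with \<open>p l \<noteq> l\<close> False show ?thesis by (intro prod_zero[THEN trans]) (auto intro!: bexI[of _ l])
      qed simp
      finally show ?thesis unfolding m by (auto simp: sign_def)
    qed
  qed
  then show ?thesis
    unfolding minor_def det_matrix_of coeff_sum
    by (simp add: finite_permutations permutes_id)
qed

text \<open>A nonzero combination of least degree divides every \<open>b i\<close>, since the
  remainder is again a combination; this is a greatest common divisor together with its Bezout
  coefficients.\<close>

lemma bezout_family:
  fixes b :: "nat \<Rightarrow> 'k::field poly"
  assumes "\<exists>i\<le>d. b i \<noteq> 0"
  obtains h b' u where "\<And>i. i \<le> d \<Longrightarrow> b i = h * b' i" "(\<Sum>i\<le>d. u i * b' i) = 1"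
proof -
  let ?S = "\<lambda>f. f \<noteq> 0 \<and> (\<exists>u. f = (\<Sum>i\<le>d. u i * b i))"
  from assms obtain i where i: "i \<le> d" "b i \<noteq> 0" by blast
  then have "?S (b i)"
    by (auto intro!: exI[of _ "\<lambda>l. if l = i then 1 else 0"] simp: if_distrib[of "\<lambda>z. z * _"] cong: if_cong)
  then obtain h where h: "?S h" "\<And>f. ?S f \<Longrightarrow> degree h \<le> degree f"
    using ex_has_least_nat[of ?S "b i" degree] by blast
  from h(1) obtain u where u: "h = (\<Sum>i\<le>d. u i * b i)" by blast
  have div: "b l = h * (b l div h)" if "l \<le> d" for l
  proof -
    have "b l mod h = 0"
    proof (rule ccontr)
      assume nz: "b l mod h \<noteq> 0"
      have "(\<Sum>i\<le>d. ((if i = l then 1 else 0) - b l div h * u i) * b i) =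
          (\<Sum>i\<le>d. if i = l then b l else 0) - (\<Sum>i\<le>d. b l div h * (u i * b i))"
        unfolding sum_subtractf[symmetric] by (intro sum.cong refl) (auto simp: algebra_simps)
      also have "\<dots> = b l - b l div h * h"
        using that by (simp add: u sum_distrib_left[symmetric])
      also have "\<dots> = b l mod h" by (simp add: minus_div_mult_eq_mod)
      finally have "?S (b l mod h)" using nz by metis
      then have "degree h \<le> degree (b l mod h)" by (rule h(2))
      with degree_mod_less[of h "b l"] h(1) nz show False by auto
    qed
    then show ?thesis by (metis mult_div_mod_eq add.right_neutral)
  qed
  have "h * (\<Sum>i\<le>d. u i * (b i div h)) = (\<Sum>i\<le>d. u i * (h * (b i div h)))"
    by (simp add: sum_distrib_left mult_ac)
  also have "\<dots> = h * 1"
    unfolding mult_1_right by (subst (2) u) (intro sum.cong refl, simp add: div[symmetric])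
  finally have "(\<Sum>i\<le>d. u i * (b i div h)) = 1" using h(1) by (simp only: mult_cancel_left) simp
  with div show thesis by (rule that)
qed

text \<open>If \<open>b = h b'\<close> with \<open>u \<cdot> b' = 1\<close>, then the columns of \<open>1 - u b'\<^sup>T\<close> are syzygies, so that \<open>u\<close>
  and the \<open>\<sigma>\<^sub>j\<close> form an invertible matrix whose inverse has first row \<open>b'\<close>.\<close>

lemma mu_basis_minors:
  fixes b :: "nat \<Rightarrow> 'k::field poly"
  assumes \<sigma>: "mu_basis d \<mu> b \<sigma>" and "\<exists>i\<le>d. b i \<noteq> 0"
  obtains g where "\<And>i. i \<le> d \<Longrightarrow> b i = g * minor d \<sigma> i"
proof -
  obtain h b' u where b: "\<And>i. i \<le> d \<Longrightarrow> b i = h * b' i" and u: "(\<Sum>i\<le>d. u i * b' i) = 1"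
    using bezout_family[OF assms(2)] by blast
  have "\<exists>p. \<forall>i\<le>d. (if i = l then 1 else 0) = u i * b' l + (\<Sum>j=1..d. p j * \<sigma> j i)" if l: "l \<le> d" for l
  proof -
    define x where "x = (\<lambda>i. (if i = l then 1 else 0) - u i * b' l)"
    have "(\<Sum>i\<le>d. x i * b i) = (\<Sum>i\<le>d. (if i = l then b l else 0) - h * b' l * (u i * b' i))"
      by (intro sum.cong refl) (auto simp: x_def b algebra_simps)
    also have "\<dots> = b l - h * b' l * (\<Sum>i\<le>d. u i * b' i)"
      using l by (simp add: sum_subtractf sum_distrib_left)
    also have "\<dots> = 0" by (simp add: u b l)
    finally have "syzygy d b x" by (simp add: syzygy_def)
    moreover have "\<forall>i\<le>d. degree (x i) \<le> (\<Sum>i\<le>d. degree (x i))" by (auto intro: member_le_sum)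
    ultimately obtain p where "\<forall>i\<le>d. x i = (\<Sum>j=1..d. p j * \<sigma> j i)"
      using \<sigma> unfolding mu_basis_def by blast
    then show ?thesis by (intro exI[of _ p]) (simp add: x_def algebra_simps)
  qed
  then obtain p where p: "\<And>i l. l \<le> d \<Longrightarrow> i \<le> d \<Longrightarrow>
      (if i = l then 1 else 0) = u i * b' l + (\<Sum>j=1..d. p l j * \<sigma> j i)" by metis
  let ?M = "matrix_of (Suc d) (minor_matrix \<sigma> u)"
  let ?K = "matrix_of (Suc d) (\<lambda>j l. if j = 0 then b' l else p l j)"
  have "?M * ?K = 1\<^sub>m (Suc d)"
    unfolding matrix_of_mult one_matrix_of
  proof (rule matrix_of_cong)
    fix i l assume "i < Suc d" "l < Suc d"
    then have il: "l \<le> d" "i \<le> d" by auto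
    have "(\<Sum>j<Suc d. minor_matrix \<sigma> u i j * (if j = 0 then b' l else p l j)) =
        u i * b' l + (\<Sum>j=1..d. p l j * \<sigma> j i)"
      unfolding lessThan_Suc_atMost sum_atMost_split_first
      by (auto simp: minor_matrix_def mult.commute intro!: sum.cong)
    with p[OF il]
    show "(\<Sum>j<Suc d. minor_matrix \<sigma> u i j * (if j = 0 then b' l else p l j)) = (if i = l then 1 else 0)"
      by (simp only:)
  qed
  then have inv: "det ?M * det ?K = 1"
    using det_mult[of ?M "Suc d" ?K] by simp
  \<comment> \<open>The unit vector \<open>e_l\<close>, written through \<open>u\<close> and the
    columns, is paired with the minors; the columns drop out because they are syzygies of the
    minors.\<close>
  have minor: "minor d \<sigma> l = det ?M * b' l" if l: "l \<le> d" for l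
  proof -
    have "minor d \<sigma> l = (\<Sum>i\<le>d. (if i = l then 1 else 0) * minor d \<sigma> i)"
      using l by (simp add: if_distrib[of "\<lambda>z. z * _"] cong: if_cong)
    also have "\<dots> = (\<Sum>i\<le>d. (u i * b' l + (\<Sum>j=1..d. p l j * \<sigma> j i)) * minor d \<sigma> i)"
      by (intro sum.cong refl) (simp only: p[OF l] atMost_iff)
    also have "\<dots> = (\<Sum>i\<le>d. u i * minor d \<sigma> i) * b' l +
        (\<Sum>i\<le>d. (\<Sum>j=1..d. p l j * \<sigma> j i) * minor d \<sigma> i)"
      unfolding sum_distrib_right[of _ _ "b' l"] sum.distrib[symmetric]
      by (intro sum.cong refl) (simp add: distrib_right distrib_left mult_ac)
    also have "(\<Sum>i\<le>d. (\<Sum>j=1..d. p l j * \<sigma> j i) * minor d \<sigma> i) = 0"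
      using syzygy_sum[of "{1..d}" d "minor d \<sigma>" \<sigma> "p l", OF syzygy_minor] by (simp add: syzygy_def)
    finally show ?thesis by (simp add: det_minor_matrix)
  qed
  have "b l = (h * det ?K) * minor d \<sigma> l" if "l \<le> d" for l
  proof -
    have "(h * det ?K) * minor d \<sigma> l = h * (det ?M * det ?K) * b' l"
      by (simp add: minor[OF that] mult_ac)
    then show ?thesis by (simp only: inv b[OF that] mult_1_right)
  qed
  then show thesis by (rule that)
qed

section \<open>The stratum and its parametrisation\<close>

abbreviation dehom :: "(nat \<Rightarrow> 'k::comm_ring_1 poly poly) \<Rightarrow> nat \<Rightarrow> 'k poly" where
  "dehom a \<equiv> \<lambda>i. poly (a i) 1"

definition tuple_of :: "nat \<Rightarrow> nat \<Rightarrow> (nat \<Rightarrow> 'k::comm_ring_1 poly) \<Rightarrow> nat \<Rightarrow> 'k poly poly" where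
  "tuple_of n d b = (\<lambda>i. if i \<le> d then homogenize n (b i) else 0)"

lemma tuple_of_tuples: "tuple_of n d b \<in> tuples n d"
  by (auto simp: tuples_def tuple_of_def free_module_def)

lemma dehom_tuple_of: "i \<le> d \<Longrightarrow> degree (b i) \<le> n \<Longrightarrow> dehom (tuple_of n d b) i = b i"
  by (simp add: tuple_of_def poly_homogenize)

lemma degree_dehom: "a \<in> tuples n d \<Longrightarrow> i \<le> d \<Longrightarrow> degree (dehom a i) \<le> n"
  by (rule degree_dehomogenize[OF tuples_homog])

lemma tuple_of_dehom:
  assumes "a \<in> tuples n d" "\<And>i. i \<le> d \<Longrightarrow> b i = dehom a i"
  shows "tuple_of n d b = a"
proof
  fix i
  show "tuple_of n d b i = a i"
  proof (cases "i \<le> d")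
    case True
    have "homogenize n (dehom a i) = a i"
      by (rule homog_eqI[OF homogenize_homog tuples_homog[OF assms(1) True]])
         (simp add: poly_homogenize degree_dehom[OF assms(1) True])
    then show ?thesis using True assms(2) by (simp add: tuple_of_def)
  next
    case False
    then show ?thesis using assms(1) by (simp add: tuple_of_def tuples_def free_module_def)
  qed
qed

lemma coeff_tuple_of: "i \<le> d \<Longrightarrow> j \<le> n \<Longrightarrow> coeff (coeff (tuple_of n d b i) j) (n - j) = coeff (b i) (n - j)"
  by (simp add: tuple_of_def coeff_homogenize)

lemma coeff_dehom_polynomial_function:
  fixes n d :: nat
  assumes "i \<le> d" "k \<le> n"
  shows "(\<lambda>a. coeff (coeff (a i) (n - k)) k) \<in> polynomial_functions (coordinates n d)"
proof (rule polynomial_functions.coordinate)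
  have "(\<lambda>a. coeff (coeff (a i) (n - k)) k) = (\<lambda>a. coeff (coeff (a i) (n - k)) (n - (n - k)))"
    using assms(2) by simp
  then show "(\<lambda>a. coeff (coeff (a i) (n - k)) k) \<in> coordinates n d"
    unfolding coordinates_def using assms(1) by (intro CollectI exI[of _ i] exI[of _ "n - k"]) simp
qed

lemma coeff_dehom:
  assumes "a \<in> tuples n d" "i \<le> d"
  shows "coeff (dehom a i) k = (if k \<le> n then coeff (coeff (a i) (n - k)) k else 0)"
  by (rule coeff_dehomogenize[OF tuples_homog[OF assms]])

section \<open>Closed conditions: syzygies with prescribed support\<close>

lemma coeff_sum_mult_supported:
  fixes x b :: "nat \<Rightarrow> 'k::comm_ring_1 poly"
  assumes I: "finite I" "I \<subseteq> {..d} \<times> UNIV"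
    and x: "\<And>i k. i \<le> d \<Longrightarrow> (i, k) \<notin> I \<Longrightarrow> coeff (x i) k = 0"
  shows "coeff (\<Sum>i\<le>d. x i * b i) e =
    (\<Sum>(i, k)\<in>I. (if k \<le> e then coeff (b i) (e - k) else 0) * coeff (x i) k)"
proof -
  let ?K = "\<lambda>i. {k. (i, k) \<in> I}"
  have finK: "finite (?K i)" for i
    by (rule finite_subset[of _ "snd ` I"]) (use I(1) in force)+
  have I_eq: "I = (SIGMA i:{..d}. ?K i)" using I(2) by auto
  have "x i = (\<Sum>k\<in>?K i. monom (coeff (x i) k) k)" if "i \<le> d" for i
    by (rule poly_eqI) (use x[OF that] finK[of i] in \<open>auto simp: coeff_sum sum.delta'\<close>)
  then have "coeff (x i * b i) e = coeff ((\<Sum>k\<in>?K i. monom (coeff (x i) k) k) * b i) e" if "i \<le> d" for i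
    using that by metis
  also have "coeff ((\<Sum>k\<in>?K i. monom (coeff (x i) k) k) * b i) e =
      (\<Sum>k\<in>?K i. (if k \<le> e then coeff (b i) (e - k) else 0) * coeff (x i) k)" for i
    unfolding sum_distrib_right coeff_sum coeff_monom_mult
    by (intro sum.cong refl) (simp add: mult.commute)
  finally have "coeff (\<Sum>i\<le>d. x i * b i) e =
      (\<Sum>i\<le>d. \<Sum>k\<in>?K i. (if k \<le> e then coeff (b i) (e - k) else 0) * coeff (x i) k)"
    unfolding coeff_sum by (intro sum.cong refl) simp
  also have "\<dots> = (\<Sum>(i, k)\<in>I. (if k \<le> e then coeff (b i) (e - k) else 0) * coeff (x i) k)"
    by (subst (2) I_eq, rule sum.Sigma) (use finK in auto)
  finally show ?thesis .
qed

text \<open>Syzygies supported in the finite set \<open>I\<close> form the kernel of a matrix with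
  entries polynomial in the tuple. The row \<open>\<kappa>\<close> allows one further linear
  condition on the syzygy: it is zero for plain existence and prescribes a ratio of two coefficients
  when parameters are separated.\<close>

lemma closedin_has_syzygy:
  fixes \<kappa> :: "nat \<times> nat \<Rightarrow> 'k::field" and n :: nat
  assumes I: "finite I" "I \<subseteq> {..d} \<times> UNIV"
  shows "closedin (zariski n d) {a \<in> tuples n d. \<exists>x. (\<exists>i\<le>d. x i \<noteq> 0) \<and>
    syzygy d (act d T (dehom a)) x \<and> (\<forall>i\<le>d. \<forall>k. (i, k) \<notin> I \<longrightarrow> coeff (x i) k = 0) \<and>
    (\<Sum>(i, k)\<in>I. \<kappa> (i, k) * coeff (x i) k) = 0}" (is "closedin _ {a \<in> _. ?P a}")
proof -
  \<comment> \<open>A bound for all exponents in \<open>I\<close>; the products then have no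
    coefficients above \<open>n + M\<close>, which leaves finitely many equations.\<close>
  define M where "M = (\<Sum>(i, k)\<in>I. k)"
  have M: "k \<le> M" if "(i, k) \<in> I" for i k
  proof -
    have "(case (i, k) of (i, k) \<Rightarrow> k) \<le> M" unfolding M_def by (rule member_le_sum) (use that I in auto)
    then show ?thesis by simp
  qed
  define \<beta> where "\<beta> = (\<lambda>a i k. if k \<le> n then \<Sum>l\<le>d. T i l * coeff (coeff (a l) (n - k)) k else 0)"
  have \<beta>: "coeff (act d T (dehom a) i) k = \<beta> a i k" if "a \<in> tuples n d" for a i k
    by (auto simp: act_def coeff_sum \<beta>_def coeff_dehom[OF that])
  \<comment> \<open>Rows up to \<open>n + M\<close> are the coefficients of the syzygy equation; row
    \<open>Suc (n + M)\<close> is reserved for \<open>\<kappa>\<close>.\<close>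
  define A where "A = (\<lambda>a e (i, k). if e = Suc (n + M) then \<kappa> (i, k)
      else if k \<le> e then \<beta> a i (e - k) else 0)"
  have "(\<lambda>a. A a e q) \<in> polynomial_functions (coordinates n d)" if "q \<in> I" for e q
  proof (cases q)
    case (Pair i k)
    have "(\<lambda>a. \<beta> a i m) \<in> polynomial_functions (coordinates n d)" for m
    proof (cases "m \<le> n")
      case True
      then show ?thesis unfolding \<beta>_def if_P[OF True]
        by (intro polynomial_functions_sum polynomial_functions.mult polynomial_functions.const
            coeff_dehom_polynomial_function) simp
    qed (simp add: \<beta>_def polynomial_functions.const)
    then show ?thesis
      unfolding A_def Pair
      by (cases "e = Suc (n + M)"; cases "k \<le> e") (simp_all add: polynomial_functions.const)
  qed
  then have "closedin (zariski n d) {a \<in> tuples n d. \<exists>v. (\<exists>q\<in>I. v q \<noteq> 0) \<and>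
      (\<forall>e\<in>{..Suc (n + M)}. (\<Sum>q\<in>I. A a e q * v q) = 0)}"
    unfolding zariski_def by (intro closedin_singular_locus I) auto
  moreover have "?P a \<longleftrightarrow> (\<exists>v. (\<exists>q\<in>I. v q \<noteq> 0) \<and> (\<forall>e\<in>{..Suc (n + M)}. (\<Sum>q\<in>I. A a e q * v q) = 0))"
    if a: "a \<in> tuples n d" for a
  proof -
    have syz: "syzygy d (act d T (dehom a)) x \<longleftrightarrow> (\<forall>e\<le>n + M. (\<Sum>q\<in>I. A a e q * coeff (x (fst q)) (snd q)) = 0)"
      if x: "\<And>i k. i \<le> d \<Longrightarrow> (i, k) \<notin> I \<Longrightarrow> coeff (x i) k = 0" for x
    proof -
      have expand: "coeff (\<Sum>i\<le>d. x i * act d T (dehom a) i) e =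
          (\<Sum>(i, k)\<in>I. (if k \<le> e then coeff (act d T (dehom a) i) (e - k) else 0) * coeff (x i) k)" for e
        by (rule coeff_sum_mult_supported[OF I]) (rule x)
      have sum: "coeff (\<Sum>i\<le>d. x i * act d T (dehom a) i) e = (\<Sum>q\<in>I. A a e q * coeff (x (fst q)) (snd q))"
        if "e \<le> n + M" for e
        unfolding expand
        by (intro sum.cong refl) (use that in \<open>auto simp: A_def \<beta>[OF a]\<close>)
      have big: "coeff (\<Sum>i\<le>d. x i * act d T (dehom a) i) e = 0" if "\<not> e \<le> n + M" for e
        unfolding expand
        by (rule sum.neutral) (use that M in \<open>force simp: \<beta>[OF a] \<beta>_def\<close>)
      show ?thesis
      proof
        assume "syzygy d (act d T (dehom a)) x"
        then show "\<forall>e\<le>n + M. (\<Sum>q\<in>I. A a e q * coeff (x (fst q)) (snd q)) = 0"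
          unfolding syzygy_def using sum by simp
      next
        assume zero: "\<forall>e\<le>n + M. (\<Sum>q\<in>I. A a e q * coeff (x (fst q)) (snd q)) = 0"
        have "coeff (\<Sum>i\<le>d. x i * act d T (dehom a) i) e = 0" for e
          using sum[of e] big[of e] zero by (cases "e \<le> n + M") simp_all
        then show "syzygy d (act d T (dehom a)) x"
          unfolding syzygy_def by (simp add: poly_eq_iff del: coeff_sum)
      qed
    qed
    have \<kappa>: "(\<Sum>(i, k)\<in>I. \<kappa> (i, k) * coeff (x i) k) = (\<Sum>q\<in>I. A a (Suc (n + M)) q * coeff (x (fst q)) (snd q))" for x
      by (intro sum.cong refl) (auto simp: A_def)
    show ?thesis
    proof
      assume "?P a"
      then obtain x i where x: "i \<le> d" "x i \<noteq> 0" "syzygy d (act d T (dehom a)) x"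
        "\<And>i k. i \<le> d \<Longrightarrow> (i, k) \<notin> I \<Longrightarrow> coeff (x i) k = 0" "(\<Sum>(i, k)\<in>I. \<kappa> (i, k) * coeff (x i) k) = 0" by blast
      let ?v = "\<lambda>q. coeff (x (fst q)) (snd q)"
      obtain k where "coeff (x i) k \<noteq> 0" using x(2) by (metis leading_coeff_0_iff)
      then have "(i, k) \<in> I" "?v (i, k) \<noteq> 0" using x(1,4) by auto
      moreover have "\<forall>e\<le>n + M. (\<Sum>q\<in>I. A a e q * ?v q) = 0"
        using iffD1[OF syz x(3)] x(4) by blast
      then have "(\<Sum>q\<in>I. A a e q * ?v q) = 0" if "e \<in> {..Suc (n + M)}" for e
        using that x(5) unfolding \<kappa> by (cases "e = Suc (n + M)") auto
      ultimately show "\<exists>v. (\<exists>q\<in>I. v q \<noteq> 0) \<and> (\<forall>e\<in>{..Suc (n + M)}. (\<Sum>q\<in>I. A a e q * v q) = 0)"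
        by (intro exI[of _ ?v] conjI bexI[of _ "(i, k)"] ballI)
    next
      assume "\<exists>v. (\<exists>q\<in>I. v q \<noteq> 0) \<and> (\<forall>e\<in>{..Suc (n + M)}. (\<Sum>q\<in>I. A a e q * v q) = 0)"
      then obtain v i k where v: "(i, k) \<in> I" "v (i, k) \<noteq> 0"
        "\<And>e. e \<le> Suc (n + M) \<Longrightarrow> (\<Sum>q\<in>I. A a e q * v q) = 0" by auto
      define x where "x = (\<lambda>i. \<Sum>k | (i, k) \<in> I. monom (v (i, k)) k)"
      have "finite {k. (i, k) \<in> I}" for i
        by (rule finite_subset[of _ "snd ` I"]) (use I(1) in force)+
      then have coeff_x: "coeff (x i) k = (if (i, k) \<in> I then v (i, k) else 0)" for i k
        by (simp add: x_def coeff_sum sum.delta')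
      have sums: "(\<Sum>q\<in>I. A a e q * coeff (x (fst q)) (snd q)) = (\<Sum>q\<in>I. A a e q * v q)" for e
        by (intro sum.cong refl) (auto simp: coeff_x)
      have "i \<le> d" "x i \<noteq> 0" using v(1,2) I(2) coeff_x[of i k] by auto
      moreover have "\<forall>i\<le>d. \<forall>k. (i, k) \<notin> I \<longrightarrow> coeff (x i) k = 0" by (simp add: coeff_x)
      moreover have "syzygy d (act d T (dehom a)) x"
        using v(3) by (subst syz) (auto simp: coeff_x sums)
      moreover have "(\<Sum>(i, k)\<in>I. \<kappa> (i, k) * coeff (x i) k) = 0"
        unfolding \<kappa> sums by (rule v(3)) simp
      ultimately show "?P a" by blast
    qed
  qed
  ultimately show ?thesis by (simp cong: conj_cong)
qed

text \<open>Linear independence of the entries comes from \<open>\<mu> j \<ge> 1\<close>: a constant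
  relation is a syzygy of degree \<open>0\<close>, and the degree clause then forces all its
  coefficients to vanish.\<close>

lemma stratum_iff_mu_basis:
  fixes a :: "nat \<Rightarrow> 'k::field poly poly"
  assumes a: "a \<in> tuples n d" and \<mu>: "partition_parts d \<mu>"
  shows "a \<in> stratum n d \<mu> \<longleftrightarrow> (\<exists>\<sigma>. mu_basis d \<mu> (dehom a) \<sigma>)"
proof
  assume "a \<in> stratum n d \<mu>"
  then show "\<exists>\<sigma>. mu_basis d \<mu> (dehom a) \<sigma>"
    using mu_basis_of_mu_type[OF a] by (simp add: stratum_def)
next
  assume "\<exists>\<sigma>. mu_basis d \<mu> (dehom a) \<sigma>"
  then obtain \<sigma> where \<sigma>: "mu_basis d \<mu> (dehom a) \<sigma>" by blast
  have "c i = 0" if c: "(\<Sum>i=0..d. Polynomial.smult [:c i:] (a i)) = 0" and i: "i \<in> {0..d}" for c i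
  proof -
    have "syzygy d (dehom a) (\<lambda>i. [:c i:])"
      using arg_cong[OF c, of "\<lambda>p. poly p 1"] by (simp add: syzygy_def poly_sum atLeast0AtMost)
    moreover have "\<forall>i\<le>d. degree [:c i:] \<le> 0" by simp
    moreover have "\<forall>e x. syzygy d (dehom a) x \<longrightarrow> (\<forall>i\<le>d. degree (x i) \<le> e) \<longrightarrow>
        (\<exists>p. (\<forall>i\<le>d. x i = (\<Sum>j=1..d. p j * \<sigma> j i)) \<and>
          (\<forall>j\<in>{1..d}. p j \<noteq> 0 \<longrightarrow> degree (p j) + \<mu> j \<le> e))"
      using \<sigma> unfolding mu_basis_def by (elim conjE)
    ultimately obtain p where p: "\<forall>i\<le>d. [:c i:] = (\<Sum>j=1..d. p j * \<sigma> j i)"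
      "\<forall>j\<in>{1..d}. p j \<noteq> 0 \<longrightarrow> degree (p j) + \<mu> j \<le> 0"
      by blast
    have "p j = 0" if "j \<in> {1..d}" for j
      using p(2) \<mu> that unfolding partition_parts_def by fastforce
    with p(1) i show ?thesis by simp
  qed
  then show "a \<in> stratum n d \<mu>"
    using a mu_type_of_mu_basis[OF a \<sigma> \<mu>] by (simp add: stratum_def CP_def)
qed

definition inverse_matrices :: "nat \<Rightarrow> (nat \<Rightarrow> nat \<Rightarrow> 'k::field) \<Rightarrow> (nat \<Rightarrow> nat \<Rightarrow> 'k) \<Rightarrow> bool" where
  "inverse_matrices d T T' \<longleftrightarrow> (\<forall>i\<le>d. \<forall>j\<le>d. (\<Sum>l\<le>d. T i l * T' l j) = (if i = j then 1 else 0) \<and>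
     (\<Sum>l\<le>d. T' i l * T l j) = (if i = j then 1 else 0))"

lemma inverse_matrices_sym: "inverse_matrices d T T' \<Longrightarrow> inverse_matrices d T' T"
  by (simp add: inverse_matrices_def)

lemma mu_basis_act_iff:
  fixes b :: "nat \<Rightarrow> 'k::field poly"
  assumes T: "inverse_matrices d T T'"
  shows "(\<exists>\<sigma>. mu_basis d \<mu> (act d (\<lambda>i l. T l i) b) \<sigma>) \<longleftrightarrow> (\<exists>\<sigma>. mu_basis d \<mu> b \<sigma>)"
proof -
  have *: "\<exists>\<sigma>. mu_basis d \<mu> (act d (\<lambda>i l. T l i) b) \<sigma>"
    if "mu_basis d \<mu> b \<sigma>" "inverse_matrices d T T'" for b \<sigma> and T T' :: "nat \<Rightarrow> nat \<Rightarrow> 'k"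
    using mu_basis_act[OF that(1), of T T'] that(2) unfolding inverse_matrices_def by blast
  have "act d (\<lambda>i l. T' l i) (act d (\<lambda>i l. T l i) b) i = b i" if "i \<le> d" for i
    by (rule act_inverse[OF _ that]) (use T in \<open>auto simp: inverse_matrices_def mult.commute\<close>)
  then have "mu_basis d \<mu> (act d (\<lambda>i l. T' l i) (act d (\<lambda>i l. T l i) b)) \<sigma> \<longleftrightarrow> mu_basis d \<mu> b \<sigma>" for \<sigma>
    by (rule mu_basis_cong)
  then show ?thesis using *[OF _ T] *[OF _ inverse_matrices_sym[OF T]] by blast
qed

text \<open>Induction on \<open>d\<close>. A diagonal term is \<open>\<mu> i\<close>, and for
  \<open>i > j\<close> the terms \<open>(i, j)\<close> and \<open>(j, i)\<close> add up to
  \<open>\<mu> i + \<mu> j - max 0 (\<mu> i - \<mu> j - 1)\<close> by monotonicity.\<close>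

lemma sum_min_eq:
  assumes "mono_on {1..d} \<mu>"
  shows "(\<Sum>i=1..d. \<Sum>j=1..d. int (min (\<mu> i) (\<mu> j + 1))) =
    int d * int (\<Sum>i=1..d. \<mu> i) - (\<Sum>i=1..d. \<Sum>j\<in>{1..<i}. max 0 (int (\<mu> i) - int (\<mu> j) - 1))"
  using assms
proof (induction d)
  case (Suc d)
  have mono: "\<mu> j \<le> \<mu> (Suc d)" if "j \<in> {1..d}" for j
    using mono_onD[OF Suc.prems, of j "Suc d"] that by simp
  let ?f = "\<lambda>i j. int (min (\<mu> i) (\<mu> j + 1))"
  have "mono_on {1..d} \<mu>" by (rule mono_on_subset[OF Suc.prems]) auto
  note IH = Suc.IH[OF this]
  have cross: "?f (Suc d) j + ?f j (Suc d) =
      int (\<mu> (Suc d)) + int (\<mu> j) - max 0 (int (\<mu> (Suc d)) - int (\<mu> j) - 1)" if "j \<in> {1..d}" for j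
    using mono[OF that] by simp
  have "(\<Sum>i=1..Suc d. \<Sum>j=1..Suc d. ?f i j) =
      (\<Sum>i=1..d. \<Sum>j=1..d. ?f i j) + (\<Sum>j=1..d. ?f (Suc d) j + ?f j (Suc d)) + int (\<mu> (Suc d))"
    by (simp add: sum.distrib)
  also have "(\<Sum>j=1..d. ?f (Suc d) j + ?f j (Suc d)) = int d * int (\<mu> (Suc d)) + int (\<Sum>i=1..d. \<mu> i) -
      (\<Sum>j=1..d. max 0 (int (\<mu> (Suc d)) - int (\<mu> j) - 1))"
    by (subst sum.cong[OF refl cross]) (simp_all add: sum.distrib sum_subtractf)
  also have "(\<Sum>j=1..d. max 0 (int (\<mu> (Suc d)) - int (\<mu> j) - 1)) =
      (\<Sum>j\<in>{1..<Suc d}. max 0 (int (\<mu> (Suc d)) - int (\<mu> j) - 1))"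
    by (simp add: atLeastLessThanSuc_atLeastAtMost)
  finally show ?case unfolding IH by (simp add: algebra_simps)
qed simp

section \<open>The parameter space of Popov matrices and common factors\<close>

locale mu_stratum =
  fixes n d :: nat and \<mu> :: "nat \<Rightarrow> nat"
  assumes parts: "partition_parts d \<mu>" and size_le: "partition_size d \<mu> \<le> n" and d_pos: "1 \<le> d"
begin

text \<open>The coordinates of the parameter space: \<open>(i, j, k)\<close> with \<open>j \<ge> 1\<close> stands for the coefficient of
  \<open>s\<^sup>k\<close> in row \<open>i\<close> of column \<open>j\<close> of a Popov matrix, and \<open>(0, 0, k)\<close> for the one of the common factor
  \<open>g\<close>.\<close>

definition column_support :: "nat \<Rightarrow> nat \<Rightarrow> nat set" where
  "column_support j i = {k. k \<le> \<mu> j \<and> (i \<noteq> 0 \<longrightarrow> k < \<mu> i)}"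

definition column_index :: "(nat \<times> nat \<times> nat) set" where
  "column_index = {(i, j, k). i \<le> d \<and> j \<in> {1..d} \<and> k \<in> column_support j i}"

definition factor_degree :: nat where
  "factor_degree = n - partition_size d \<mu>"

definition parameter_index :: "(nat \<times> nat \<times> nat) set" where
  "parameter_index = (\<lambda>k. (0, 0, k)) ` {..factor_degree} \<union> column_index"

definition columns :: "(nat \<times> nat \<times> nat \<Rightarrow> 'k) \<Rightarrow> nat \<Rightarrow> nat \<Rightarrow> 'k::field poly" where
  "columns w j i = (\<Sum>k\<in>column_support j i. monom (w (i, j, k)) k) + (if i = j then monom 1 (\<mu> j) else 0)"

definition factor :: "(nat \<times> nat \<times> nat \<Rightarrow> 'k) \<Rightarrow> 'k::field poly" where
  "factor w = (\<Sum>k\<le>factor_degree. monom (w (0, 0, k)) k)"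

definition parametrisation :: "(nat \<times> nat \<times> nat \<Rightarrow> 'k) \<Rightarrow> nat \<Rightarrow> 'k::field poly poly" where
  "parametrisation w = tuple_of n d (\<lambda>i. factor w * minor d (columns w) i)"

text \<open>Row \<open>0\<close> is cut off at degree \<open>n\<close>: every \<open>\<mu> j\<close>
  is at most \<open>n\<close>, so \<open>below_syzygy_zero\<close> with \<open>E = n\<close> extends
  the absence of such syzygies to all degrees once a Popov basis of syzygies is present.\<close>

definition below_index :: "(nat \<times> nat) set" where
  "below_index = {(i, k). i \<le> d \<and> k \<le> n \<and> (i \<noteq> 0 \<longrightarrow> k < \<mu> i)}"

definition vector_index :: "nat \<Rightarrow> (nat \<times> nat) set" where
  "vector_index j = {(i, k). i \<le> d \<and> k \<le> \<mu> j \<and> (i = 0 \<or> k < \<mu> i \<or> i = j \<and> k = \<mu> j)}"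

definition non_generic :: "(nat \<Rightarrow> nat \<Rightarrow> 'k::field) \<Rightarrow> (nat \<Rightarrow> 'k poly poly) set" where
  "non_generic T = {a \<in> tuples n d. \<exists>x. (\<exists>i\<le>d. x i \<noteq> 0) \<and> syzygy d (act d (\<lambda>i l. T l i) (dehom a)) x \<and>
     below d \<mu> x \<and> (\<forall>i\<le>d. degree (x i) \<le> n)}"

definition has_vector :: "(nat \<Rightarrow> nat \<Rightarrow> 'k::field) \<Rightarrow> nat \<Rightarrow> (nat \<Rightarrow> 'k poly poly) set" where
  "has_vector T j = {a \<in> tuples n d. \<exists>x. (\<exists>i\<le>d. x i \<noteq> 0) \<and> syzygy d (act d (\<lambda>i l. T l i) (dehom a)) x \<and>
     popov_vector d \<mu> j x}"

lemma finite_column_support: "finite (column_support j i)"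
  by (rule finite_subset[of _ "{..\<mu> j}"]) (auto simp: column_support_def)

lemma below_index_iff:
  "below d \<mu> x \<and> (\<forall>i\<le>d. degree (x i) \<le> n) \<longleftrightarrow> (\<forall>i\<le>d. \<forall>k. (i, k) \<notin> below_index \<longrightarrow> coeff (x i) k = 0)"
proof
  assume x: "below d \<mu> x \<and> (\<forall>i\<le>d. degree (x i) \<le> n)"
  show "\<forall>i\<le>d. \<forall>k. (i, k) \<notin> below_index \<longrightarrow> coeff (x i) k = 0"
  proof (intro allI impI)
    fix i k assume i: "i \<le> d" and k: "(i, k) \<notin> below_index"
    show "coeff (x i) k = 0"
    proof (cases "k \<le> n")
      case True
      with i k have "i \<in> {1..d}" "\<mu> i \<le> k" by (auto simp: below_index_def)
      with x show ?thesis by (simp add: below_def)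
    next
      case False
      with x i have "degree (x i) < k" by (meson le_less_trans not_le)
      then show ?thesis by (rule coeff_eq_0)
    qed
  qed
next
  assume *: "\<forall>i\<le>d. \<forall>k. (i, k) \<notin> below_index \<longrightarrow> coeff (x i) k = 0"
  then show "below d \<mu> x \<and> (\<forall>i\<le>d. degree (x i) \<le> n)"
    by (auto simp: below_def below_index_def intro!: degree_le)
qed

lemma vector_index_iff:
  assumes "j \<in> {1..d}"
  shows "popov_vector d \<mu> j x \<longleftrightarrow> (\<forall>i\<le>d. \<forall>k. (i, k) \<notin> vector_index j \<longrightarrow> coeff (x i) k = 0)"
proof
  assume x: "popov_vector d \<mu> j x"
  show "\<forall>i\<le>d. \<forall>k. (i, k) \<notin> vector_index j \<longrightarrow> coeff (x i) k = 0"
  proof (intro allI impI)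
    fix i k assume i: "i \<le> d" and k: "(i, k) \<notin> vector_index j"
    show "coeff (x i) k = 0"
    proof (cases "k \<le> \<mu> j")
      case True
      with i k have "i \<in> {1..d}" "\<mu> i \<le> k" "\<not> (i = j \<and> k = \<mu> j)" by (auto simp: vector_index_def)
      with x show ?thesis unfolding popov_vector_def by blast
    next
      case False
      with x i have "degree (x i) < k" unfolding popov_vector_def by (meson le_less_trans not_le)
      then show ?thesis by (rule coeff_eq_0)
    qed
  qed
next
  assume x: "\<forall>i\<le>d. \<forall>k. (i, k) \<notin> vector_index j \<longrightarrow> coeff (x i) k = 0"
  have "degree (x i) \<le> \<mu> j" if "i \<le> d" for i
    by (rule degree_le) (use x that in \<open>simp add: vector_index_def\<close>)
  moreover have "i = j \<and> k = \<mu> j \<or> coeff (x i) k = 0" if "i \<in> {1..d}" "\<mu> i \<le> k" for i k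
  proof (cases "i = j \<and> k = \<mu> j")
    case False
    then have "(i, k) \<notin> vector_index j" using that by (auto simp: vector_index_def)
    with x that(1) show ?thesis by simp
  qed simp
  ultimately show "popov_vector d \<mu> j x" unfolding popov_vector_def by blast
qed

lemma index_finite:
  "finite below_index" "below_index \<subseteq> {..d} \<times> UNIV"
  "finite (vector_index j)" "vector_index j \<subseteq> {..d} \<times> UNIV"
proof -
  show "finite below_index"
    by (rule finite_subset[of _ "{..d} \<times> {..n}"]) (auto simp: below_index_def)
  show "finite (vector_index j)"
    by (rule finite_subset[of _ "{..d} \<times> {..\<mu> j}"]) (auto simp: vector_index_def)
qed (auto simp: below_index_def vector_index_def)

lemma closedin_non_generic:
  "closedin (zariski n d) (non_generic (T :: nat \<Rightarrow> nat \<Rightarrow> 'k::field))"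
  using closedin_has_syzygy[OF index_finite(1,2), where n = n and T = "\<lambda>i l. T l i" and \<kappa> = "\<lambda>_. 0"]
  by (simp add: non_generic_def below_index_iff)

lemma closedin_has_vector:
  "j \<in> {1..d} \<Longrightarrow> closedin (zariski n d) (has_vector (T :: nat \<Rightarrow> nat \<Rightarrow> 'k::field) j)"
  using closedin_has_syzygy[OF index_finite(3,4), where n = n and T = "\<lambda>i l. T l i" and \<kappa> = "\<lambda>_. 0" and j1 = j]
  by (simp add: has_vector_def vector_index_iff)

lemma coeff_columns:
  "coeff (columns w j i) k = (if k \<in> column_support j i then w (i, j, k) else 0) +
    (if i = j \<and> k = \<mu> j then 1 else 0)"
  unfolding columns_def using finite_column_support[of j i] by (auto simp: coeff_sum sum.delta')

lemma popov_columns: "popov d \<mu> (columns w)"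
  unfolding popov_def
  by (auto simp: coeff_columns column_support_def intro!: degree_le)

lemma coeff_factor: "coeff (factor w) k = (if k \<le> factor_degree then w (0, 0, k) else 0)"
  unfolding factor_def by (simp add: coeff_sum sum.delta')

lemma degree_factor: "degree (factor w) \<le> factor_degree"
  by (rule degree_le) (simp add: coeff_factor)

lemma degree_minor_columns: "degree (minor d (columns w) i) \<le> partition_size d \<mu>"
  unfolding partition_size_def by (rule degree_minor) (rule popov_degree[OF popov_columns])

lemma minor_cong:
  assumes "\<And>i j. i \<le> d \<Longrightarrow> j \<in> {1..d} \<Longrightarrow> \<sigma> j i = \<tau> j i"
  shows "minor d \<sigma> = minor d \<tau>"
  unfolding minor_def by (intro ext arg_cong[where f = det] matrix_of_cong) (simp add: minor_matrix_def assms)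

definition coefficients_polynomial :: "('a \<Rightarrow> 'k poly) \<Rightarrow> ('a \<Rightarrow> 'k::comm_ring_1) set \<Rightarrow> bool" where
  "coefficients_polynomial F C \<longleftrightarrow> (\<forall>k. (\<lambda>w. coeff (F w) k) \<in> polynomial_functions C)"

lemma coefficients_polynomial_const: "coefficients_polynomial (\<lambda>_. p) C"
  by (simp add: coefficients_polynomial_def polynomial_functions.const)

lemma coefficients_polynomial_mult:
  "coefficients_polynomial F C \<Longrightarrow> coefficients_polynomial G C \<Longrightarrow> coefficients_polynomial (\<lambda>w. F w * G w) C"
  unfolding coefficients_polynomial_def coeff_mult
  by (intro allI polynomial_functions_sum polynomial_functions.mult) auto

lemma coefficients_polynomial_sum:
  "(\<And>i. i \<in> A \<Longrightarrow> coefficients_polynomial (F i) C) \<Longrightarrow> coefficients_polynomial (\<lambda>w. \<Sum>i\<in>A. F i w) C"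
  unfolding coefficients_polynomial_def coeff_sum
  by (intro allI polynomial_functions_sum) auto

lemma coefficients_polynomial_prod:
  "(\<And>i. i \<in> A \<Longrightarrow> coefficients_polynomial (F i) C) \<Longrightarrow> coefficients_polynomial (\<lambda>w. \<Prod>i\<in>A. F i w) C"
  by (induction A rule: infinite_finite_induct)
     (auto intro: coefficients_polynomial_const coefficients_polynomial_mult)

lemma coefficients_polynomial_minor:
  assumes "\<And>i j. i \<le> d \<Longrightarrow> j \<in> {1..d} \<Longrightarrow> coefficients_polynomial (\<lambda>w. F w j i) C"
  shows "coefficients_polynomial (\<lambda>w. minor d (F w) i) C"
  unfolding minor_def det_matrix_of
proof (intro coefficients_polynomial_sum coefficients_polynomial_mult coefficients_polynomial_const
    coefficients_polynomial_prod)
  fix p l assume "p \<in> {p. p permutes {0..<Suc d}}" "l \<in> {..<Suc d}"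
  then have p: "p permutes {0..<Suc d}" and l: "l < Suc d" by auto
  have "l \<le> d" "p l \<le> d" using permutes_in_image[OF p, of l] l by auto
  then show "coefficients_polynomial (\<lambda>w. minor_matrix (F w) (\<lambda>l. if l = i then 1 else 0) l (p l)) C"
    using assms[of l "p l"] by (cases "p l = 0") (auto simp: minor_matrix_def coefficients_polynomial_const)
qed

lemma parametrisation_polynomial:
  assumes "f \<in> coordinates n d"
  shows "(\<lambda>w :: nat \<times> nat \<times> nat \<Rightarrow> 'k::field. f (parametrisation w)) \<in>
    polynomial_functions (coordinate_functions parameter_index)"
proof -
  let ?C = "coordinate_functions parameter_index :: ((nat \<times> nat \<times> nat \<Rightarrow> 'k) \<Rightarrow> 'k) set"
  obtain i j where ij: "i \<le> d" "j \<le> n" "f = (\<lambda>a. coeff (coeff (a i) j) (n - j))"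
    using assms by (auto simp: coordinates_def)
  have coord: "(\<lambda>w. w q) \<in> polynomial_functions ?C" if "q \<in> parameter_index" for q
    by (rule polynomial_functions.coordinate) (use that in \<open>auto simp: coordinate_functions_def\<close>)
  have factor: "coefficients_polynomial factor ?C"
    unfolding coefficients_polynomial_def coeff_factor
  proof
    fix k
    show "(\<lambda>w. if k \<le> factor_degree then w (0, 0, k) else 0) \<in> polynomial_functions ?C"
    proof (cases "k \<le> factor_degree")
      case True
      then have "(0, 0, k) \<in> parameter_index" by (simp add: parameter_index_def)
      with True show ?thesis by (simp add: coord)
    qed (simp add: polynomial_functions.const)
  qed
  have columns: "coefficients_polynomial (\<lambda>w. columns w j i) ?C" if "i \<le> d" "j \<in> {1..d}" for i j
    unfolding coefficients_polynomial_def coeff_columns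
  proof
    fix k
    have "(\<lambda>w. if k \<in> column_support j i then w (i, j, k) else 0) \<in> polynomial_functions ?C"
    proof (cases "k \<in> column_support j i")
      case True
      then have "(i, j, k) \<in> parameter_index" using that by (simp add: parameter_index_def column_index_def)
      with True show ?thesis by (simp add: coord)
    qed (simp add: polynomial_functions.const)
    then show "(\<lambda>w. (if k \<in> column_support j i then w (i, j, k) else 0) + (if i = j \<and> k = \<mu> j then 1 else 0))
        \<in> polynomial_functions ?C"
      by (rule polynomial_functions.add) (rule polynomial_functions.const)
  qed
  have "coefficients_polynomial (\<lambda>w. factor w * minor d (columns w) i) ?C"
    by (rule coefficients_polynomial_mult[OF factor coefficients_polynomial_minor]) (rule columns)
  then have "(\<lambda>w. coeff (factor w * minor d (columns w) i) (n - j)) \<in> polynomial_functions ?C"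
    by (simp only: coefficients_polynomial_def)
  moreover have "(\<lambda>w. f (parametrisation w)) = (\<lambda>w. coeff (factor w * minor d (columns w) i) (n - j))"
    unfolding ij(3) parametrisation_def coeff_tuple_of[OF ij(1,2)] ..
  ultimately show ?thesis by (simp only:)
qed

lemma \<mu>_le: "j \<in> {1..d} \<Longrightarrow> \<mu> j \<le> n"
proof -
  assume "j \<in> {1..d}"
  then have "\<mu> j \<le> partition_size d \<mu>" unfolding partition_size_def by (intro member_le_sum) auto
  then show "\<mu> j \<le> n" using size_le by simp
qed

lemma degree_factor_minor: "degree (factor w * minor d (columns w) i) \<le> n"
proof -
  have "degree (factor w * minor d (columns w) i) \<le> factor_degree + partition_size d \<mu>"
    by (rule order_trans[OF degree_mult_le add_mono[OF degree_factor degree_minor_columns]])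
  then show ?thesis using size_le by (simp add: factor_degree_def)
qed

lemma dehom_parametrisation: "i \<le> d \<Longrightarrow> dehom (parametrisation w) i = factor w * minor d (columns w) i"
  unfolding parametrisation_def
  by (rule dehom_tuple_of[where b = "\<lambda>i. factor w * minor d (columns w) i"]) (simp_all add: degree_factor_minor)

lemma parametrisation_tuples: "parametrisation w \<in> tuples n d"
  unfolding parametrisation_def by (rule tuple_of_tuples)

lemma syzygy_columns:
  assumes "j \<in> {1..d}"
  shows "syzygy d (dehom (parametrisation w)) (columns w j)"
proof -
  have "(\<Sum>i\<le>d. columns w j i * dehom (parametrisation w) i) =
      factor w * (\<Sum>i\<le>d. columns w j i * minor d (columns w) i)"
    unfolding sum_distrib_left by (intro sum.cong refl) (simp add: dehom_parametrisation)
  then show ?thesis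
    using syzygy_minor[OF assms, of "columns w"] by (simp add: syzygy_def)
qed

section \<open>Linear changes of the entries\<close>

definition transform :: "(nat \<Rightarrow> nat \<Rightarrow> 'k::field) \<Rightarrow> (nat \<Rightarrow> 'k poly poly) \<Rightarrow> nat \<Rightarrow> 'k poly poly" where
  "transform T a = tuple_of n d (act d (\<lambda>i l. T l i) (dehom a))"

definition identity :: "nat \<Rightarrow> nat \<Rightarrow> 'k::field" where
  "identity = (\<lambda>i j. if i = j then 1 else 0)"

lemma act_identity: "i \<le> d \<Longrightarrow> act d (\<lambda>i l. identity l i) b i = b i"
proof -
  assume "i \<le> d"
  have "act d (\<lambda>i l. identity l i) b i = (\<Sum>l\<le>d. if l = i then b l else 0)"
    unfolding act_def identity_def by (intro sum.cong refl) simp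
  with \<open>i \<le> d\<close> show ?thesis by simp
qed

lemma inverse_identity: "inverse_matrices d identity identity"
  by (auto simp: inverse_matrices_def identity_def if_distrib[of "\<lambda>z. z * _"] cong: if_cong)

lemma dehom_transform:
  assumes "a \<in> tuples n d" "i \<le> d"
  shows "dehom (transform T a) i = act d (\<lambda>i l. T l i) (dehom a) i"
  unfolding transform_def
  by (rule dehom_tuple_of[OF assms(2) degree_act]) (rule degree_dehom[OF assms(1)])

lemma transform_tuples: "transform T a \<in> tuples n d"
  unfolding transform_def by (rule tuple_of_tuples)

lemma transform_identity: "a \<in> tuples n d \<Longrightarrow> transform identity a = a"
  unfolding transform_def by (rule tuple_of_dehom) (auto simp: act_identity)

lemma syzygy_transform:
  assumes "a \<in> tuples n d"
  shows "syzygy d (dehom (transform T a)) x \<longleftrightarrow> syzygy d (act d (\<lambda>i l. T l i) (dehom a)) x"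
  by (rule syzygy_cong) (simp_all add: dehom_transform[OF assms])

lemma mu_basis_transform:
  assumes "a \<in> tuples n d" "inverse_matrices d T T'"
  shows "(\<exists>\<sigma>. mu_basis d \<mu> (dehom (transform T a)) \<sigma>) \<longleftrightarrow> (\<exists>\<sigma>. mu_basis d \<mu> (dehom a) \<sigma>)"
proof -
  have "mu_basis d \<mu> (dehom (transform T a)) \<sigma> \<longleftrightarrow> mu_basis d \<mu> (act d (\<lambda>i l. T l i) (dehom a)) \<sigma>" for \<sigma>
    by (rule mu_basis_cong) (rule dehom_transform[OF assms(1)])
  then show ?thesis using mu_basis_act_iff[OF assms(2)] by simp
qed

lemma non_generic_transform:
  assumes "a \<in> tuples n d"
  shows "transform T a \<in> non_generic identity \<longleftrightarrow> a \<in> non_generic T"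
proof -
  have "syzygy d (act d (\<lambda>i l. identity l i) (dehom (transform T a))) x \<longleftrightarrow>
      syzygy d (act d (\<lambda>i l. T l i) (dehom a)) x" for x
    unfolding syzygy_transform[OF assms, symmetric]
    by (rule syzygy_cong) (simp_all add: act_identity)
  with assms show ?thesis unfolding non_generic_def by (simp add: transform_tuples)
qed

lemma has_vector_transform:
  assumes "a \<in> tuples n d"
  shows "transform T a \<in> has_vector identity j \<longleftrightarrow> a \<in> has_vector T j"
proof -
  have "syzygy d (act d (\<lambda>i l. identity l i) (dehom (transform T a))) x \<longleftrightarrow>
      syzygy d (act d (\<lambda>i l. T l i) (dehom a)) x" for x
    unfolding syzygy_transform[OF assms, symmetric]
    by (rule syzygy_cong) (simp_all add: act_identity)
  with assms show ?thesis unfolding has_vector_def by (simp add: transform_tuples)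
qed

lemma non_generic_identity:
  "a \<in> non_generic identity \<longleftrightarrow> a \<in> tuples n d \<and> (\<exists>x. (\<exists>i\<le>d. x i \<noteq> 0) \<and> syzygy d (dehom a) x \<and>
     below d \<mu> x \<and> (\<forall>i\<le>d. degree (x i) \<le> n))"
proof -
  have "syzygy d (act d (\<lambda>i l. identity l i) (dehom a)) x \<longleftrightarrow> syzygy d (dehom a) x" for x
    by (rule syzygy_cong) (simp_all add: act_identity)
  then show ?thesis by (simp add: non_generic_def)
qed

lemma has_vector_identity:
  "a \<in> has_vector identity j \<longleftrightarrow> a \<in> tuples n d \<and> (\<exists>x. (\<exists>i\<le>d. x i \<noteq> 0) \<and> syzygy d (dehom a) x \<and>
     popov_vector d \<mu> j x)"
proof -
  have "syzygy d (act d (\<lambda>i l. identity l i) (dehom a)) x \<longleftrightarrow> syzygy d (dehom a) x" for x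
    by (rule syzygy_cong) (simp_all add: act_identity)
  then show ?thesis by (simp add: has_vector_def)
qed

lemma generic_no_below:
  assumes "a \<in> tuples n d" "a \<notin> non_generic identity"
    "popov d \<mu> \<sigma>" "\<And>j. j \<in> {1..d} \<Longrightarrow> syzygy d (dehom a) (\<sigma> j)"
    "syzygy d (dehom a) x" "below d \<mu> x" "i \<le> d"
  shows "x i = 0"
proof (rule below_syzygy_zero[OF assms(3,4) \<mu>_le _ assms(5-7)])
  fix y l assume "syzygy d (dehom a) y" "below d \<mu> y" "\<And>i. i \<le> d \<Longrightarrow> degree (y i) \<le> n" "l \<le> d"
  with assms(1,2) show "y l = 0" unfolding non_generic_identity by blast
qed

lemma mu_basis_of_generic:
  assumes a: "a \<in> tuples n d" "a \<notin> non_generic identity" and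
    \<sigma>: "popov d \<mu> \<sigma>" "\<And>j. j \<in> {1..d} \<Longrightarrow> syzygy d (dehom a) (\<sigma> j)"
  shows "mu_basis d \<mu> (dehom a) \<sigma>"
proof (rule mu_basis_of_popov[OF \<sigma>(1)])
  show "syzygy d (dehom a) (\<sigma> j)" if "j \<in> {1..d}" for j by (rule \<sigma>(2)[OF that])
  show "x i = 0" if "syzygy d (dehom a) x" "below d \<mu> x" "i \<le> d" for x i
    using generic_no_below[OF a \<sigma>(1) _ that] \<sigma>(2) by blast
qed

lemma generic_popov:
  assumes a: "a \<in> tuples n d" "a \<notin> non_generic identity" and
    vec: "\<And>j. j \<in> {1..d} \<Longrightarrow> a \<in> has_vector identity j"
  obtains \<sigma> where "popov d \<mu> \<sigma>" "\<And>j. j \<in> {1..d} \<Longrightarrow> syzygy d (dehom a) (\<sigma> j)"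
proof (rule exists_popov[of d "dehom a" \<mu>])
  fix j assume "j \<in> {1..d}"
  with vec show "\<exists>x. (\<exists>i\<le>d. x i \<noteq> 0) \<and> syzygy d (dehom a) x \<and> popov_vector d \<mu> j x"
    unfolding has_vector_identity by blast
next
  fix x i j assume x: "j \<in> {1..d}" "syzygy d (dehom a) x" "below d \<mu> x"
    "\<And>i. i \<le> d \<Longrightarrow> degree (x i) \<le> \<mu> j" "i \<le> d"
  have "\<forall>i\<le>d. degree (x i) \<le> n" using x(4) \<mu>_le[OF x(1)] order_trans by blast
  with a x(2,3,5) show "x i = 0" unfolding non_generic_identity by blast
qed (rule that)

lemma mu_basis_has_vector:
  assumes "a \<in> tuples n d" "mu_basis d \<mu> (dehom a) \<sigma>" "j \<in> {1..d}"
  shows "a \<in> has_vector identity j"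
  using exists_popov_vector[OF assms(2,3)] assms(1) unfolding has_vector_identity by blast

section \<open>Generic members of the stratum as values of the parametrisation\<close>

definition parameter_domain :: "(nat \<times> nat \<times> nat \<Rightarrow> 'k::field) set" where
  "parameter_domain = {w. parametrisation w \<notin> non_generic identity}"

text \<open>The tuple is \<open>g\<close> times the minors of its Popov basis. Minor
  \<open>0\<close> has coefficient \<open>1\<close> at \<open>s ^ |\<mu>|\<close>, so
  \<open>g\<close> has degree at most \<open>n - |\<mu>|\<close> and fits into the coordinates
  reserved for the factor.\<close>

lemma parametrisation_surjective:
  fixes a :: "nat \<Rightarrow> 'k::field poly poly"
  assumes a: "a \<in> tuples n d" "a \<notin> non_generic identity" and
    \<sigma>: "popov d \<mu> \<sigma>" "\<And>j. j \<in> {1..d} \<Longrightarrow> syzygy d (dehom a) (\<sigma> j)"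
  shows "\<exists>w\<in>parameter_domain. parametrisation w = a"
proof -
  have "\<exists>i\<le>d. dehom a i \<noteq> 0"
  proof (rule ccontr)
    assume "\<not> ?thesis"
    then have "syzygy d (dehom a) (\<lambda>i. if i = 0 then 1 else 0)" by (simp add: syzygy_def)
    moreover have "below d \<mu> (\<lambda>i. if i = 0 then 1 else 0 :: 'k poly)" by (simp add: below_def)
    ultimately show False
      using generic_no_below[OF a \<sigma>, of "\<lambda>i. if i = 0 then 1 else 0" 0] by simp
  qed
  then obtain g where g: "\<And>i. i \<le> d \<Longrightarrow> dehom a i = g * minor d \<sigma> i"
    using mu_basis_minors[OF mu_basis_of_generic[OF a \<sigma>]] by blast
  define w where "w = (\<lambda>(i, j, k). if j = 0 then coeff g k else coeff (\<sigma> j i) k)"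
  have "columns w j i = \<sigma> j i" if ij: "i \<le> d" "j \<in> {1..d}" for i j
  proof (rule poly_eqI)
    fix k
    have "j \<noteq> 0" using ij by simp
    show "coeff (columns w j i) k = coeff (\<sigma> j i) k"
    proof (cases "k \<in> column_support j i")
      case True
      then have "\<not> (i = j \<and> k = \<mu> j)" using \<open>j \<noteq> 0\<close> by (auto simp: column_support_def)
      with True \<open>j \<noteq> 0\<close> show ?thesis by (simp add: coeff_columns w_def)
    next
      case False
      show ?thesis
      proof (cases "i \<noteq> 0 \<and> \<mu> i \<le> k")
        case True
        with ij have "coeff (\<sigma> j i) k = (if i = j \<and> k = \<mu> j then 1 else 0)"
          by (intro popov_coeff[OF \<sigma>(1)]) auto
        with False show ?thesis by (simp add: coeff_columns)
      next
        case False
        with \<open>k \<notin> _\<close> have k: "\<mu> j < k" by (auto simp: column_support_def)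
        then have "coeff (\<sigma> j i) k = 0"
          using popov_degree[OF \<sigma>(1) ij(2,1)] by (intro coeff_eq_0) simp
        with k \<open>k \<notin> _\<close> show ?thesis by (simp add: coeff_columns)
      qed
    qed
  qed
  then have minors: "minor d (columns w) = minor d \<sigma>" by (rule minor_cong)
  have "coeff (minor d \<sigma> 0) (partition_size d \<mu>) = 1"
    unfolding partition_size_def by (rule coeff_minor_popov[OF \<sigma>(1)])
  then have m0: "partition_size d \<mu> \<le> degree (minor d \<sigma> 0)" "minor d \<sigma> 0 \<noteq> 0"
    by (auto intro: le_degree)
  have "degree g \<le> factor_degree"
  proof (cases "g = 0")
    case False
    then have "degree g + degree (minor d \<sigma> 0) \<le> n"
      using degree_dehom[OF a(1), of 0] m0(2) by (simp add: g degree_mult_eq)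
    with m0(1) show ?thesis by (simp add: factor_degree_def)
  qed simp
  then have "factor w = g"
    by (intro poly_eqI) (auto simp: coeff_factor w_def coeff_eq_0)
  then have "parametrisation w = a"
    unfolding parametrisation_def minors by (intro tuple_of_dehom[OF a(1)]) (simp add: g)
  with a(2) show ?thesis unfolding parameter_domain_def by blast
qed

lemma parametrisation_stratum:
  assumes "w \<in> parameter_domain"
  shows "parametrisation w \<in> stratum n d \<mu>"
  using mu_basis_of_generic[OF parametrisation_tuples _ popov_columns syzygy_columns] assms
    stratum_iff_mu_basis[OF parametrisation_tuples parts]
  unfolding parameter_domain_def by blast

section \<open>Local closedness and density of the generic members\<close>

lemma stratum_generic_transform:
  assumes "a \<in> stratum n d \<mu>"
  obtains T T' where "inverse_matrices d T T'" "a \<notin> non_generic T"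
proof -
  have a: "a \<in> tuples n d" using assms by (simp add: stratum_def CP_def)
  then obtain \<sigma> where \<sigma>: "mu_basis d \<mu> (dehom a) \<sigma>"
    using assms stratum_iff_mu_basis[OF a parts] by blast
  obtain T T' where T:
    "\<And>i j. i \<le> d \<Longrightarrow> j \<le> d \<Longrightarrow> (\<Sum>l\<le>d. T i l * T' l j) = (if i = j then 1 else 0)"
    "\<And>i j. i \<le> d \<Longrightarrow> j \<le> d \<Longrightarrow> (\<Sum>l\<le>d. T' i l * T l j) = (if i = j then 1 else 0)"
    and zero: "\<And>x i. syzygy d (act d (\<lambda>i l. T l i) (dehom a)) x \<Longrightarrow> below d \<mu> x \<Longrightarrow> i \<le> d \<Longrightarrow> x i = 0"
    by (rule exists_generic_transform[OF \<sigma>]) (rule that)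
  show thesis
  proof (rule that)
    show "inverse_matrices d T T'" using T by (simp add: inverse_matrices_def)
    show "a \<notin> non_generic T" using zero unfolding non_generic_def by blast
  qed
qed

text \<open>Popov vectors exist after every linear change, a closed condition that may be imposed
  for all \<open>T\<close>; genericity is open and holds for some \<open>T\<close>. Conversely, the
  \<open>T\<close> witnessing genericity also has all its Popov vectors, and the two together
  produce a Popov basis of the changed tuple.\<close>

lemma stratum_eq:
  "stratum n d \<mu> =
    (\<Inter>(T, j)\<in>{T. \<exists>T'. inverse_matrices d T T'} \<times> {1..d}. has_vector T j) \<inter>
    (\<Union>T\<in>{T. \<exists>T'. inverse_matrices d T T'}. tuples n d - non_generic T)"
proof (intro equalityI subsetI)
  fix a assume a: "a \<in> stratum n d \<mu>"
  then have tup: "a \<in> tuples n d" by (simp add: stratum_def CP_def)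
  obtain \<sigma> where \<sigma>: "mu_basis d \<mu> (dehom a) \<sigma>" using a stratum_iff_mu_basis[OF tup parts] by blast
  have "a \<in> has_vector T j" if T: "inverse_matrices d T T'" and j: "j \<in> {1..d}" for T T' j
  proof -
    obtain \<tau> where "mu_basis d \<mu> (dehom (transform T a)) \<tau>"
      using mu_basis_transform[OF tup T] \<sigma> by blast
    from mu_basis_has_vector[OF transform_tuples this j]
    show ?thesis by (simp add: has_vector_transform[OF tup])
  qed
  moreover obtain T T' where "inverse_matrices d T T'" "a \<notin> non_generic T"
    by (rule stratum_generic_transform[OF a])
  ultimately show "a \<in> (\<Inter>(T, j)\<in>{T. \<exists>T'. inverse_matrices d T T'} \<times> {1..d}. has_vector T j) \<inter>
    (\<Union>T\<in>{T. \<exists>T'. inverse_matrices d T T'}. tuples n d - non_generic T)"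
    using tup by blast
next
  fix a assume "a \<in> (\<Inter>(T, j)\<in>{T. \<exists>T'. inverse_matrices d T T'} \<times> {1..d}. has_vector T j) \<inter>
    (\<Union>T\<in>{T. \<exists>T'. inverse_matrices d T T'}. tuples n d - non_generic T)"
  then obtain T T' where T: "inverse_matrices d T T'" "a \<in> tuples n d" "a \<notin> non_generic T"
    and vec: "\<And>j. j \<in> {1..d} \<Longrightarrow> a \<in> has_vector T j" by blast
  have "transform T a \<notin> non_generic identity" "\<And>j. j \<in> {1..d} \<Longrightarrow> transform T a \<in> has_vector identity j"
    using T(3) vec by (simp_all add: non_generic_transform[OF T(2)] has_vector_transform[OF T(2)])
  then obtain \<sigma> where "popov d \<mu> \<sigma>" "\<And>j. j \<in> {1..d} \<Longrightarrow> syzygy d (dehom (transform T a)) (\<sigma> j)"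
    using generic_popov[OF transform_tuples, of T a] by blast
  then have "mu_basis d \<mu> (dehom (transform T a)) \<sigma>"
    using mu_basis_of_generic[OF transform_tuples \<open>transform T a \<notin> _\<close>] by blast
  then show "a \<in> stratum n d \<mu>"
    using mu_basis_transform[OF T(2,1)] stratum_iff_mu_basis[OF T(2) parts] by blast
qed

lemma stratum_locally_closed:
  fixes P :: "(nat \<Rightarrow> 'k::field poly poly) set"
  assumes P: "P = stratum n d \<mu>"
  shows "\<exists>V. closedin (zariski n d) V \<and> openin (subtopology (zariski n d) V) P"
proof (intro exI conjI)
  let ?G = "{T :: nat \<Rightarrow> nat \<Rightarrow> 'k. \<exists>T'. inverse_matrices d T T'}"
  let ?V = "\<Inter>(T, j)\<in>?G \<times> {1..d}. has_vector T j"
  have "(identity, 1) \<in> ?G \<times> {1..d}" using inverse_identity d_pos by auto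
  then show "closedin (zariski n d) ?V"
    by (intro closedin_Inter) (auto intro: closedin_has_vector)
  have "openin (zariski n d) (\<Union>T\<in>?G. tuples n d - non_generic T)"
  proof (intro openin_Union ballI)
    fix U assume "U \<in> (\<lambda>T. tuples n d - non_generic T) ` ?G"
    then obtain T :: "nat \<Rightarrow> nat \<Rightarrow> 'k" where "U = tuples n d - non_generic T" by blast
    then show "openin (zariski n d) U"
      using openin_diff[OF openin_topspace closedin_non_generic[of T]] by (simp add: zariski_def)
  qed
  then show "openin (subtopology (zariski n d) ?V) P"
    unfolding P stratum_eq by (subst Int_commute) (rule openin_subtopology_Int)
qed

text \<open>A tuple in the stratum is joined by the line \<open>(1 - \<tau>) 1 + \<tau> T\<close> of linear transformations to
  a generic one; all but finitely many points of this line are generic members of the stratum.\<close>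

lemma parametrisation_dense:
  fixes f :: "(nat \<Rightarrow> 'k::field poly poly) \<Rightarrow> 'k"
  assumes inf: "infinite (UNIV :: 'k set)" and f: "f \<in> polynomial_functions (coordinates n d)"
    and zero: "\<And>w. w \<in> parameter_domain \<Longrightarrow> f (parametrisation w) = 0" and a: "a \<in> stratum n d \<mu>"
  shows "f a = 0"
proof -
  have tup: "a \<in> tuples n d" using a by (simp add: stratum_def CP_def)
  obtain T T' where T: "inverse_matrices d T T'" "a \<notin> non_generic T"
    by (rule stratum_generic_transform[OF a])
  define M where "M = (\<lambda>\<tau> i j. identity i j + \<tau> * (T i j - identity i j))"
  define \<gamma> where "\<gamma> = (\<lambda>\<tau>. transform (M \<tau>) a)"
  have "M 0 = identity" "M 1 = T" by (simp_all add: M_def fun_eq_iff)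
  then have \<gamma>0: "\<gamma> 0 = a" and \<gamma>1: "\<gamma> 1 \<notin> non_generic identity"
    using T(2) by (simp_all add: \<gamma>_def transform_identity[OF tup] non_generic_transform[OF tup])
  obtain F where F: "F \<subseteq> polynomial_functions (coordinates n d)"
    "non_generic (identity :: nat \<Rightarrow> nat \<Rightarrow> 'k) = zero_locus (tuples n d) F"
    using closedin_non_generic[of identity] unfolding zariski_def closedin_zariski by blast
  have "\<gamma> 1 \<in> tuples n d" by (simp add: \<gamma>_def transform_tuples)
  \<comment> \<open>\<open>h\<close> vanishes on all non-generic tuples, so
    \<open>h (\<gamma> \<tau>) \<noteq> 0\<close> certifies genericity along the line.\<close>
  with \<gamma>1 F(2) obtain h where h: "h \<in> F" "h (\<gamma> 1) \<noteq> 0" by (auto simp: zero_locus_def)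
  have curve: "\<exists>p. \<forall>\<tau>. g (\<gamma> \<tau>) = poly p \<tau>" if "g \<in> polynomial_functions (coordinates n d)" for g
    using that
  proof (rule polynomial_functions_curve)
    fix c :: "(nat \<Rightarrow> 'k poly poly) \<Rightarrow> 'k" assume "c \<in> coordinates n d"
    then obtain i j where ij: "i \<le> d" "j \<le> n" "c = (\<lambda>a. coeff (coeff (a i) j) (n - j))"
      by (auto simp: coordinates_def)
    let ?b = "\<lambda>l. coeff (dehom a l) (n - j)"
    let ?p = "\<Sum>l\<le>d. [:identity l i * ?b l, (T l i - identity l i) * ?b l:]"
    have "c (\<gamma> \<tau>) = (\<Sum>l\<le>d. M \<tau> l i * ?b l)" for \<tau>
      unfolding ij(3) \<gamma>_def transform_def coeff_tuple_of[OF ij(1,2)] by (simp add: act_def coeff_sum)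
    also have "(\<Sum>l\<le>d. M \<tau> l i * ?b l) = poly ?p \<tau>" for \<tau>
      unfolding poly_sum by (intro sum.cong refl) (simp add: M_def algebra_simps)
    finally show "\<exists>p. \<forall>\<tau>. c (\<gamma> \<tau>) = poly p \<tau>" by blast
  qed
  have "h \<in> polynomial_functions (coordinates n d)" using h(1) F(1) by blast
  then obtain p\<^sub>f p\<^sub>h where p: "\<And>\<tau>. f (\<gamma> \<tau>) = poly p\<^sub>f \<tau>" "\<And>\<tau>. h (\<gamma> \<tau>) = poly p\<^sub>h \<tau>"
    using curve[OF f] curve by blast
  \<comment> \<open>The determinant keeps track of invertibility: where it is nonzero,
    \<open>\<gamma> \<tau>\<close> stays in the stratum. It equals \<open>1\<close> at
    \<open>\<tau> = 0\<close>, so it is not the zero polynomial.\<close>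
  have "(\<lambda>\<tau>. det (matrix_of (Suc d) (M \<tau>))) \<in> polynomial_functions {\<lambda>\<tau>. \<tau>}"
    unfolding M_def
    by (intro polynomial_functions_det polynomial_functions.add polynomial_functions.mult
        polynomial_functions.const polynomial_functions.coordinate) simp
  then have "\<exists>p. \<forall>\<tau>. det (matrix_of (Suc d) (M \<tau>)) = poly p \<tau>"
  proof (rule polynomial_functions_curve[where \<gamma> = "\<lambda>\<tau>. \<tau>"])
    fix c :: "'k \<Rightarrow> 'k" assume "c \<in> {\<lambda>\<tau>. \<tau>}"
    then have "\<forall>\<tau>. c \<tau> = poly [:0, 1:] \<tau>" by simp
    then show "\<exists>p. \<forall>\<tau>. c \<tau> = poly p \<tau>" ..
  qed
  then obtain p\<^sub>d where p\<^sub>d: "\<And>\<tau>. det (matrix_of (Suc d) (M \<tau>)) = poly p\<^sub>d \<tau>" by blast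
  have "poly (p\<^sub>f * p\<^sub>h * p\<^sub>d) \<tau> = 0" for \<tau>
  proof (cases "h (\<gamma> \<tau>) = 0 \<or> det (matrix_of (Suc d) (M \<tau>)) = 0")
    case True
    then show ?thesis by (auto simp: p p\<^sub>d)
  next
    case False
    obtain N where "\<And>i j. i < Suc d \<Longrightarrow> j < Suc d \<Longrightarrow> (\<Sum>l<Suc d. M \<tau> i l * N l j) = (if i = j then 1 else 0)"
      "\<And>i j. i < Suc d \<Longrightarrow> j < Suc d \<Longrightarrow> (\<Sum>l<Suc d. N i l * M \<tau> l j) = (if i = j then 1 else 0)"
      by (rule exists_inverse_matrix[of "Suc d" "M \<tau>"]) (use False in blast)+
    note N = this[unfolded less_Suc_eq_le lessThan_Suc_atMost]
    have inv: "inverse_matrices d (M \<tau>) N" unfolding inverse_matrices_def using N by simp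
    have tup': "\<gamma> \<tau> \<in> tuples n d" by (simp add: \<gamma>_def transform_tuples)
    have gen: "\<gamma> \<tau> \<notin> non_generic identity" using False h(1) F(2) by (auto simp: zero_locus_def)
    obtain \<sigma> where \<sigma>: "mu_basis d \<mu> (dehom (\<gamma> \<tau>)) \<sigma>"
      using mu_basis_transform[OF tup inv] stratum_iff_mu_basis[OF tup parts] a unfolding \<gamma>_def by blast
    obtain \<sigma>' where "popov d \<mu> \<sigma>'" "\<And>j. j \<in> {1..d} \<Longrightarrow> syzygy d (dehom (\<gamma> \<tau>)) (\<sigma>' j)"
      using generic_popov[OF tup' gen mu_basis_has_vector[OF tup' \<sigma>]] by blast
    with parametrisation_surjective[OF tup' gen] obtain w where
      "w \<in> parameter_domain" "parametrisation w = \<gamma> \<tau>" by blast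
    with zero have "f (\<gamma> \<tau>) = 0" by metis
    then show ?thesis by (simp add: p)
  qed
  then have "p\<^sub>f * p\<^sub>h * p\<^sub>d = 0"
    using inf by (metis (mono_tags, lifting) UNIV_eq_I mem_Collect_eq poly_roots_finite)
  moreover have "p\<^sub>h \<noteq> 0" using h(2) p(2) by auto
  moreover have "p\<^sub>d \<noteq> 0"
  proof -
    have "matrix_of (Suc d) (M 0) = 1\<^sub>m (Suc d)"
      unfolding one_matrix_of \<open>M 0 = identity\<close> identity_def ..
    then have "poly p\<^sub>d 0 = 1" unfolding p\<^sub>d[symmetric] by simp
    then show ?thesis by auto
  qed
  ultimately have "p\<^sub>f = 0" by simp
  with p(1)[of 0] \<gamma>0 show ?thesis by simp
qed

section \<open>A monomial tuple showing that generic members exist\<close>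

definition tail_sum :: "nat \<Rightarrow> nat" where
  "tail_sum i = (\<Sum>j\<in>{i<..d}. \<mu> j)"

lemma tail_sum_step: "i \<in> {1..d} \<Longrightarrow> tail_sum (i - 1) = \<mu> i + tail_sum i"
proof -
  assume "i \<in> {1..d}"
  then have "{i - 1<..d} = insert i {i<..d}" by auto
  then show ?thesis by (simp add: tail_sum_def)
qed

lemma tail_sum_mono: "i \<le> j \<Longrightarrow> tail_sum j \<le> tail_sum i"
  unfolding tail_sum_def by (intro sum_mono2) auto

lemma tail_sum_le: "tail_sum i \<le> n"
proof -
  have "tail_sum i \<le> tail_sum 0" by (rule tail_sum_mono) simp
  also have "tail_sum 0 = partition_size d \<mu>"
    unfolding tail_sum_def partition_size_def by (rule sum.cong) auto
  finally show ?thesis using size_le by simp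
qed

text \<open>The monomial tuple \<open>(s\<^bsup>\<mu>\<^sub>1 + \<dots> + \<mu>\<^sub>d\<^esup>, \<dots>, s\<^bsup>\<mu>\<^sub>d\<^esup>, 1)\<close>, whose syzygies are spanned by
  \<open>s\<^bsup>\<mu>\<^sub>i\<^esup> e\<^sub>i - e\<^bsub>i-1\<^esub>\<close>.\<close>

lemma parameter_domain_nonempty: "\<exists>w :: nat \<times> nat \<times> nat \<Rightarrow> 'k::field. w \<in> parameter_domain"
proof -
  define b :: "nat \<Rightarrow> 'k poly" where "b = (\<lambda>i. monom 1 (tail_sum i))"
  define a where "a = tuple_of n d b"
  have a: "a \<in> tuples n d" unfolding a_def by (rule tuple_of_tuples)
  have b: "dehom a i = b i" if "i \<le> d" for i
    unfolding a_def by (rule dehom_tuple_of[OF that])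
      (simp add: b_def order_trans[OF degree_monom_le tail_sum_le])
  define \<sigma> :: "nat \<Rightarrow> nat \<Rightarrow> 'k poly" where
    "\<sigma> = (\<lambda>j i. if i = j then monom 1 (\<mu> j) else if Suc i = j then -1 else 0)"
  have \<mu>_pos: "1 \<le> \<mu> i" if "i \<in> {1..d}" for i using parts that by (simp add: partition_parts_def)
  have popov: "popov d \<mu> \<sigma>"
    unfolding popov_def
  proof (intro ballI conjI allI impI)
    fix j i assume j: "j \<in> {1..d}"
    show "degree (\<sigma> j i) \<le> \<mu> j" by (simp add: \<sigma>_def degree_monom_le)
    fix k assume "i \<in> {1..d}" "\<mu> i \<le> k"
    with \<mu>_pos[of i] have "k \<noteq> 0" by auto
    then show "coeff (\<sigma> j i) k = (if i = j \<and> k = \<mu> j then 1 else 0)"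
      by (auto simp: \<sigma>_def coeff_1)
  qed
  have syz: "syzygy d (dehom a) (\<sigma> j)" if j: "j \<in> {1..d}" for j
  proof -
    have "(\<Sum>i\<le>d. \<sigma> j i * dehom a i) =
        (\<Sum>i\<le>d. (if i = j then monom 1 (\<mu> j) * b j else 0) + (if i = j - 1 then - b (j - 1) else 0))"
      by (intro sum.cong refl) (use j in \<open>auto simp: b \<sigma>_def\<close>)
    also have "\<dots> = monom 1 (\<mu> j) * b j - b (j - 1)"
    proof -
      have "j \<le> d" "j - 1 \<le> d" using j by auto
      then show ?thesis by (simp add: sum.distrib)
    qed
    also have "\<dots> = 0" unfolding b_def tail_sum_step[OF j] by (simp add: mult_monom)
    finally show ?thesis by (simp add: syzygy_def)
  qed
  \<comment> \<open>Descending induction on \<open>i\<close>. At the exponent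
    \<open>k + tail_sum i\<close> with \<open>k < \<mu> i\<close> (any \<open>k\<close> for
    \<open>i = 0\<close>), the entries after \<open>i\<close> are already zero, and those before
    \<open>i\<close> are multiplied by powers of at least \<open>\<mu> i + tail_sum i\<close>; only
    coefficient \<open>k\<close> of \<open>x i\<close> is seen.\<close>
  have "x i = 0" if x: "syzygy d (dehom a) x" "below d \<mu> x" and i: "i \<le> d" for x i
    using i
  proof (induction "d - i" arbitrary: i rule: less_induct)
    case less
    have later: "x l = 0" if "i < l" "l \<le> d" for l
      using less that by (intro less.hyps) auto
    have "coeff (x i) k = 0" for k
    proof (cases "i \<in> {1..d} \<and> \<mu> i \<le> k")
      case True
      with x(2) show ?thesis by (simp add: below_def)
    next
      case False
      have "coeff (x l * b l) (k + tail_sum i) = (if l = i then coeff (x i) k else 0)" if l: "l \<le> d" for l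
      proof (cases l i rule: linorder_cases)
        case less
        then have "i \<in> {1..d}" using \<open>i \<le> d\<close> by auto
        then have "k + tail_sum i < tail_sum (i - 1)" using False tail_sum_step by auto
        also have "\<dots> \<le> tail_sum l" by (rule tail_sum_mono) (use less in auto)
        finally show ?thesis using less by (simp add: b_def mult.commute[of _ "monom 1 _"] coeff_monom_mult)
      next
        case equal
        then show ?thesis by (simp add: b_def mult.commute[of _ "monom 1 _"] coeff_monom_mult)
      next
        case greater
        then show ?thesis using later[OF _ l] by simp
      qed
      then have "coeff (\<Sum>l\<le>d. x l * dehom a l) (k + tail_sum i) = coeff (x i) k"
        using less.prems by (simp add: coeff_sum b)
      with x(1) show ?thesis by (simp add: syzygy_def)
    qed
    then show ?case by (simp add: poly_eq_iff)
  qed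
  then have "a \<notin> non_generic identity" unfolding non_generic_identity by blast
  from parametrisation_surjective[OF a this popov syz] show ?thesis by blast
qed

section \<open>Functions separating the parameters\<close>

lemma columns_cong:
  assumes "\<And>q. q \<in> column_index \<Longrightarrow> w q = w' q" "i \<le> d" "j \<in> {1..d}"
  shows "columns w j i = columns w' j i"
  by (rule poly_eqI) (use assms in \<open>simp add: coeff_columns column_index_def\<close>)

text \<open>With the columns fixed, entry \<open>0\<close> is the factor times a fixed minor of
  degree at most \<open>|\<mu>|\<close> whose coefficient there is \<open>1\<close>. If the factors
  agree above \<open>i\<close>, the coefficient at \<open>i + |\<mu>|\<close> of the difference of
  the entries is the difference of the coefficients \<open>i\<close> of the factors.\<close>

lemma separate_factor:
  fixes w\<^sub>0 w' :: "nat \<times> nat \<times> nat \<Rightarrow> 'k::field"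
  assumes i: "i \<le> factor_degree" and cols: "\<And>q. q \<in> column_index \<Longrightarrow> w' q = w\<^sub>0 q"
    and high: "\<And>k. i < k \<Longrightarrow> k \<le> factor_degree \<Longrightarrow> w' (0, 0, k) = w\<^sub>0 (0, 0, k)"
    and diff: "w' (0, 0, i) \<noteq> w\<^sub>0 (0, 0, i)"
  shows "\<exists>f\<in>polynomial_functions (coordinates n d). f (parametrisation w') \<noteq> 0 \<and>
    (\<forall>w. (\<forall>q\<in>column_index. w q = w\<^sub>0 q) \<and> (\<forall>k. i \<le> k \<and> k \<le> factor_degree \<longrightarrow> w (0, 0, k) = w\<^sub>0 (0, 0, k)) \<longrightarrow>
      f (parametrisation w) = 0)"
proof -
  let ?s = "partition_size d \<mu>"
  let ?k = "i + ?s"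
  let ?m = "minor d (columns w\<^sub>0) 0"
  define c where "c = coeff (factor w\<^sub>0 * ?m) ?k"
  define f where "f = (\<lambda>a :: nat \<Rightarrow> 'k poly poly. coeff (coeff (a 0) (n - ?k)) ?k - c)"
  have k: "?k \<le> n" using i size_le by (simp add: factor_degree_def)
  have f: "f (parametrisation w) = coeff ((factor w - factor w\<^sub>0) * ?m) ?k"
    if "\<And>q. q \<in> column_index \<Longrightarrow> w q = w\<^sub>0 q" for w
  proof -
    have "minor d (columns w) = minor d (columns w\<^sub>0)"
      by (rule minor_cong) (rule columns_cong[OF that])
    moreover have "coeff (dehom (parametrisation w) 0) ?k = coeff (coeff (parametrisation w 0) (n - ?k)) ?k"
      using coeff_dehom[OF parametrisation_tuples, of 0 w ?k] k by simp
    ultimately show ?thesis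
      by (simp add: f_def c_def dehom_parametrisation left_diff_distrib)
  qed
  have "f \<in> polynomial_functions (coordinates n d)"
    unfolding f_def
    by (intro polynomial_functions_diff polynomial_functions.const coeff_dehom_polynomial_function k) simp
  moreover have "f (parametrisation w') \<noteq> 0"
  proof -
    have "degree (factor w' - factor w\<^sub>0) \<le> i"
      by (rule degree_le) (simp add: coeff_factor high)
    from coeff_mult_top[OF this degree_minor_columns, of w\<^sub>0 0]
    have "f (parametrisation w') = (w' (0, 0, i) - w\<^sub>0 (0, 0, i)) * coeff ?m ?s"
      using f[OF cols] i by (simp add: coeff_factor)
    moreover have "coeff ?m ?s = 1"
      unfolding partition_size_def by (rule coeff_minor_popov[OF popov_columns])
    ultimately show ?thesis using diff by simp
  qed
  moreover have "f (parametrisation w) = 0" if "\<forall>q\<in>column_index. w q = w\<^sub>0 q"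
    "\<forall>k. i \<le> k \<and> k \<le> factor_degree \<longrightarrow> w (0, 0, k) = w\<^sub>0 (0, 0, k)" for w
  proof -
    have "coeff ((factor w - factor w\<^sub>0) * ?m) ?k = 0"
    proof (rule coeff_mult_eq_0[of i])
      show "coeff (factor w - factor w\<^sub>0) k = 0" if "i \<le> k" for k
        using \<open>\<forall>k. i \<le> k \<and> k \<le> factor_degree \<longrightarrow> _\<close> that by (simp add: coeff_factor)
      show "degree ?m + i \<le> ?k" using degree_minor_columns[of w\<^sub>0 0] by simp
    qed
    with f[of w] that(1) show ?thesis by simp
  qed
  ultimately show ?thesis by blast
qed

text \<open>Over the parameter domain, column \<open>j\<close> is up to scalars the only nonzero
  syzygy of the shape \<open>popov_vector d \<mu> j\<close>. So a prescribed ratio between one of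
  its coefficients and the pivot is a closed condition on the tuple, and it detects whether
  \<open>w q = c\<close>.\<close>

lemma separate_column:
  fixes w' :: "nat \<times> nat \<times> nat \<Rightarrow> 'k::field"
  assumes q: "q \<in> column_index" and w': "w' \<in> parameter_domain" "w' q \<noteq> c"
  shows "\<exists>f\<in>polynomial_functions (coordinates n d). f (parametrisation w') \<noteq> 0 \<and>
    (\<forall>w. w q = c \<longrightarrow> f (parametrisation w) = 0)"
proof -
  obtain i\<^sub>0 j\<^sub>0 k\<^sub>0 where q_eq: "q = (i\<^sub>0, j\<^sub>0, k\<^sub>0)" by (metis prod_cases3)
  have ijk: "i\<^sub>0 \<le> d" "j\<^sub>0 \<in> {1..d}" "k\<^sub>0 \<in> column_support j\<^sub>0 i\<^sub>0"
    using q by (auto simp: q_eq column_index_def)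
  have neq: "\<not> (i\<^sub>0 = j\<^sub>0 \<and> k\<^sub>0 = \<mu> j\<^sub>0)" using ijk by (auto simp: column_support_def)
  \<comment> \<open>The condition \<open>w q = c\<close> made homogeneous by means of the pivot
    coefficient, which is \<open>1\<close> in the normalised column.\<close>
  define \<kappa> where "\<kappa> = (\<lambda>p. (if p = (i\<^sub>0, k\<^sub>0) then 1 else 0) - (if p = (j\<^sub>0, \<mu> j\<^sub>0) then c else 0))"
  let ?I = "vector_index j\<^sub>0"
  have in_I: "(i\<^sub>0, k\<^sub>0) \<in> ?I" "(j\<^sub>0, \<mu> j\<^sub>0) \<in> ?I"
    using ijk by (auto simp: vector_index_def column_support_def)
  have \<kappa>: "(\<Sum>(i, k)\<in>?I. \<kappa> (i, k) * coeff (x i) k) = coeff (x i\<^sub>0) k\<^sub>0 - c * coeff (x j\<^sub>0) (\<mu> j\<^sub>0)"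
    for x :: "nat \<Rightarrow> 'k poly"
  proof -
    have "(\<Sum>(i, k)\<in>?I. \<kappa> (i, k) * coeff (x i) k) =
        (\<Sum>p\<in>?I. (if p = (i\<^sub>0, k\<^sub>0) then coeff (x i\<^sub>0) k\<^sub>0 else 0) -
          (if p = (j\<^sub>0, \<mu> j\<^sub>0) then c * coeff (x j\<^sub>0) (\<mu> j\<^sub>0) else 0))"
      by (intro sum.cong refl) (auto simp: \<kappa>_def left_diff_distrib split: if_splits)
    then show ?thesis using in_I index_finite(3)[of j\<^sub>0] by (simp add: sum_subtractf)
  qed
  define B where "B = {a \<in> tuples n d. \<exists>x. (\<exists>i\<le>d. x i \<noteq> 0) \<and>
    syzygy d (act d (\<lambda>i l. identity l i) (dehom a)) x \<and> (\<forall>i\<le>d. \<forall>k. (i, k) \<notin> ?I \<longrightarrow> coeff (x i) k = 0) \<and>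
    (\<Sum>(i, k)\<in>?I. \<kappa> (i, k) * coeff (x i) k) = 0}"
  have "closedin (zariski n d) B"
    unfolding B_def by (rule closedin_has_syzygy[OF index_finite(3,4)])
  then obtain F where F: "F \<subseteq> polynomial_functions (coordinates n d)" "B = zero_locus (tuples n d) F"
    unfolding zariski_def closedin_zariski by blast
  have B_iff: "a \<in> B \<longleftrightarrow> a \<in> tuples n d \<and> (\<exists>x. (\<exists>i\<le>d. x i \<noteq> 0) \<and> syzygy d (dehom a) x \<and>
      popov_vector d \<mu> j\<^sub>0 x \<and> coeff (x i\<^sub>0) k\<^sub>0 = c * coeff (x j\<^sub>0) (\<mu> j\<^sub>0))" for a
  proof -
    have "syzygy d (act d (\<lambda>i l. identity l i) (dehom a)) x \<longleftrightarrow> syzygy d (dehom a) x" for x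
      by (rule syzygy_cong) (simp_all add: act_identity)
    then show ?thesis unfolding B_def \<kappa> vector_index_iff[OF ijk(2)] by simp
  qed
  have col: "coeff (columns w j\<^sub>0 i\<^sub>0) k\<^sub>0 = w q" "coeff (columns w j\<^sub>0 j\<^sub>0) (\<mu> j\<^sub>0) = 1" for w
    using ijk neq by (auto simp: coeff_columns q_eq column_support_def)
  have "parametrisation w \<in> B" if "w q = c" for w
    unfolding B_iff
  proof (intro conjI exI[of _ "columns w j\<^sub>0"] parametrisation_tuples syzygy_columns ijk(2))
    show "\<exists>i\<le>d. columns w j\<^sub>0 i \<noteq> 0"
      using col(2)[of w] ijk(2) by (intro exI[of _ j\<^sub>0]) auto
    show "popov_vector d \<mu> j\<^sub>0 (columns w j\<^sub>0)"
      unfolding popov_vector_def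
    proof (intro conjI ballI allI impI)
      show "degree (columns w j\<^sub>0 i) \<le> \<mu> j\<^sub>0" if "i \<le> d" for i
        by (rule popov_degree[OF popov_columns ijk(2) that])
      fix i k assume "i \<in> {1..d}" "\<mu> i \<le> k"
      from popov_coeff[OF popov_columns ijk(2) this, of w]
      show "i = j\<^sub>0 \<and> k = \<mu> j\<^sub>0 \<or> coeff (columns w j\<^sub>0 i) k = 0" by (simp split: if_splits)
    qed
    show "coeff (columns w j\<^sub>0 i\<^sub>0) k\<^sub>0 = c * coeff (columns w j\<^sub>0 j\<^sub>0) (\<mu> j\<^sub>0)"
      by (simp add: col that)
  qed
  moreover have "parametrisation w' \<notin> B"
  proof
    assume "parametrisation w' \<in> B"
    then obtain x l where x: "l \<le> d" "x l \<noteq> 0" "syzygy d (dehom (parametrisation w')) x"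
      "popov_vector d \<mu> j\<^sub>0 x" "coeff (x i\<^sub>0) k\<^sub>0 = c * coeff (x j\<^sub>0) (\<mu> j\<^sub>0)"
      unfolding B_iff by blast
    \<comment> \<open>Subtracting \<open>r\<close> times the column removes the pivot coefficient of
      \<open>x\<close>; the difference is a syzygy below \<open>\<mu>\<close>, hence zero, and
      \<open>x\<close> is a multiple of the column.\<close>
    define r where "r = coeff (x j\<^sub>0) (\<mu> j\<^sub>0)"
    define y where "y = (\<lambda>i. x i - Polynomial.smult r (columns w' j\<^sub>0 i))"
    have "(\<Sum>i\<le>d. y i * dehom (parametrisation w') i) =
        (\<Sum>i\<le>d. x i * dehom (parametrisation w') i) -
        Polynomial.smult r (\<Sum>i\<le>d. columns w' j\<^sub>0 i * dehom (parametrisation w') i)"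
      by (simp add: y_def left_diff_distrib sum_subtractf smult_sum_right)
    then have "syzygy d (dehom (parametrisation w')) y"
      using x(3) syzygy_columns[OF ijk(2), of w'] by (simp add: syzygy_def)
    moreover have "below d \<mu> y"
      unfolding below_def
    proof (intro ballI allI impI)
      fix i k assume ik: "i \<in> {1..d}" "\<mu> i \<le> k"
      show "coeff (y i) k = 0"
      proof (cases "i = j\<^sub>0 \<and> k = \<mu> j\<^sub>0")
        case True
        then show ?thesis by (simp add: y_def r_def col)
      next
        case False
        with x(4) ik have "coeff (x i) k = 0" unfolding popov_vector_def by blast
        moreover have "coeff (columns w' j\<^sub>0 i) k = 0"
          using popov_coeff[OF popov_columns ijk(2) ik, of w'] False by (simp only: if_False)
        ultimately show ?thesis by (simp add: y_def)
      qed
    qed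
    ultimately have y: "y i = 0" if "i \<le> d" for i
      using generic_no_below[OF parametrisation_tuples _ popov_columns syzygy_columns] w'(1) that
      unfolding parameter_domain_def by blast
    then have x_eq: "x i = Polynomial.smult r (columns w' j\<^sub>0 i)" if "i \<le> d" for i
      using that by (simp add: y_def)
    have "r * w' q = c * r"
      using x(5) by (simp add: x_eq[OF ijk(1)] col r_def[symmetric])
    then have "r = 0" using w'(2) by (simp add: mult.commute)
    with x_eq[OF x(1)] x(2) show False by simp
  qed
  then obtain f where "f \<in> F" "f (parametrisation w') \<noteq> 0"
    using parametrisation_tuples unfolding F(2) zero_locus_def by blast
  ultimately show ?thesis using F by (auto simp: zero_locus_def)
qed

section \<open>Dimension count\<close>

lemma finite_column_index: "finite column_index"
  and card_column_index: "int (card column_index) = int d * int (partition_size d \<mu>) + int (partition_size d \<mu>) +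
    int d - (\<Sum>(i, j)\<in>{(i, j). 1 \<le> j \<and> j < i \<and> i \<le> d}. max 0 (int (\<mu> i) - int (\<mu> j) - 1))"
proof -
  let ?S = "SIGMA j:{1..d}. SIGMA i:{..d}. column_support j i"
  have img: "column_index = (\<lambda>(j, i, k). (i, j, k)) ` ?S"
    by (force simp: column_index_def)
  have finS: "finite ?S" by (intro finite_SigmaI finite_column_support) auto
  then show "finite column_index" unfolding img by (rule finite_imageI)
  have "card column_index = card ?S"
    unfolding img by (rule card_image) (auto simp: inj_on_def)
  also have "\<dots> = (\<Sum>j=1..d. \<Sum>i\<le>d. card (column_support j i))"
    by (simp add: card_SigmaI finite_column_support)
  \<comment> \<open>Row \<open>0\<close> is bounded only by the column degree
    \<open>\<mu> j\<close>; in row \<open>i \<ge> 1\<close> the exponent must also stay below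
    \<open>\<mu> i\<close>.\<close>
  also have "\<dots> = (\<Sum>j=1..d. \<mu> j + 1 + (\<Sum>i=1..d. min (\<mu> i) (\<mu> j + 1)))"
  proof (intro sum.cong refl)
    fix j
    have "column_support j 0 = {..\<mu> j}" by (auto simp: column_support_def)
    moreover have "column_support j i = {..<min (\<mu> i) (\<mu> j + 1)}" if "i \<in> {1..d}" for i
      using that by (auto simp: column_support_def)
    ultimately show "(\<Sum>i\<le>d. card (column_support j i)) = \<mu> j + 1 + (\<Sum>i=1..d. min (\<mu> i) (\<mu> j + 1))"
      unfolding sum_atMost_split_first by simp
  qed
  also have "\<dots> = partition_size d \<mu> + d + (\<Sum>j=1..d. \<Sum>i=1..d. min (\<mu> i) (\<mu> j + 1))"
    unfolding sum.distrib partition_size_def by simp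
  also have "(\<Sum>j=1..d. \<Sum>i=1..d. min (\<mu> i) (\<mu> j + 1)) = (\<Sum>i=1..d. \<Sum>j=1..d. min (\<mu> i) (\<mu> j + 1))"
    by (rule sum.swap)
  finally have "int (card column_index) = int (partition_size d \<mu>) + int d +
      (\<Sum>i=1..d. \<Sum>j=1..d. int (min (\<mu> i) (\<mu> j + 1)))" by simp
  also have "(\<Sum>i=1..d. \<Sum>j=1..d. int (min (\<mu> i) (\<mu> j + 1))) =
    int d * int (partition_size d \<mu>) - (\<Sum>i=1..d. \<Sum>j\<in>{1..<i}. max 0 (int (\<mu> i) - int (\<mu> j) - 1))"
    unfolding partition_size_def by (rule sum_min_eq) (use parts in \<open>simp add: partition_parts_def\<close>)
  also have "(\<Sum>i=1..d. \<Sum>j\<in>{1..<i}. max 0 (int (\<mu> i) - int (\<mu> j) - 1)) =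
    (\<Sum>(i, j)\<in>(SIGMA i:{1..d}. {1..<i}). max 0 (int (\<mu> i) - int (\<mu> j) - 1))"
    by (rule sum.Sigma) auto
  also have "(SIGMA i:{1..d}. {1..<i}) = {(i, j). 1 \<le> j \<and> j < i \<and> i \<le> d}" by auto
  finally show "int (card column_index) = int d * int (partition_size d \<mu>) + int (partition_size d \<mu>) +
    int d - (\<Sum>(i, j)\<in>{(i, j). 1 \<le> j \<and> j < i \<and> i \<le> d}. max 0 (int (\<mu> i) - int (\<mu> j) - 1))" by simp
qed

lemma stratum_irreducible_dim:
  fixes P :: "(nat \<Rightarrow> 'k::field poly poly) set"
  assumes inf: "infinite (UNIV :: 'k set)" and P: "P = stratum n d \<mu>"
  shows "irreducible_space (subtopology (zariski n d) P)"
    and "krull_dim (subtopology (zariski n d) P) = ereal (real (Suc factor_degree + card column_index))"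
proof -
  let ?D = "Suc factor_degree + card column_index"
  obtain h where h: "bij_betw h {..<card column_index} column_index"
    using ex_bij_betw_nat_finite[OF finite_column_index] by (auto simp: atLeast0LessThan)
  \<comment> \<open>The order matters: the factor coordinates are released first, since separating
    them requires all columns to agree with the base point, whereas a column coordinate is separated
    whatever the other parameters are.\<close>
  define \<xi> where "\<xi> = (\<lambda>k. if k \<le> factor_degree then (0, 0, k) else h (k - Suc factor_degree))"
  have \<xi>_column: "\<xi> k \<in> column_index" if "factor_degree < k" "k < ?D" for k
    using h that by (auto simp: \<xi>_def bij_betw_def)
  have column_\<xi>: "\<exists>k. factor_degree < k \<and> k < ?D \<and> q = \<xi> k" if q: "q \<in> column_index" for q
  proof -
    obtain l where "l < card column_index" "q = h l" using h q by (auto simp: bij_betw_def)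
    then show ?thesis by (intro exI[of _ "l + Suc factor_degree"]) (simp add: \<xi>_def)
  qed
  have "inj_on \<xi> {..<?D}"
  proof (rule inj_onI)
    fix k l assume kl: "k \<in> {..<?D}" "l \<in> {..<?D}" "\<xi> k = \<xi> l"
    have "\<xi> m \<in> column_index \<longleftrightarrow> \<not> m \<le> factor_degree" if "m < ?D" for m
    proof (cases "m \<le> factor_degree")
      case True
      then show ?thesis by (simp add: \<xi>_def column_index_def)
    qed (use \<xi>_column that in simp)
    with kl have "k \<le> factor_degree \<longleftrightarrow> l \<le> factor_degree" by (metis lessThan_iff)
    then show "k = l"
    proof (cases "k \<le> factor_degree")
      case False
      with \<open>k \<le> factor_degree \<longleftrightarrow> l \<le> factor_degree\<close> kl
      have "h (k - Suc factor_degree) = h (l - Suc factor_degree)" by (simp add: \<xi>_def)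
      moreover have "k - Suc factor_degree < card column_index" "l - Suc factor_degree < card column_index"
        using False \<open>k \<le> factor_degree \<longleftrightarrow> l \<le> factor_degree\<close> kl by auto
      ultimately have "k - Suc factor_degree = l - Suc factor_degree"
        using h by (auto simp: bij_betw_def inj_on_def)
      with False \<open>k \<le> factor_degree \<longleftrightarrow> l \<le> factor_degree\<close> show ?thesis by simp
    qed (use kl in \<open>simp add: \<xi>_def\<close>)
  qed
  moreover have "\<xi> ` {..<?D} = parameter_index"
  proof (intro equalityI subsetI)
    fix q assume "q \<in> \<xi> ` {..<?D}"
    then obtain k where k: "k < ?D" "q = \<xi> k" by auto
    show "q \<in> parameter_index"
    proof (cases "k \<le> factor_degree")
      case True
      then show ?thesis by (simp add: k(2) \<xi>_def parameter_index_def)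
    next
      case False
      then have "\<xi> k \<in> column_index" using k(1) by (intro \<xi>_column) simp_all
      then show ?thesis by (simp add: k(2) parameter_index_def)
    qed
  next
    fix q assume "q \<in> parameter_index"
    then consider k where "k \<le> factor_degree" "q = (0, 0, k)" | "q \<in> column_index"
      by (auto simp: parameter_index_def)
    then show "q \<in> \<xi> ` {..<?D}"
    proof cases
      case 1
      then show ?thesis by (intro image_eqI[of _ _ k]) (simp_all add: \<xi>_def)
    next
      case 2
      then show ?thesis using column_\<xi> by blast
    qed
  qed
  ultimately have \<xi>: "bij_betw \<xi> {..<?D} parameter_index" by (simp add: bij_betw_def)
  obtain w\<^sub>0 :: "nat \<times> nat \<times> nat \<Rightarrow> 'k" where w\<^sub>0: "w\<^sub>0 \<in> parameter_domain"
    using parameter_domain_nonempty by blast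
  obtain F where F: "F \<subseteq> polynomial_functions (coordinates n d)"
    "non_generic (identity :: nat \<Rightarrow> nat \<Rightarrow> 'k) = zero_locus (tuples n d) F"
    using closedin_non_generic[of identity] unfolding zariski_def closedin_zariski by blast
  \<comment> \<open>The equations of the non-generic locus pulled back to the parameters; the
    parameter domain is the union of their nonvanishing loci.\<close>
  define Q where "Q = (\<lambda>f w. f (parametrisation w)) ` F"
  have Q: "Q \<subseteq> polynomial_functions (coordinate_functions parameter_index)"
  proof
    fix q assume "q \<in> Q"
    then obtain f where f: "f \<in> polynomial_functions (coordinates n d)" and q: "q = (\<lambda>w. f (parametrisation w))"
      using F(1) unfolding Q_def by auto
    show "q \<in> polynomial_functions (coordinate_functions parameter_index)"
      unfolding q by (rule polynomial_functions_compose[OF f parametrisation_polynomial])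
  qed
  have W: "parameter_domain = {w. \<exists>q\<in>Q. q w \<noteq> 0}"
    unfolding parameter_domain_def F(2) Q_def zero_locus_def by (simp add: parametrisation_tuples)
  have PS: "P \<subseteq> tuples n d" unfolding P by (auto simp: stratum_def CP_def)
  have image: "parametrisation w \<in> P" if "w \<in> parameter_domain" for w
    unfolding P by (rule parametrisation_stratum[OF that])
  have dense: "f a = 0" if "f \<in> polynomial_functions (coordinates n d)"
    "\<And>w. w \<in> parameter_domain \<Longrightarrow> f (parametrisation w) = 0" "a \<in> P" for f a
    by (rule parametrisation_dense[OF inf that(1,2)]) (use that(3) P in auto)
  have sep: "\<exists>f\<in>polynomial_functions (coordinates n d). f (parametrisation w') \<noteq> 0 \<and>
      (\<forall>w\<in>parameter_domain. (\<forall>k. i \<le> k \<and> k < ?D \<longrightarrow> w (\<xi> k) = w\<^sub>0 (\<xi> k)) \<longrightarrow> f (parametrisation w) = 0)"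
    if i: "i < ?D" and w': "w' \<in> parameter_domain" "\<And>k. i < k \<Longrightarrow> k < ?D \<Longrightarrow> w' (\<xi> k) = w\<^sub>0 (\<xi> k)"
      "w' (\<xi> i) \<noteq> w\<^sub>0 (\<xi> i)" for i w'
  proof (cases "i \<le> factor_degree")
    case True
    have cols: "w q = w\<^sub>0 q" if "\<And>k. i < k \<Longrightarrow> k < ?D \<Longrightarrow> w (\<xi> k) = w\<^sub>0 (\<xi> k)" "q \<in> column_index" for w q
      using column_\<xi>[OF that(2)] that(1) True by fastforce
    have high: "w (0, 0, k) = w\<^sub>0 (0, 0, k)" if "k \<le> factor_degree" "w (\<xi> k) = w\<^sub>0 (\<xi> k)" for w k
      using that by (simp add: \<xi>_def)
    have "\<exists>f\<in>polynomial_functions (coordinates n d). f (parametrisation w') \<noteq> 0 \<and>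
      (\<forall>w. (\<forall>q\<in>column_index. w q = w\<^sub>0 q) \<and>
        (\<forall>k. i \<le> k \<and> k \<le> factor_degree \<longrightarrow> w (0, 0, k) = w\<^sub>0 (0, 0, k)) \<longrightarrow> f (parametrisation w) = 0)"
    proof (rule separate_factor[OF True])
      show "w' q = w\<^sub>0 q" if "q \<in> column_index" for q by (rule cols[OF w'(2) that])
      show "w' (0, 0, k) = w\<^sub>0 (0, 0, k)" if "i < k" "k \<le> factor_degree" for k
      proof -
        have "w' (\<xi> k) = w\<^sub>0 (\<xi> k)" by (rule w'(2)) (use that in auto)
        with high[of k w'] that(2) show ?thesis by simp
      qed
      show "w' (0, 0, i) \<noteq> w\<^sub>0 (0, 0, i)" using w'(3) True by (simp add: \<xi>_def)
    qed
    then obtain f where f: "f \<in> polynomial_functions (coordinates n d)" "f (parametrisation w') \<noteq> 0"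
      "\<And>w. (\<forall>q\<in>column_index. w q = w\<^sub>0 q) \<Longrightarrow>
        (\<forall>k. i \<le> k \<and> k \<le> factor_degree \<longrightarrow> w (0, 0, k) = w\<^sub>0 (0, 0, k)) \<Longrightarrow> f (parametrisation w) = 0" by blast
    have "f (parametrisation w) = 0" if w: "\<forall>k. i \<le> k \<and> k < ?D \<longrightarrow> w (\<xi> k) = w\<^sub>0 (\<xi> k)" for w
    proof (rule f(3))
      show "\<forall>q\<in>column_index. w q = w\<^sub>0 q"
      proof
        fix q assume "q \<in> column_index"
        then show "w q = w\<^sub>0 q" by (rule cols[rotated]) (use w in auto)
      qed
      show "\<forall>k. i \<le> k \<and> k \<le> factor_degree \<longrightarrow> w (0, 0, k) = w\<^sub>0 (0, 0, k)"
      proof (intro allI impI)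
        fix k assume k: "i \<le> k \<and> k \<le> factor_degree"
        then have "w (\<xi> k) = w\<^sub>0 (\<xi> k)" using w by auto
        with k show "w (0, 0, k) = w\<^sub>0 (0, 0, k)" by (intro high) auto
      qed
    qed
    with f(1,2) show ?thesis by (intro bexI[of _ f]) simp_all
  next
    case False
    then have "\<xi> i \<in> column_index" using i by (intro \<xi>_column) simp_all
    from separate_column[OF this w'(1,3)] obtain f where f: "f \<in> polynomial_functions (coordinates n d)"
      "f (parametrisation w') \<noteq> 0" "\<And>w. w (\<xi> i) = w\<^sub>0 (\<xi> i) \<Longrightarrow> f (parametrisation w) = 0" by auto
    then show ?thesis using i by (intro bexI[of _ f]) simp_all
  qed
  note krull = krull_dim_parametrised[where S = "tuples n d" and C = "coordinates n d" and P = P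
      and \<psi> = parametrisation and X = parameter_index and Q = Q and W = parameter_domain
      and w\<^sub>0 = w\<^sub>0 and \<xi> = \<xi> and D = ?D]
  show "irreducible_space (subtopology (zariski n d) P)"
    unfolding zariski_def
    by (rule krull(1)) (fact inf PS parametrisation_polynomial Q W image dense w\<^sub>0 \<xi> sep)+
  show "krull_dim (subtopology (zariski n d) P) = ereal (real ?D)"
    unfolding zariski_def
    by (rule krull(2)) (fact inf PS parametrisation_polynomial Q W image dense w\<^sub>0 \<xi> sep)+
qed

end

theorem theorem3p13:
  fixes n d :: nat and \<mu> :: "nat \<Rightarrow> nat" and P :: "(nat \<Rightarrow> 'k::field poly poly) set"
  assumes "infinite (UNIV :: 'k set)"
    and "2 \<le> d" and "d \<le> n"
    and "partition_parts d \<mu>"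
    and "d \<le> partition_size d \<mu>" and "partition_size d \<mu> \<le> n"
    and "P = stratum n d \<mu>"
  shows "(\<exists>V. closedin (zariski n d) V \<and> openin (subtopology (zariski n d) V) P) \<and>
    irreducible_space (subtopology (zariski n d) P) \<and>
    krull_dim (subtopology (zariski n d) P) =
      ereal (of_int (int d * int (partition_size d \<mu>) + int d + int n + 1
        - (\<Sum>(i, j)\<in>{(i, j). 1 \<le> j \<and> j < i \<and> i \<le> d}. max 0 (int (\<mu> i) - int (\<mu> j) - 1))))"
proof -
  interpret mu_stratum n d \<mu> using assms(2,4,6) by unfold_locales auto
  \<comment> \<open>The factor contributes \<open>n - |\<mu>| + 1\<close> coordinates, which cancels
    the summand \<open>|\<mu>|\<close> that row \<open>0\<close> adds to the column count.\<close>
  have "int (Suc factor_degree + card column_index) = int d * int (partition_size d \<mu>) + int d + int n + 1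
      - (\<Sum>(i, j)\<in>{(i, j). 1 \<le> j \<and> j < i \<and> i \<le> d}. max 0 (int (\<mu> i) - int (\<mu> j) - 1))"
    using card_column_index size_le by (simp add: factor_degree_def of_nat_diff)
  from arg_cong[OF this, of real_of_int]
  have dim: "real (Suc factor_degree + card column_index) =
      of_int (int d * int (partition_size d \<mu>) + int d + int n + 1
      - (\<Sum>(i, j)\<in>{(i, j). 1 \<le> j \<and> j < i \<and> i \<le> d}. max 0 (int (\<mu> i) - int (\<mu> j) - 1)))"
    by (simp only: of_int_of_nat_eq)
  show ?thesis
    using stratum_locally_closed[OF assms(7)] stratum_irreducible_dim[OF assms(1,7)]
    unfolding dim by (intro conjI)
qed

end
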